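(* Let $n=2m$ be even, $G=SO_0(2m-1,1)$, $K\simeq SO(2m-1)$, and let $(\tau_\lambda,V_\lambda)$ be an irreducible representation of $K$ with highest weight $\lambda$. There exists a constant $d_\lambda$, depending on $\lambda$ but not on $Q\in GT(\lambda)$ nor on $\phi_{\tau_\lambda}$, such that for every $\phi_{\tau_\lambda}(g)=\sum_{Q\in GT(\lambda)}c(Q;g)\,Q\in C^\infty_{\tau_\lambda}(K\backslash G)$, \begin{align*} d_\lambda\,L(\mathbb{PF}_{2m})\phi_{\tau_\lambda}(g) &=\sum_{Q\in GT(\lambda)}\Big\{\big(L(H)-m+1\big)c(Q;g)\,\varpi_0Q+\sum_{i=1}^{2m-2}L(X_i)c(Q;g)\,[\varpi_0,A_{2m-1,i}]Q\Big\}\\ &=P_0\phi_{\tau_\lambda}(g). \end{align*}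
   Context: Lie algebra and group: $E_{i,j}$ are the $n\times n$ matrix units, $A_{j,i}=E_{j,i}-E_{i,j}$, $\mathfrak g=\mathfrak{so}_n$ is the complex Lie algebra of skew-symmetric matrices. $G=SO_0(n-1,1)$ is realized as the identity component of $\{g\in SO(n,\mathbb{C}): I_{n-1,1}\overline{g}I_{n-1,1}=g\}$, $I_{n-1,1}=\mathrm{diag}(1,\dots,1,-1)$; $K\simeq SO(n-1)$ is the maximal compact subgroup fixed by $\theta(g)=I_{n-1,1}gI_{n-1,1}$; $\mathfrak k$ is spanned by $A_{j,i}$, $i<j\le n-1$, and $\mathfrak p$ by $\sqrt{-1}A_{n,i}$, $1\le i\le n-1$. $H=\sqrt{-1}A_{n,n-1}$, $X_i=A_{n-1,i}+\sqrt{-1}A_{n,i}$ ($1\le i\le n-2$). Functions: for a finite-dimensional representation $(\tau,V)$ of $K$, $C^\infty_\tau(K\backslash G)$ is the space of smooth $f:G\to V$ with $f(kg)=\tau(k)f(g)$. $L$ is the left regular representation, $L(W)f(g)=\frac{d}{dt}\big|_{0}f(\exp(-tW)g)$, extended complex linearly and to $U(\mathfrak g)$. $GT(\lambda)$ is the Gelfand–Tsetlin basis of $V_\lambda$, and $c(Q;g)$ are the coefficient functions. Shift operator: $V_\lambda\otimes\mathfrak p$ ($K$ acting on $\mathfrak p$ by $\mathrm{Ad}$) is multiplicity free. $\mathrm{pr}_0:V_\lambda\otimes\mathfrak p\to V_{\lambda}$ is the $K$-equivariant projection onto the component isomorphic to $V_\lambda$ (a fixed nonzero $K$-map if $V_\lambda$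 occurs in $V_\lambda\otimes\mathfrak p$, zero otherwise). Put $\nabla\phi(g)=\sum_{i=1}^{n-1}L(\sqrt{-1}A_{n,i})\phi(g)\otimes\sqrt{-1}A_{n,i}$ and $P_0=\mathrm{pr}_0\circ\nabla$. The operator $\varpi_0:V_\lambda\to V_\lambda$ is $\varpi_0Q=\mathrm{pr}_0(Q\otimes\sqrt{-1}A_{n,n-1})$, and $[\varpi_0,A]=\varpi_0\tau_\lambda(A)-\tau_\lambda(A)\varpi_0$ for $A\in\mathfrak k$. Pfaffian: for distinct positive integers, $\mathrm{Pf}_2(i_2,i_1)=A_{i_2,i_1}$ and $\mathrm{Pf}_{2k}(i_{2k},\dots,i_1)=\sum_{j=1}^{2k-1}(-1)^{j+1}A_{i_{2k},i_j}\mathrm{Pf}_{2k-2}(i_{2k-1},\dots,\widehat{i_j},\dots,i_1)$ in the enveloping algebra; $\mathbb{PF}_{2k}=\mathrm{Pf}_{2k}(2k,2k-1,\dots,1)$. *)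

theory Defs
  imports "HOL-Analysis.Analysis" "HOL-Library.Poly_Mapping"
begin

text \<open>
  Matrices of size $n$ are elements of \<open>complex^'n^'n\<close> with $n = $ \<open>CARD('n)\<close>; the linear order on
  \<open>'n\<close> serves only to number the rows and columns by $1, \dots, n$.
\<close>

section \<open>Matrices\<close>

type_synonym 'n cmat = "complex^'n^'n"

definition idx :: "nat \<Rightarrow> 'n::{finite,linorder}" where
  "idx i = sorted_list_of_set UNIV ! (i - 1)"

lemma bij_betw_idx: "bij_betw (idx :: nat \<Rightarrow> 'n::{finite,linorder}) {1..CARD('n)} UNIV"
proof -
  let ?l = "sorted_list_of_set (UNIV :: 'n set)"
  have "bij_betw (\<lambda>i. i - 1) {1..CARD('n)} {..<CARD('n)}"
    by (rule bij_betw_byWitness[where f' = Suc]) auto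
  moreover have "bij_betw ((!) ?l) {..<CARD('n)} UNIV"
    by (rule bij_betw_nth) auto
  ultimately have "bij_betw ((!) ?l \<circ> (\<lambda>i. i - 1)) {1..CARD('n)} UNIV"
    by (rule bij_betw_trans)
  then show ?thesis by (simp add: idx_def[abs_def] comp_def)
qed

definition cscale :: "complex \<Rightarrow> complex^'n^'m \<Rightarrow> complex^'n^'m" where
  "cscale c X = (\<chi> a b. c * X $ a $ b)"

definition cnj_mat :: "complex^'n^'m \<Rightarrow> complex^'n^'m" where
  "cnj_mat X = (\<chi> a b. cnj (X $ a $ b))"

definition bracket :: "('n::finite) cmat \<Rightarrow> 'n cmat \<Rightarrow> 'n cmat" where
  "bracket X Y = X ** Y - Y ** X"

primrec mat_pow :: "('n::finite) cmat \<Rightarrow> nat \<Rightarrow> 'n cmat" where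
  "mat_pow X 0 = mat 1"
| "mat_pow X (Suc k) = X ** mat_pow X k"

definition mat_exp :: "('n::finite) cmat \<Rightarrow> 'n cmat" where
  "mat_exp X = suminf (\<lambda>k. mat_pow X k /\<^sub>R fact k)"

definition E_mat :: "nat \<Rightarrow> nat \<Rightarrow> ('n::{finite,linorder}) cmat" where
  "E_mat i j = (\<chi> a b. if a = idx i \<and> b = idx j then 1 else 0)"

definition A_mat :: "nat \<Rightarrow> nat \<Rightarrow> ('n::{finite,linorder}) cmat" where
  "A_mat j i = E_mat j i - E_mat i j"

section \<open>The groups and their Lie algebras\<close>

definition I_mat :: "('n::{finite,linorder}) cmat" where
  "I_mat = (\<chi> a b. if a = b then (if a = idx CARD('n) then - 1 else 1) else 0)"

definition theta :: "('n::{finite,linorder}) cmat \<Rightarrow> 'n cmat" where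
  "theta X = I_mat ** X ** I_mat"

definition G_grp :: "(('n::{finite,linorder}) cmat) set" where
  "G_grp = connected_component_set
     {g. transpose g ** g = mat 1 \<and> det g = 1 \<and> I_mat ** cnj_mat g ** I_mat = g} (mat 1)"

definition K_grp :: "(('n::{finite,linorder}) cmat) set" where
  "K_grp = {g \<in> G_grp. theta g = g}"

definition k_alg :: "(('n::{finite,linorder}) cmat) set" where
  "k_alg = {X. transpose X = - X \<and> theta X = X}"

definition p_alg :: "(('n::{finite,linorder}) cmat) set" where
  "p_alg = {X. transpose X = - X \<and> theta X = - X}"

text \<open>
  The Lie algebra of $G$ is the real form of the skew-symmetric matrices fixed by the conjugation
  $W \mapsto I_{n-1,1} \overline W I_{n-1,1}$.  Every skew-symmetric $W$ is $U + \sqrt{-1}\, V$ for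
  unique $U$, $V$ in the real form, given here by \<open>re_form W\<close> and \<open>im_form W\<close>.
\<close>

definition re_form :: "('n::{finite,linorder}) cmat \<Rightarrow> 'n cmat" where
  "re_form W = cscale (1 / 2) (W + I_mat ** cnj_mat W ** I_mat)"

definition im_form :: "('n::{finite,linorder}) cmat \<Rightarrow> 'n cmat" where
  "im_form W = cscale (1 / (2 * \<i>)) (W - I_mat ** cnj_mat W ** I_mat)"

lemma re_form_im_form: "re_form W + cscale \<i> (im_form W) = W"
  by (simp add: re_form_def im_form_def cscale_def vec_eq_iff field_simps)

definition H_mat :: "('n::{finite,linorder}) cmat" where
  "H_mat = cscale \<i> (A_mat CARD('n) (CARD('n) - 1))"

definition X_mat :: "nat \<Rightarrow> ('n::{finite,linorder}) cmat" where
  "X_mat i = A_mat (CARD('n) - 1) i + cscale \<i> (A_mat CARD('n) i)"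

section \<open>Representations of $K$\<close>

text \<open>
  A finite-dimensional complex representation is written in coordinates, as a continuous matrix
  representation on \<open>complex^'d\<close>, which plays the role of $V$.
\<close>

definition K_rep :: "(('n::{finite,linorder}) cmat \<Rightarrow> ('d::finite) cmat) \<Rightarrow> bool" where
  "K_rep \<tau> \<longleftrightarrow> \<tau> (mat 1) = mat 1 \<and> (\<forall>g\<in>K_grp. \<forall>h\<in>K_grp. \<tau> (g ** h) = \<tau> g ** \<tau> h) \<and>
     continuous_on K_grp \<tau>"

definition irreducible_under ::
  "(('n::finite) cmat) set \<Rightarrow> ('n cmat \<Rightarrow> 'd cmat) \<Rightarrow> (complex^'d) set \<Rightarrow> bool" where
  "irreducible_under M \<tau> U \<longleftrightarrow> vec.subspace U \<and> U \<noteq> {0} \<and> (\<forall>k\<in>M. \<forall>v\<in>U. \<tau> k *v v \<in> U) \<and>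
     (\<forall>S. vec.subspace S \<and> S \<subseteq> U \<and> (\<forall>k\<in>M. \<forall>v\<in>S. \<tau> k *v v \<in> S) \<longrightarrow> S = {0} \<or> S = U)"

definition irreducible_K_rep ::
  "(('n::{finite,linorder}) cmat \<Rightarrow> ('d::finite) cmat) \<Rightarrow> bool" where
  "irreducible_K_rep \<tau> \<longleftrightarrow> K_rep \<tau> \<and> irreducible_under K_grp \<tau> UNIV"

text \<open>The differential of \<open>\<tau>\<close>, extended complex linearly from the real form to \<open>k_alg\<close>.\<close>

definition drep_real ::
  "(('n::finite) cmat \<Rightarrow> ('d::finite) cmat) \<Rightarrow> 'n cmat \<Rightarrow> 'd cmat" where
  "drep_real \<tau> W = vector_derivative (\<lambda>t. \<tau> (mat_exp (t *\<^sub>R W))) (at 0)"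

definition drep ::
  "(('n::{finite,linorder}) cmat \<Rightarrow> ('d::finite) cmat) \<Rightarrow> 'n cmat \<Rightarrow> 'd cmat" where
  "drep \<tau> W = drep_real \<tau> (re_form W) + cscale \<i> (drep_real \<tau> (im_form W))"

text \<open>
  For even $n = 2m$, so that $K \simeq SO(2m-1)$ has rank $m - 1$: the elements
  $\sqrt{-1} A_{2j,2j-1}$ with $1 \le j \le m-1$ span a Cartan subalgebra of $\mathfrak k$, weights
  are tuples of eigenvalues of these elements, and the positive roots are the lexicographically
  positive ones, i.e. $\varepsilon_i \pm \varepsilon_j$ ($i < j$) and $\varepsilon_i$.
\<close>

definition cartan :: "nat \<Rightarrow> ('n::{finite,linorder}) cmat" where
  "cartan j = cscale \<i> (A_mat (2 * j) (2 * j - 1))"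

definition pos_root_vector :: "('n::{finite,linorder}) cmat \<Rightarrow> bool" where
  "pos_root_vector X \<longleftrightarrow> X \<in> k_alg \<and>
     (\<exists>\<alpha> :: nat \<Rightarrow> int.
        (\<forall>j\<in>{1..CARD('n) div 2 - 1}. bracket (cartan j) X = cscale (of_int (\<alpha> j)) X) \<and>
        (\<exists>j\<in>{1..CARD('n) div 2 - 1}. \<alpha> j > 0 \<and> (\<forall>l\<in>{1..<j}. \<alpha> l = 0)))"

definition highest_weight ::
  "(('n::{finite,linorder}) cmat \<Rightarrow> ('d::finite) cmat) \<Rightarrow> (nat \<Rightarrow> int) \<Rightarrow> bool" where
  "highest_weight \<tau> lam \<longleftrightarrow> (\<exists>v. v \<noteq> 0 \<and>
     (\<forall>j\<in>{1..CARD('n) div 2 - 1}. drep \<tau> (cartan j) *v v = of_int (lam j) *s v) \<and>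
     (\<forall>X. pos_root_vector X \<longrightarrow> drep \<tau> X *v v = 0))"

text \<open>
  \<open>SO_sub p\<close> is the copy of $SO(p)$ in $K$ acting on the first $p$ coordinates.  A Gelfand--Tsetlin
  basis is a basis adapted to the chain $SO(2) \subset SO(3) \subset \dots \subset SO(n-1)$: each basis vector
  generates an irreducible representation of every member of the chain.  Since the branching laws
  are multiplicity free, this determines the basis up to rescaling its vectors; no particular
  normalization is imposed.
\<close>

definition SO_sub :: "nat \<Rightarrow> (('n::{finite,linorder}) cmat) set" where
  "SO_sub p = {k \<in> K_grp. \<forall>j\<in>{p<..CARD('n)}. k *v axis (idx j) 1 = axis (idx j) 1}"

definition GT_basis ::
  "(('n::{finite,linorder}) cmat \<Rightarrow> 'd cmat) \<Rightarrow> (complex^'d) set \<Rightarrow> bool" where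
  "GT_basis \<tau> B \<longleftrightarrow> vec.independent B \<and> vec.span B = UNIV \<and>
     (\<forall>Q\<in>B. \<forall>p\<in>{2..CARD('n) - 1}.
        irreducible_under (SO_sub p) \<tau> (vec.span ((\<lambda>k. \<tau> k *v Q) ` SO_sub p)))"

section \<open>The tensor product of $V$ and $\mathfrak p$\<close>

text \<open>
  $V \otimes \mathfrak p$ is realized inside $V \otimes M_n(\mathbb{C})$, whose elements are the
  arrays \<open>complex^('d \<times> 'n \<times> 'n)\<close>.
\<close>

definition tensor :: "complex^'d \<Rightarrow> ('n::finite) cmat \<Rightarrow> complex^('d \<times> 'n \<times> 'n)" where
  "tensor v X = vec_lambda (\<lambda>(r, a, b). v $ r * X $ a $ b)"

definition tensor_p :: "(complex^(('d::finite) \<times> 'n \<times> 'n::{finite,linorder})) set" where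
  "tensor_p = vec.span {tensor v X | v X. X \<in> p_alg}"

definition Ad :: "('n::finite) cmat \<Rightarrow> 'n cmat \<Rightarrow> 'n cmat" where
  "Ad k X = k ** X ** matrix_inv k"

definition tensor_act :: "(('n::finite) cmat \<Rightarrow> ('d::finite) cmat) \<Rightarrow> 'n cmat \<Rightarrow>
    complex^('d \<times> 'n \<times> 'n) \<Rightarrow> complex^('d \<times> 'n \<times> 'n)" where
  "tensor_act \<tau> k T = vec_lambda (\<lambda>(r, a, b). \<Sum>r'\<in>UNIV. \<Sum>a'\<in>UNIV. \<Sum>b'\<in>UNIV.
     \<tau> k $ r $ r' * k $ a $ a' * matrix_inv k $ b' $ b * T $ (r', a', b'))"

lemma tensor_act_tensor: "tensor_act \<tau> k (tensor v X) = tensor (\<tau> k *v v) (Ad k X)"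
proof -
  have "(\<Sum>r'\<in>UNIV. \<Sum>a'\<in>UNIV. \<Sum>b'\<in>UNIV.
          \<tau> k $ r $ r' * k $ a $ a' * matrix_inv k $ b' $ b * (v $ r' * X $ a' $ b'))
        = (\<Sum>r'\<in>UNIV. \<tau> k $ r $ r' * v $ r') *
          (\<Sum>b'\<in>UNIV. (\<Sum>a'\<in>UNIV. k $ a $ a' * X $ a' $ b') * matrix_inv k $ b' $ b)" for r a b
  proof -
    have eq: "(\<Sum>b'\<in>UNIV. (\<Sum>a'\<in>UNIV. k $ a $ a' * X $ a' $ b') * matrix_inv k $ b' $ b)
        = (\<Sum>a'\<in>UNIV. \<Sum>b'\<in>UNIV. k $ a $ a' * X $ a' $ b' * matrix_inv k $ b' $ b)"
      by (subst sum.swap) (simp add: sum_distrib_right)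
    show ?thesis
      unfolding eq sum_product by (simp add: sum_distrib_left mult_ac)
  qed
  then show ?thesis
    by (simp add: tensor_act_def tensor_def Ad_def matrix_matrix_mult_def matrix_vector_mult_def
        vec_eq_iff)
qed

definition linear_on_sub ::
  "(complex^'a) set \<Rightarrow> (complex^'a \<Rightarrow> complex^'b) \<Rightarrow> bool" where
  "linear_on_sub S f \<longleftrightarrow> (\<forall>x\<in>S. \<forall>y\<in>S. f (x + y) = f x + f y) \<and> (\<forall>c. \<forall>x\<in>S. f (c *s x) = c *s f x)"

text \<open>\<open>V_occurs \<tau>\<close>: some $K$-subrepresentation of $V \otimes \mathfrak p$ is isomorphic to $V$.\<close>

definition V_occurs :: "(('n::{finite,linorder}) cmat \<Rightarrow> ('d::finite) cmat) \<Rightarrow> bool" where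
  "V_occurs \<tau> \<longleftrightarrow> (\<exists>J :: complex^'d \<Rightarrow> complex^('d \<times> 'n \<times> 'n).
     linear_on_sub UNIV J \<and> inj J \<and> range J \<subseteq> tensor_p \<and>
     (\<forall>k\<in>K_grp. \<forall>v. J (\<tau> k *v v) = tensor_act \<tau> k (J v)))"

text \<open>The values of \<open>pr0\<close> outside \<open>tensor_p\<close> are irrelevant.\<close>

definition is_pr0 :: "(('n::{finite,linorder}) cmat \<Rightarrow> 'd cmat) \<Rightarrow>
    (complex^('d \<times> 'n \<times> 'n) \<Rightarrow> complex^'d) \<Rightarrow> bool" where
  "is_pr0 \<tau> pr0 \<longleftrightarrow> linear_on_sub tensor_p pr0 \<and>
     (\<forall>k\<in>K_grp. \<forall>T\<in>tensor_p. pr0 (tensor_act \<tau> k T) = \<tau> k *v pr0 T) \<and>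
     (if V_occurs \<tau> then \<exists>T\<in>tensor_p. pr0 T \<noteq> 0 else \<forall>T\<in>tensor_p. pr0 T = 0)"

definition varpi0 ::
  "(complex^('d \<times> 'n \<times> 'n::{finite,linorder}) \<Rightarrow> complex^'d) \<Rightarrow> complex^'d \<Rightarrow> complex^'d" where
  "varpi0 pr0 Q = pr0 (tensor Q H_mat)"

definition varpi0_comm :: "(('n::{finite,linorder}) cmat \<Rightarrow> 'd cmat) \<Rightarrow>
    (complex^('d \<times> 'n \<times> 'n) \<Rightarrow> complex^'d) \<Rightarrow> 'n cmat \<Rightarrow> complex^'d \<Rightarrow> complex^'d" where
  "varpi0_comm \<tau> pr0 A Q = varpi0 pr0 (drep \<tau> A *v Q) - drep \<tau> A *v varpi0 pr0 Q"

section \<open>Smooth equivariant functions\<close>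

primrec Ck_on ::
  "nat \<Rightarrow> ('a::real_normed_vector) set \<Rightarrow> ('a \<Rightarrow> 'b::real_normed_vector) \<Rightarrow> bool" where
  "Ck_on 0 S f \<longleftrightarrow> continuous_on S f"
| "Ck_on (Suc k) S f \<longleftrightarrow> (\<forall>x\<in>S. f differentiable (at x)) \<and>
     (\<forall>v. Ck_on k S (\<lambda>x. frechet_derivative f (at x) v))"

text \<open>
  $G$ is an embedded submanifold of the space of matrices, so a function on $G$ is smooth iff it
  locally extends to a smooth function on an open set of matrices.  Functions on $G$ are total
  functions on matrices of which only the values on $G$ matter.
\<close>

definition smooth_on_G ::
  "(('n::{finite,linorder}) cmat \<Rightarrow> 'b::real_normed_vector) \<Rightarrow> bool" where
  "smooth_on_G f \<longleftrightarrow> (\<forall>g\<in>G_grp. \<exists>U F. open U \<and> g \<in> U \<and> (\<forall>k. Ck_on k U F) \<and>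
     (\<forall>x\<in>U \<inter> G_grp. F x = f x))"

definition C_infty :: "(('n::{finite,linorder}) cmat \<Rightarrow> 'd cmat) \<Rightarrow>
    ('n cmat \<Rightarrow> complex^'d) set" where
  "C_infty \<tau> = {f. smooth_on_G f \<and> (\<forall>k\<in>K_grp. \<forall>g\<in>G_grp. f (k ** g) = \<tau> k *v f g)}"

section \<open>The left regular representation\<close>

text \<open>
  In what follows \<open>sc\<close> is the complex scalar multiplication of the space in which the functions
  take their values.
\<close>

definition lreg_real ::
  "('n::finite) cmat \<Rightarrow> ('n cmat \<Rightarrow> 'b::real_normed_vector) \<Rightarrow> 'n cmat \<Rightarrow> 'b" where
  "lreg_real W f g = vector_derivative (\<lambda>t. f (mat_exp ((- t) *\<^sub>R W) ** g)) (at 0)"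

definition lreg :: "(complex \<Rightarrow> 'b \<Rightarrow> 'b) \<Rightarrow> ('n::{finite,linorder}) cmat \<Rightarrow>
    ('n cmat \<Rightarrow> 'b::real_normed_vector) \<Rightarrow> 'n cmat \<Rightarrow> 'b" where
  "lreg sc W f g = lreg_real (re_form W) f g + sc \<i> (lreg_real (im_form W) f g)"

text \<open>
  Elements of $U(\mathfrak g)$ are represented by elements of the free associative algebra
  $\mathbb{C}\langle \mathfrak g\rangle$, of which $U(\mathfrak g)$ is a quotient: finitely supported
  complex combinations of words, multiplied by concatenation of words.  The extension of $L$ to an
  action of $\mathbb{C}\langle \mathfrak g\rangle$ on smooth functions by $L(uv) = L(u)L(v)$ factors
  through $U(\mathfrak g)$, as $L$ is a representation of $\mathfrak g$ on smooth functions.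
\<close>

datatype 'a word = Word (letters: "'a list")

instantiation word :: (type) monoid_add
begin

definition zero_word :: "'a word" where "0 = Word []"

definition plus_word :: "'a word \<Rightarrow> 'a word \<Rightarrow> 'a word" where
  "u + v = Word (letters u @ letters v)"

instance
  by standard (simp_all add: zero_word_def plus_word_def)

end

type_synonym 'n env = "('n cmat) word \<Rightarrow>\<^sub>0 complex"

definition gen :: "('n::finite) cmat \<Rightarrow> 'n env" where
  "gen X = Poly_Mapping.single (Word [X]) 1"

primrec lreg_word :: "(complex \<Rightarrow> 'b \<Rightarrow> 'b) \<Rightarrow> (('n::{finite,linorder}) cmat) list \<Rightarrow>
    ('n cmat \<Rightarrow> 'b::real_normed_vector) \<Rightarrow> 'n cmat \<Rightarrow> 'b" where
  "lreg_word sc [] f = f"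
| "lreg_word sc (X # w) f = lreg sc X (lreg_word sc w f)"

definition lreg_env :: "(complex \<Rightarrow> 'b \<Rightarrow> 'b) \<Rightarrow> ('n::{finite,linorder}) env \<Rightarrow>
    ('n cmat \<Rightarrow> 'b::real_normed_vector) \<Rightarrow> 'n cmat \<Rightarrow> 'b" where
  "lreg_env sc u f g = (\<Sum>w\<in>Poly_Mapping.keys u. sc (Poly_Mapping.lookup u w) (lreg_word sc (letters w) f g))"

text \<open>
  \<open>Pf k i\<close> is $\mathrm{Pf}_{2k}(i_{2k}, \dots, i_1)$.  The index function of the inner Pfaffian lists
  $i_{2k+1}, \dots, \widehat{i_j}, \dots, i_1$, and the value $1$ at $k = 0$ amounts to
  $\mathrm{Pf}_2(i_2, i_1) = A_{i_2,i_1}$.  \<open>PF k\<close> is $\mathbb{PF}_{2k}$.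
\<close>

primrec Pf :: "nat \<Rightarrow> (nat \<Rightarrow> nat) \<Rightarrow> ('n::{finite,linorder}) env" where
  "Pf 0 i = 1"
| "Pf (Suc k) i = (\<Sum>j=1..2*k+1. (- 1) ^ (j + 1) * gen (A_mat (i (2*k+2)) (i j)) *
     Pf k (\<lambda>l. if l < j then i l else i (l + 1)))"

lemma Pf_2: "Pf 1 i = gen (A_mat (i 2) (i 1))"
  by (simp add: numeral_2_eq_2)

definition PF :: "nat \<Rightarrow> ('n::{finite,linorder}) env" where
  "PF k = Pf k (\<lambda>l. l)"

section \<open>The shift operator\<close>

definition nabla :: "(('n::{finite,linorder}) cmat \<Rightarrow> complex^'d) \<Rightarrow> 'n cmat \<Rightarrow>
    complex^('d \<times> 'n \<times> 'n)" where
  "nabla \<phi> g = (\<Sum>i=1..CARD('n) - 1.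
     tensor (lreg (*s) (cscale \<i> (A_mat CARD('n) i)) \<phi> g) (cscale \<i> (A_mat CARD('n) i)))"

definition P0 :: "(complex^('d \<times> 'n \<times> 'n) \<Rightarrow> complex^'d) \<Rightarrow>
    (('n::{finite,linorder}) cmat \<Rightarrow> complex^'d) \<Rightarrow> 'n cmat \<Rightarrow> complex^'d" where
  "P0 pr0 \<phi> g = pr0 (nabla \<phi> g)"

end

theory Submission
  imports Defs
begin

text \<open>
  A $K$-map $V \otimes \mathfrak p \to V$ amounts to operators $B_1, \dots, B_{n-1}$ on $V$ that transform
  under $\mathfrak{so}_{n-1}$ like the coordinates of a vector: $B_a v$ is the image of
  $v \otimes \sqrt{-1} A_{n,a}$.  The signed Pfaffians $(-1)^{a+1} \mathrm{Pf}(n-1, \dots, \widehat a, \dots, 1)$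
  of the operators $\tau(A_{x,y})$ are another such family.  On an irreducible module with highest weight
  vector $v$ a family is determined by the scalar by which $B_{n-1}$ acts on $v$: if it is $0$, then the
  images of $v \otimes x$, for the weight vectors $x$ of $\mathfrak p$ in decreasing order, are one after the
  other highest weight vectors of a weight other than $\lambda$, hence $0$.  For the Pfaffians the scalar is
  $(-\sqrt{-1})^{m-1} \prod_j (\lambda_j + m - 1 - j)$, which vanishes only if $\lambda_{m-1} = 0$; in that
  case the scalar of every family vanishes.  So every family is a multiple of the Pfaffians, and expanding
  $\mathbb{PF}_{2m}$ along its first row, with $L(W) \phi = - \tau(W) \phi$ for $W \in \mathfrak k$, gives
  $P_0 \phi$.  The expression in the middle is a rewriting of $P_0 \phi$: one has
  $[\varpi_0, A_{n-1,i}] = B_i$, and $\sum_i B_i \tau(A_{n-1,i}) = - (m-1) \varpi_0$ because the Casimir operator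
  $\sum \tau(A_{x,y})^2$ is a scalar and so commutes with $\varpi_0$.
\<close>

section \<open>Pfaffians in the enveloping algebra\<close>

text \<open>The argument lives in the Lie algebra, whereas \<tau> is only a continuous matrix
  representation of K, irreducible under K. So its differential has to be shown to exist, to be
  linear and to respect brackets, and irreducibility has to be carried over to the operators
  \<tau>(A_{x,y}). A subspace stable under these operators is stable under their exponentials; hence
  it suffices that plane rotations generate K, which is elimination by rotations. In the highest
  weight theory a single integral grading element of the Cartan subalgebra tells raising from
  lowering operators, and comparing its eigenvalues does the work of comparing weights. The shift m
  - 1 - j in the Pfaffian scalar is an effect of noncommutativity: a Pfaffian sum with two equal
  rows is not 0 but a multiple of the Pfaffian of the other rows. The constant is d_\<lambda> =
  (-1)^(m-1) i d, where d is the factor between the family of pr_0 and the Pfaffians: the m - 1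
  letters from k contribute a minus sign each, and A_{n,a} = - i (i A_{n,a}) contributes -
  i.\<close>

text \<open>
  \<open>pf D S\<close> below is the Pfaffian with rows and columns $S$ of the operators \<open>D x y\<close>, expanded along the
  largest row as in \<open>Pf\<close>, and \<open>pf_sign S a b\<close> is the sign of the entry $(a, b)$ in an expansion along
  row $a$.  Only operators with disjoint indices commute, which is enough to expand along any row.
\<close>

definition sgl :: "nat \<Rightarrow> nat \<Rightarrow> real" where
  "sgl a b = (if a < b then - 1 else 1)"

definition pos_sign :: "nat set \<Rightarrow> nat \<Rightarrow> real" where
  "pos_sign S a = (- 1) ^ card {c \<in> S. c < a}"

definition pf_sign :: "nat set \<Rightarrow> nat \<Rightarrow> nat \<Rightarrow> real" where
  "pf_sign S a b = - (sgl a b * pos_sign S a * pos_sign S b)"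

lemma sgl_swap: "a \<noteq> b \<Longrightarrow> sgl b a = - sgl a b"
  by (auto simp: sgl_def)

lemma sgl_sq [simp]: "sgl a b * sgl a b = 1" "sgl a b * (sgl a b * x) = x"
  by (auto simp: sgl_def)

lemma pos_sign_sq [simp]: "pos_sign S a * pos_sign S a = 1" "pos_sign S a * (pos_sign S a * x) = x"
  by (auto simp: pos_sign_def simp flip: power_mult_distrib mult.assoc)

lemma pos_sign_remove:
  assumes "finite S" "x \<in> S"
  shows "pos_sign (S - {x}) a = pos_sign S a * sgl x a"
proof (cases "x < a")
  case True
  have "{c \<in> S. c < a} = insert x {c \<in> S - {x}. c < a}"
    using assms True by auto
  then have "card {c \<in> S. c < a} = Suc (card {c \<in> S - {x}. c < a})"
    using assms by simp
  with True show ?thesis by (simp add: pos_sign_def sgl_def)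
next
  case False
  then have "{c \<in> S. c < a} = {c \<in> S - {x}. c < a}"
    by auto
  with False show ?thesis by (simp add: pos_sign_def sgl_def)
qed

lemma pos_sign_remove2:
  assumes "finite S" "x \<in> S" "y \<in> S" "x \<noteq> y"
  shows "pos_sign (S - {x, y}) a = pos_sign S a * sgl x a * sgl y a"
proof -
  have "S - {x, y} = S - {x} - {y}" by auto
  with assms show ?thesis by (simp add: pos_sign_remove)
qed

lemma pf_sign_swap: "a \<noteq> b \<Longrightarrow> pf_sign S b a = - pf_sign S a b"
  by (simp add: pf_sign_def sgl_swap[of a b] mult_ac)

text \<open>Deleting {m, b} changes the sign of (a, c) by four factors \<open>sgl\<close>, and
  deleting {a, c} changes the sign of (m, b) by the same four factors with their arguments swapped.
  Four swaps cancel.\<close>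

lemma pf_sign_exchange:
  assumes "finite S" "{a, b, c, m} \<subseteq> S" "distinct [a, b, c, m]"
  shows "pf_sign S m b * pf_sign (S - {m, b}) a c = pf_sign S a c * pf_sign (S - {a, c}) m b"
  using assms
  by (simp add: pf_sign_def pos_sign_remove2 sgl_swap[of a m] sgl_swap[of a b] sgl_swap[of c m]
      sgl_swap[of c b] mult_ac)

text \<open>
  Pulling two rows out of a Pfaffian, the remaining minors carry the sign of the Pfaffian expansion
  of the complementary Pfaffian.
\<close>

lemma pf_sign_nested:
  assumes "finite S" "{x, y, j, l} \<subseteq> S" "distinct [x, y, j, l]"
  shows "pf_sign S x j * pf_sign (S - {x, j}) y l = - (pf_sign S x y * pf_sign (S - {x, y}) j l)"
  using assms
  by (simp add: pf_sign_def pos_sign_remove2 sgl_swap[of x j] sgl_swap[of x y] sgl_swap[of j y]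
      sgl_swap[of y l] sgl_swap[of j l] mult_ac)

lemma sum_swap_distinct:
  fixes f :: "'a \<Rightarrow> 'a \<Rightarrow> 'b::comm_monoid_add"
  assumes "finite R"
  shows "(\<Sum>b\<in>R. \<Sum>c\<in>R - {b}. f b c) = (\<Sum>c\<in>R. \<Sum>b\<in>R - {c}. f b c)"
proof -
  have "(\<Sum>b\<in>R. \<Sum>c\<in>R - {b}. f b c) = (\<Sum>b\<in>R. \<Sum>c | c \<in> R \<and> b \<noteq> c. f b c)"
    by (intro sum.cong refl) auto
  also have "\<dots> = (\<Sum>c\<in>R. \<Sum>b | b \<in> R \<and> b \<noteq> c. f b c)"
    by (rule sum.swap_restrict) (use assms in auto)
  also have "\<dots> = (\<Sum>c\<in>R. \<Sum>b\<in>R - {c}. f b c)"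
    by (intro sum.cong refl) auto
  finally show ?thesis .
qed

section \<open>Row expansions and commutators of noncommutative Pfaffians\<close>

function pf :: "(nat \<Rightarrow> nat \<Rightarrow> 'a) \<Rightarrow> nat set \<Rightarrow> 'a::real_algebra_1" where
  "pf D S = (if finite S \<and> S \<noteq> {} then
     (\<Sum>b\<in>S - {Max S}. pf_sign S (Max S) b *\<^sub>R (D (Max S) b * pf D (S - {Max S, b}))) else 1)"
  by auto
termination
proof (relation "Wellfounded.measure (\<lambda>(D, S). card S)", goal_cases)
  case (2 D S b)
  then have "S - {Max S, b} \<subset> S" "finite S" using Max_in[of S] by auto
  then show ?case
    by (simp only: in_measure case_prod_conv psubset_card_mono)
qed simp

declare pf.simps [simp del]

lemma pf_empty [simp]: "pf D {} = 1"
  by (simp add: pf.simps)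

locale so_family =
  fixes D :: "nat \<Rightarrow> nat \<Rightarrow> 'a::real_algebra_1" and U :: "nat set"
  assumes D_skew: "x \<in> U \<Longrightarrow> y \<in> U \<Longrightarrow> D y x = - D x y"
    and D_bracket: "\<lbrakk>x \<in> U; y \<in> U; z \<in> U; w \<in> U\<rbrakk> \<Longrightarrow> D x y * D z w - D z w * D x y =
      (if y = z then D x w else 0) - (if x = z then D y w else 0)
      - (if y = w then D x z else 0) + (if x = w then D y z else 0)"
begin

lemma D_same:
  assumes "x \<in> U"
  shows "D x x = 0"
proof -
  have "D x x + D x x = 0"
    using D_skew[OF assms assms] by (metis add.right_inverse)
  then show ?thesis
    by (simp flip: scaleR_2)
qed

lemma D_commute:
  assumes "{x, y, z, w} \<subseteq> U" "x \<noteq> z" "x \<noteq> w" "y \<noteq> z" "y \<noteq> w"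
  shows "D x y * D z w = D z w * D x y"
  using D_bracket[of x y z w] assms by simp

lemma D_pf_commute:
  assumes "finite S" "S \<subseteq> U" "x \<in> U" "y \<in> U" "x \<notin> S" "y \<notin> S"
  shows "D x y * pf D S = pf D S * D x y"
  using assms
proof (induction "card S" arbitrary: S rule: less_induct)
  case less
  show ?case
  proof (cases "S = {}")
    case False
    let ?m = "Max S"
    have m: "?m \<in> S" using less.prems False by auto
    have "D x y * (D ?m b * pf D (S - {?m, b})) = D ?m b * pf D (S - {?m, b}) * D x y"
      if b: "b \<in> S - {?m}" for b
    proof -
      have "card (S - {?m, b}) < card S"
        by (rule psubset_card_mono) (use less.prems m in auto)
      then have "D x y * pf D (S - {?m, b}) = pf D (S - {?m, b}) * D x y"
        using less.prems by (intro less.hyps) auto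
      moreover have "D x y * D ?m b = D ?m b * D x y"
        by (rule D_commute) (use less.prems m b in auto)
      ultimately show ?thesis by (metis mult.assoc)
    qed
    then show ?thesis
      using less.prems False
      by (subst (1 2) pf.simps) (auto simp: sum_distrib_left sum_distrib_right intro!: sum.cong)
  qed simp
qed

text \<open>Two rows a and m are compared. Expanding the minors of each along the other row turns
  both expansions into double sums over entries \<open>D a c\<close> and \<open>D m b\<close> with
  four distinct indices; these entries commute, and \<open>pf_sign_exchange\<close> matches the
  signs. The induction hypothesis supplies the expansions of the minors along rows that need not be
  their largest.\<close>

lemma pf_row:
  assumes "finite S" "S \<subseteq> U" "a \<in> S"
  shows "pf D S = (\<Sum>b\<in>S - {a}. pf_sign S a b *\<^sub>R (D a b * pf D (S - {a, b})))"
  using assms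
proof (induction "card S" arbitrary: S a rule: less_induct)
  case less
  define row where "row a = (\<Sum>b\<in>S - {a}. pf_sign S a b *\<^sub>R (D a b * pf D (S - {a, b})))" for a
  define t where "t a m c b = (pf_sign S a c * pf_sign (S - {a, c}) m b) *\<^sub>R
      (D a c * D m b * pf D (S - {a, c, m, b}))" for a m c b
  have IH: "pf D (S - {a, c}) =
      (\<Sum>b\<in>S - {a, m} - {c}. pf_sign (S - {a, c}) m b *\<^sub>R (D m b * pf D (S - {a, c, m, b})))"
    if "a \<in> S" "m \<in> S" "c \<in> S" "m \<noteq> a" "c \<noteq> a" "m \<noteq> c" for a m c
  proof -
    have "card (S - {a, c}) < card S"
      by (rule psubset_card_mono) (use less.prems that in auto)
    then have "pf D (S - {a, c}) = (\<Sum>b\<in>S - {a, c} - {m}. pf_sign (S - {a, c}) m b *\<^sub>R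
        (D m b * pf D (S - {a, c} - {m, b})))"
      using less.prems that by (intro less.hyps) auto
    moreover have "S - {a, c} - {m} = S - {a, m} - {c}" "S - {a, c} - {m, b} = S - {a, c, m, b}" for b
      by auto
    ultimately show ?thesis by simp
  qed
  have row2: "row a = pf_sign S a m *\<^sub>R (D a m * pf D (S - {a, m})) +
      (\<Sum>c\<in>S - {a, m}. \<Sum>b\<in>S - {a, m} - {c}. t a m c b)" if "a \<in> S" "m \<in> S" "a \<noteq> m" for a m
  proof -
    have *: "S - {a} - {m} = S - {a, m}" by auto
    have "row a = pf_sign S a m *\<^sub>R (D a m * pf D (S - {a, m})) +
        (\<Sum>c\<in>S - {a, m}. pf_sign S a c *\<^sub>R (D a c * pf D (S - {a, c})))"
      unfolding row_def using less.prems that by (subst sum.remove[of _ m]) (auto simp: *)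
    moreover have "(\<Sum>c\<in>S - {a, m}. pf_sign S a c *\<^sub>R (D a c * pf D (S - {a, c}))) =
        (\<Sum>c\<in>S - {a, m}. \<Sum>b\<in>S - {a, m} - {c}. t a m c b)"
    proof (rule sum.cong[OF refl])
      fix c assume "c \<in> S - {a, m}"
      then show "pf_sign S a c *\<^sub>R (D a c * pf D (S - {a, c})) = (\<Sum>b\<in>S - {a, m} - {c}. t a m c b)"
        using \<open>a \<in> S\<close> \<open>m \<in> S\<close> \<open>a \<noteq> m\<close>
        by (subst IH[of a m c]) (auto simp: t_def sum_distrib_left scaleR_sum_right mult.assoc)
    qed
    ultimately show ?thesis by simp
  qed
  have "row a = row m" if "a \<in> S" "m \<in> S" "a \<noteq> m" for a m
  proof -
    have "t a m c b = t m a b c" if "c \<in> S - {a, m}" "b \<in> S - {a, m} - {c}" for b c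
    proof -
      have "D a c * D m b = D m b * D a c"
        by (rule D_commute) (use that less.prems \<open>a \<in> S\<close> \<open>m \<in> S\<close> \<open>a \<noteq> m\<close> in auto)
      moreover have "S - {a, c, m, b} = S - {m, b, a, c}" by auto
      ultimately show ?thesis
        unfolding t_def using pf_sign_exchange[of S a b c m] less.prems that \<open>a \<in> S\<close> \<open>m \<in> S\<close> \<open>a \<noteq> m\<close>
        by auto
    qed
    then have "(\<Sum>c\<in>S - {a, m}. \<Sum>b\<in>S - {a, m} - {c}. t a m c b) =
        (\<Sum>c\<in>S - {a, m}. \<Sum>b\<in>S - {a, m} - {c}. t m a b c)"
      by (auto intro!: sum.cong)
    also have "\<dots> = (\<Sum>b\<in>S - {m, a}. \<Sum>c\<in>S - {m, a} - {b}. t m a b c)"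
      using less.prems by (subst sum_swap_distinct) (auto simp: insert_commute)
    \<comment> \<open>The entry common to both rows occurs as (a, m) in one expansion and as (m, a)
      in the other; the operator and \<open>pf_sign\<close> both change sign.\<close>
    moreover have "D a m * pf D (S - {a, m}) = - (D m a * pf D (S - {m, a}))"
    proof -
      have "D a m = - D m a" by (rule D_skew) (use less.prems that in auto)
      then show ?thesis by (simp add: insert_commute)
    qed
    ultimately show ?thesis
      using row2[of a m] row2[of m a] that pf_sign_swap[of a m S] by simp
  qed
  moreover have "pf D S = row (Max S)"
    using less.prems by (subst pf.simps) (auto simp: row_def)
  moreover have "Max S \<in> S" using less.prems(1,3) by (intro Max_in) auto
  ultimately show ?case
    using less.prems row_def by metis
qed

text \<open>Every row gives the same Pfaffian, so adding the expansions along all rows counts it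
  \<open>card S\<close> times. In this form a Pfaffian is recognized inside a sum over ordered
  pairs.\<close>

lemma pf_edge_sum:
  assumes "finite S" "S \<subseteq> U"
  shows "(\<Sum>j\<in>S. \<Sum>l\<in>S - {j}. pf_sign S j l *\<^sub>R (D j l * pf D (S - {j, l}))) = real (card S) *\<^sub>R pf D S"
proof -
  have "(\<Sum>j\<in>S. \<Sum>l\<in>S - {j}. pf_sign S j l *\<^sub>R (D j l * pf D (S - {j, l}))) = (\<Sum>j\<in>S. pf D S)"
    using assms by (intro sum.cong refl pf_row[symmetric])
  then show ?thesis by (simp add: scaleR_conv_of_real)
qed

text \<open>Expanding along x and then along y isolates the two rows that \<open>D x y\<close>
  moves. What is left over is indexed by R, which contains neither x nor y.\<close>

lemma pf_two_rows:
  assumes "finite S" "S \<subseteq> U" "x \<in> S" "y \<in> S" "x \<noteq> y"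
  defines "R \<equiv> S - {x, y}"
  shows "pf D S = pf_sign S x y *\<^sub>R (D x y * pf D R -
     (\<Sum>j\<in>R. \<Sum>l\<in>R - {j}. pf_sign R j l *\<^sub>R (D x j * D y l * pf D (R - {j, l}))))"
proof -
  have R: "S - {x} - {y} = R" by (auto simp: R_def)
  have "pf_sign S x j *\<^sub>R (D x j * pf D (S - {x, j})) =
      (\<Sum>l\<in>R - {j}. - (pf_sign S x y *\<^sub>R pf_sign R j l *\<^sub>R (D x j * D y l * pf D (R - {j, l}))))"
    if j: "j \<in> R" for j
  proof -
    have "pf D (S - {x, j}) = (\<Sum>l\<in>S - {x, j} - {y}. pf_sign (S - {x, j}) y l *\<^sub>R
        (D y l * pf D (S - {x, j} - {y, l})))"
      by (rule pf_row) (use assms j in auto)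
    moreover have "S - {x, j} - {y} = R - {j}" "S - {x, j} - {y, l} = R - {j, l}" for l
      by (auto simp: R_def)
    ultimately have "pf_sign S x j *\<^sub>R (D x j * pf D (S - {x, j})) =
        (\<Sum>l\<in>R - {j}. (pf_sign S x j * pf_sign (S - {x, j}) y l) *\<^sub>R (D x j * D y l * pf D (R - {j, l})))"
      by (simp add: sum_distrib_left scaleR_sum_right mult.assoc)
    also have "\<dots> = (\<Sum>l\<in>R - {j}. - (pf_sign S x y *\<^sub>R pf_sign R j l *\<^sub>R (D x j * D y l * pf D (R - {j, l}))))"
      using assms j by (intro sum.cong refl) (subst pf_sign_nested; auto simp: R_def)
    finally show ?thesis .
  qed
  then have "(\<Sum>j\<in>R. pf_sign S x j *\<^sub>R (D x j * pf D (S - {x, j}))) =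
      - (pf_sign S x y *\<^sub>R (\<Sum>j\<in>R. \<Sum>l\<in>R - {j}. pf_sign R j l *\<^sub>R (D x j * D y l * pf D (R - {j, l}))))"
    by (simp add: scaleR_sum_right sum_negf)
  moreover have "pf D S = pf_sign S x y *\<^sub>R (D x y * pf D R) +
      (\<Sum>j\<in>R. pf_sign S x j *\<^sub>R (D x j * pf D (S - {x, j})))"
    using assms(1-5) by (subst pf_row[of S x], simp_all, subst sum.remove[of _ y]) (auto simp: R R_def)
  ultimately show ?thesis by (simp add: scaleR_diff_right)
qed

text \<open>With commuting entries the sum would vanish by antisymmetry in (j, l). Here exchanging j
  and l leaves half of the commutators [D x j, D x l] = - D j l, which \<open>pf_edge_sum\<close>
  adds up. The shifts in the Pfaffian eigenvalue come from this term.\<close>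

lemma pf_same_row_sum:
  assumes "finite R" "R \<subseteq> U" "x \<in> U" "x \<notin> R"
  shows "(\<Sum>j\<in>R. \<Sum>l\<in>R - {j}. pf_sign R j l *\<^sub>R (D x j * D x l * pf D (R - {j, l}))) =
     (- real (card R) / 2) *\<^sub>R pf D R" (is "?s = _")
proof -
  have "?s = (\<Sum>l\<in>R. \<Sum>j\<in>R - {l}. pf_sign R j l *\<^sub>R (D x j * D x l * pf D (R - {j, l})))"
    by (rule sum_swap_distinct) fact
  also have "\<dots> = (\<Sum>l\<in>R. \<Sum>j\<in>R - {l}. - (pf_sign R l j *\<^sub>R (D x j * D x l * pf D (R - {l, j}))))"
    by (intro sum.cong refl, subst pf_sign_swap) (auto simp: insert_commute)
  finally have "?s + ?s = (\<Sum>j\<in>R. \<Sum>l\<in>R - {j}. pf_sign R j l *\<^sub>R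
      ((D x j * D x l - D x l * D x j) * pf D (R - {j, l})))"
    by (simp add: sum.distrib[symmetric] sum_negf sum_subtractf algebra_simps)
  also have "\<dots> = (\<Sum>j\<in>R. \<Sum>l\<in>R - {j}. - (pf_sign R j l *\<^sub>R (D j l * pf D (R - {j, l}))))"
    using assms by (intro sum.cong refl) (subst D_bracket; auto)
  also have "\<dots> = - (real (card R) *\<^sub>R pf D R)"
    using pf_edge_sum[OF assms(1,2)] by (simp add: sum_negf)
  finally have "2 *\<^sub>R ?s = 2 *\<^sub>R ((- real (card R) / 2) *\<^sub>R pf D R)"
    by (simp add: scaleR_2)
  then show ?thesis by (subst (asm) scaleR_cancel_left) simp
qed

text \<open>In the two-row expansion, \<open>D x y\<close> commutes with its own entry and with
  every Pfaffian inside R. On the remaining double sum E it acts as a derivation and produces the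
  sum with both rows x minus the sum with both rows y; by \<open>pf_same_row_sum\<close> these
  agree.\<close>

lemma pf_bracket_inside:
  assumes "finite S" "S \<subseteq> U" "x \<in> S" "y \<in> S"
  shows "D x y * pf D S - pf D S * D x y = 0"
proof (cases "x = y")
  case True
  then show ?thesis using assms D_same[of x] by auto
next
  case False
  define R where "R = S - {x, y}"
  have R: "finite R" "R \<subseteq> U" "x \<in> U" "y \<in> U" "x \<notin> R" "y \<notin> R"
    using assms by (auto simp: R_def)
  let ?p = "\<lambda>j l. pf D (R - {j, l})"
  have c: "D x y * pf D T = pf D T * D x y" if "T \<subseteq> R" for T
    by (rule D_pf_commute) (use R that finite_subset in auto)
  have "D x y * (D x j * D y l * ?p j l) - D x j * D y l * ?p j l * D x y =
      D x j * D x l * ?p j l - D y j * D y l * ?p j l" if "j \<in> R" "l \<in> R - {j}" for j l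
  proof -
    have jl: "j \<in> U" "l \<in> U" "x \<noteq> j" "y \<noteq> j" "x \<noteq> l" "y \<noteq> l"
      using R that by auto
    have 1: "D x y * D x j = D x j * D x y - D y j"
      using D_bracket[of x y x j] R jl False by (simp add: algebra_simps)
    have 2: "D x y * D y l = D y l * D x y + D x l"
      using D_bracket[of x y y l] R jl False by (simp add: algebra_simps)
    have "D x y * (D x j * D y l * ?p j l) = (D x y * D x j) * D y l * ?p j l"
      by (simp add: mult.assoc)
    also have "\<dots> = D x j * (D x y * D y l) * ?p j l - D y j * D y l * ?p j l"
      by (simp add: 1 algebra_simps)
    also have "\<dots> = D x j * D y l * (D x y * ?p j l) + D x j * D x l * ?p j l - D y j * D y l * ?p j l"
      by (simp add: 2 algebra_simps)
    also have "D x y * ?p j l = ?p j l * D x y"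
      by (rule c) auto
    finally show ?thesis by (simp add: mult.assoc)
  qed
  then have "(\<Sum>j\<in>R. \<Sum>l\<in>R - {j}. pf_sign R j l *\<^sub>R (D x y * (D x j * D y l * ?p j l) - D x j * D y l * ?p j l * D x y)) =
    (\<Sum>j\<in>R. \<Sum>l\<in>R - {j}. pf_sign R j l *\<^sub>R (D x j * D x l * ?p j l - D y j * D y l * ?p j l))"
    by simp
  also have "\<dots> = 0"
    using pf_same_row_sum[of R x] pf_same_row_sum[of R y] R
    by (simp add: scaleR_diff_right sum_subtractf)
  finally have z: "(\<Sum>j\<in>R. \<Sum>l\<in>R - {j}. pf_sign R j l *\<^sub>R (D x y * (D x j * D y l * ?p j l) - D x j * D y l * ?p j l * D x y)) = 0" .
  define E where "E = (\<Sum>j\<in>R. \<Sum>l\<in>R - {j}. pf_sign R j l *\<^sub>R (D x j * D y l * ?p j l))"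
  have "D x y * E - E * D x y = 0"
    unfolding E_def z[symmetric]
    by (simp add: sum_distrib_left sum_distrib_right sum_subtractf scaleR_diff_right)
  moreover have "D x y * (D x y * pf D R) - D x y * pf D R * D x y = 0"
    using c[OF order_refl] by (metis diff_self mult.assoc)
  moreover have "pf D S = pf_sign S x y *\<^sub>R (D x y * pf D R - E)"
    unfolding E_def R_def by (rule pf_two_rows[OF assms False])
  then have "D x y * pf D S - pf D S * D x y = pf_sign S x y *\<^sub>R
      ((D x y * (D x y * pf D R) - D x y * pf D R * D x y) - (D x y * E - E * D x y))"
    by (simp add: right_diff_distrib left_diff_distrib scaleR_diff_right)
  ultimately show ?thesis by simp
qed

text \<open>In the expansion along y the minors contain neither x nor y, so \<open>D x y\<close>
  acts on the factor \<open>D y b\<close> only and replaces it by \<open>D x b\<close>. The result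
  is an expansion along x, up to the sign that compares the positions of x and y.\<close>

lemma pf_bracket_outside:
  assumes "finite S" "S \<subseteq> U" "x \<in> U" "x \<notin> S" "y \<in> S"
  shows "D x y * pf D S - pf D S * D x y =
    (pos_sign (S - {y}) x * pos_sign (S - {y}) y) *\<^sub>R pf D (insert x (S - {y}))"
proof -
  define T where "T = insert x (S - {y})"
  let ?s = "pos_sign (S - {y})"
  have xy: "x \<noteq> y" using assms by auto
  have T: "T - {x} = S - {y}" "T - {x, b} = S - {y, b}" for b using assms by (auto simp: T_def)
  have "D x y * (D y b * pf D (S - {y, b})) - D y b * pf D (S - {y, b}) * D x y = D x b * pf D (S - {y, b})"
    if "b \<in> S - {y}" for b
  proof -
    have "b \<in> U" "y \<in> U" "x \<noteq> b" "y \<noteq> b"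
      using assms that by auto
    then have "D x y * D y b = D y b * D x y + D x b"
      using D_bracket[of x y y b] assms xy by (simp add: algebra_simps)
    moreover have "D x y * pf D (S - {y, b}) = pf D (S - {y, b}) * D x y"
      by (rule D_pf_commute) (use assms in auto)
    ultimately have "D x y * (D y b * pf D (S - {y, b})) =
        D y b * (pf D (S - {y, b}) * D x y) + D x b * pf D (S - {y, b})"
      by (metis distrib_right mult.assoc)
    then show ?thesis by (simp add: mult.assoc)
  qed
  then have 1: "(\<Sum>b\<in>S - {y}. pf_sign S y b *\<^sub>R
      (D x y * (D y b * pf D (S - {y, b})) - D y b * pf D (S - {y, b}) * D x y)) =
      (\<Sum>b\<in>S - {y}. pf_sign S y b *\<^sub>R (D x b * pf D (S - {y, b})))"
    by (intro sum.cong refl) simp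
  have 2: "pf_sign S y b = (?s x * ?s y) * pf_sign T x b" if "b \<in> S - {y}" for b
  proof -
    have "pos_sign S b = ?s b * sgl y b" "pos_sign S y = ?s y"
      using assms(1,5) by (simp_all add: pos_sign_remove mult.assoc) (simp add: sgl_def)
    moreover have "?s b = pos_sign T b * sgl x b" "?s x = pos_sign T x * sgl x x"
      unfolding T(1)[symmetric] using assms(1) by (intro pos_sign_remove; simp add: T_def)+
    then have "pos_sign T b = ?s b * sgl x b" "pos_sign T x = ?s x"
      by (simp_all add: mult.assoc) (simp add: sgl_def)
    ultimately show ?thesis by (simp add: pf_sign_def mult_ac)
  qed
  have "pf D T = (\<Sum>b\<in>T - {x}. pf_sign T x b *\<^sub>R (D x b * pf D (T - {x, b})))"
    by (rule pf_row) (use assms in \<open>auto simp: T_def\<close>)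
  then have 3: "pf D T = (\<Sum>b\<in>S - {y}. pf_sign T x b *\<^sub>R (D x b * pf D (S - {y, b})))"
    unfolding T .
  have 4: "pf D S = (\<Sum>b\<in>S - {y}. pf_sign S y b *\<^sub>R (D y b * pf D (S - {y, b})))"
    by (rule pf_row) (use assms in auto)
  have "D x y * pf D S - pf D S * D x y = (\<Sum>b\<in>S - {y}. pf_sign S y b *\<^sub>R
      (D x y * (D y b * pf D (S - {y, b})) - D y b * pf D (S - {y, b}) * D x y))"
    unfolding 4 by (simp add: sum_distrib_left sum_distrib_right sum_subtractf scaleR_diff_right)
  also have "\<dots> = (\<Sum>b\<in>S - {y}. (?s x * ?s y) *\<^sub>R pf_sign T x b *\<^sub>R (D x b * pf D (S - {y, b})))"
    unfolding 1 by (intro sum.cong refl) (simp add: 2)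
  finally show ?thesis
    unfolding T_def[symmetric] 3 scaleR_sum_right .
qed

end

section \<open>The Banach algebra of matrices\<close>

text \<open>A type of its own makes matrix multiplication the ring product and the operator norm the
  norm, so that the theory of \<open>exp\<close> and of derivatives of products in Banach algebras
  applies to matrices.\<close>

typedef 'd endo = "UNIV :: (complex^'d^'d) set"
  morphisms mat_of Endo ..

setup_lifting type_definition_endo

lemma mat_of_Endo [simp]: "mat_of (Endo A) = A"
  by (simp add: Endo_inverse)

lemma matrix_mul_add_rdistrib: "(A + B) ** C = A ** C + B ** (C :: complex^'d^'m)"
  by (simp add: matrix_matrix_mult_def vec_eq_iff sum.distrib distrib_right)

instantiation endo :: (finite) ring_1
begin
lift_definition zero_endo :: "'a endo" is 0 .
lift_definition one_endo :: "'a endo" is "mat 1" .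
lift_definition plus_endo :: "'a endo \<Rightarrow> 'a endo \<Rightarrow> 'a endo" is "(+)" .
lift_definition minus_endo :: "'a endo \<Rightarrow> 'a endo \<Rightarrow> 'a endo" is "(-)" .
lift_definition uminus_endo :: "'a endo \<Rightarrow> 'a endo" is "uminus" .
lift_definition times_endo :: "'a endo \<Rightarrow> 'a endo \<Rightarrow> 'a endo" is "(**)" .
instance
proof
  show "(0::'a endo) \<noteq> 1"
    by transfer (simp add: mat_def vec_eq_iff)
qed (transfer; simp add: matrix_mul_assoc matrix_add_ldistrib matrix_mul_add_rdistrib)+
end

lemma matrix_mul_scaleR_left: "(c *\<^sub>R A) ** B = c *\<^sub>R (A ** (B :: complex^'d^'m))"
  by (simp add: matrix_matrix_mult_def vec_eq_iff scaleR_right.sum)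

lemma matrix_mul_scaleR_right: "A ** (c *\<^sub>R B) = c *\<^sub>R (A ** (B :: complex^'d^'m))"
  by (simp add: matrix_matrix_mult_def vec_eq_iff scaleR_right.sum)

lemma matrix_vector_scaleR:
  "(c *\<^sub>R A) *v x = c *\<^sub>R (A *v x)" "A *v (c *\<^sub>R x) = c *\<^sub>R (A *v (x :: complex^'d))"
  by (simp_all add: matrix_vector_mult_def vec_eq_iff scaleR_sum_right)

lemma bounded_bilinear_matrix_vector_mult:
  "bounded_bilinear (\<lambda>(A :: complex^'d^'m) x. A *v x)"
proof -
  have "bilinear (\<lambda>(A :: complex^'d^'m) x. A *v x)"
    by (auto simp: bilinear_def linear_iff algebra_simps matrix_vector_scaleR)
  then show ?thesis by (simp add: bilinear_conv_bounded_bilinear)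
qed

lemma bounded_linear_mult_vec: "bounded_linear (\<lambda>x. (A :: complex^'d^'m) *v x)"
  by (rule bounded_bilinear.bounded_linear_right[OF bounded_bilinear_matrix_vector_mult])

lemma matrix_vector_axis: "(A *v axis j 1) $ i = (A :: complex^'d^'m) $ i $ j"
  by (simp add: matrix_vector_mult_def axis_def if_distrib cong: if_cong)

lemma norm_entry_le_onorm: "norm (A $ i $ j) \<le> onorm ((*v) (A :: complex^'d^'m))"
proof -
  have "norm (A $ i $ j) \<le> norm (A *v axis j 1)"
    using Finite_Cartesian_Product.norm_nth_le[of "A *v axis j 1" i] by (simp add: matrix_vector_axis)
  also have "\<dots> \<le> onorm ((*v) A) * norm (axis j (1::complex))"
    by (rule onorm[OF bounded_linear_mult_vec])
  also have "norm (axis j (1::complex)) = 1"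
    by (simp add: norm_axis_1)
  finally show ?thesis by simp
qed

text \<open>A crude constant suffices: the bound makes \<open>mat_of\<close> continuous, which
  carries completeness over to the operator norm.\<close>

lemma norm_le_onorm:
  "norm A \<le> (real CARD('m) * real CARD('d)) * onorm ((*v) (A :: complex^'d^'m))"
proof -
  have "norm A \<le> (\<Sum>i\<in>UNIV. norm (A $ i))"
    unfolding norm_vec_def by (rule L2_set_le_sum) simp
  also have "\<dots> \<le> (\<Sum>i\<in>(UNIV::'m set). \<Sum>j\<in>(UNIV::'d set). norm (A $ i $ j))"
    unfolding norm_vec_def by (intro sum_mono L2_set_le_sum) simp
  also have "\<dots> \<le> (\<Sum>i\<in>(UNIV::'m set). \<Sum>j\<in>(UNIV::'d set). onorm ((*v) A))"
    by (intro sum_mono norm_entry_le_onorm)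
  finally show ?thesis by simp
qed

instantiation endo :: (finite) real_normed_algebra_1
begin
lift_definition scaleR_endo :: "real \<Rightarrow> 'a endo \<Rightarrow> 'a endo" is "scaleR" .
definition norm_endo :: "'a endo \<Rightarrow> real" where "norm_endo A = onorm ((*v) (mat_of A))"
definition dist_endo :: "'a endo \<Rightarrow> 'a endo \<Rightarrow> real" where "dist_endo A B = norm (A - B)"
definition sgn_endo :: "'a endo \<Rightarrow> 'a endo" where "sgn_endo A = inverse (norm A) *\<^sub>R A"
definition uniformity_endo :: "('a endo \<times> 'a endo) filter" where
  "uniformity_endo = (INF e\<in>{0<..}. principal {(x, y). dist x y < e})"
definition open_endo :: "'a endo set \<Rightarrow> bool" where
  "open_endo U = (\<forall>x\<in>U. \<forall>\<^sub>F (x', y) in uniformity. x' = x \<longrightarrow> y \<in> U)"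
instance
proof
  fix A B :: "'a endo" and c :: real
  have *: "onorm ((*v) C) = 0 \<longleftrightarrow> C = 0" for C :: "complex^'a^'a"
  proof
    assume "onorm ((*v) C) = 0"
    then show "C = 0" using norm_le_onorm[of C] by simp
  qed (simp add: onorm_eq_0[OF bounded_linear_mult_vec])
  have fun1: "(*v) (P + Q) = (\<lambda>x. P *v x + Q *v x)" and fun2: "(*v) (c *\<^sub>R P) = (\<lambda>x. c *\<^sub>R (P *v x))"
    and fun3: "(*v) (P ** Q) = (\<lambda>x. P *v (Q *v x))" for P Q :: "complex^'a^'a"
    by (auto simp: fun_eq_iff matrix_vector_mult_add_rdistrib matrix_vector_scaleR matrix_vector_mul_assoc)
  show "norm A = 0 \<longleftrightarrow> A = 0"
    unfolding norm_endo_def * by transfer simp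
  show "norm (A + B) \<le> norm A + norm B"
    using onorm_triangle[OF bounded_linear_mult_vec bounded_linear_mult_vec, of "mat_of A" "mat_of B"]
    by (simp add: norm_endo_def plus_endo.rep_eq fun1)
  show "norm (c *\<^sub>R A) = \<bar>c\<bar> * norm A"
    using onorm_scaleR[OF bounded_linear_mult_vec, of c "mat_of A"]
    by (simp add: norm_endo_def scaleR_endo.rep_eq fun2)
  show "norm (A * B) \<le> norm A * norm B"
    using onorm_compose[OF bounded_linear_mult_vec bounded_linear_mult_vec, of "mat_of A" "mat_of B"]
    by (simp add: norm_endo_def times_endo.rep_eq comp_def fun3)
  have "(*v) (mat 1) = (\<lambda>x::complex^'a. x)" by (simp add: fun_eq_iff)
  then show "norm (1::'a endo) = 1"
    by (simp add: norm_endo_def one_endo.rep_eq onorm_id)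
  show "dist A B = norm (A - B)" by (rule dist_endo_def)
  show "sgn A = inverse (norm A) *\<^sub>R A" by (rule sgn_endo_def)
qed (rule uniformity_endo_def open_endo_def; fail | transfer; simp add: algebra_simps matrix_mul_scaleR_left matrix_mul_scaleR_right)+
end

lemma norm_mult_vec_le: "norm (mat_of A *v x) \<le> norm A * norm x"
  unfolding norm_endo_def by (rule onorm[OF bounded_linear_mult_vec])

lemma norm_mat_of_le: "norm (mat_of A) \<le> (real CARD('d) * real CARD('d)) * norm (A :: 'd::finite endo)"
  unfolding norm_endo_def by (rule norm_le_onorm)

lemma bounded_linear_mat_of: "bounded_linear (mat_of :: 'd::finite endo \<Rightarrow> _)"
  by (rule bounded_linear_intro[where K = "real CARD('d) * real CARD('d)"])
    (use norm_mat_of_le in \<open>simp_all add: plus_endo.rep_eq scaleR_endo.rep_eq mult.commute\<close>)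

lemma bounded_linear_Endo: "bounded_linear (Endo :: complex^'d^'d \<Rightarrow> 'd::finite endo)"
proof -
  obtain K where K: "\<And>(A :: complex^'d^'d) x. norm (A *v x) \<le> norm A * norm x * K"
    using bounded_bilinear.bounded[OF bounded_bilinear_matrix_vector_mult] by blast
  show ?thesis
  proof (rule bounded_linear_intro[where K = K])
    fix A :: "complex^'d^'d"
    show "norm (Endo A) \<le> norm A * K"
      unfolding norm_endo_def mat_of_Endo
      by (rule onorm_le) (use K in \<open>simp add: mult_ac\<close>)
  qed (simp_all flip: mat_of_inject add: plus_endo.rep_eq scaleR_endo.rep_eq)
qed

instance endo :: (finite) banach
proof
  fix X :: "nat \<Rightarrow> 'a endo"
  assume "Cauchy X"
  then have "Cauchy (\<lambda>n. mat_of (X n))"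
    by (rule bounded_linear.Cauchy[OF bounded_linear_mat_of])
  then obtain L where "(\<lambda>n. mat_of (X n)) \<longlonglongrightarrow> L"
    using Cauchy_convergent convergent_def by blast
  then have "(\<lambda>n. Endo (mat_of (X n))) \<longlonglongrightarrow> Endo L"
    by (rule bounded_linear.tendsto[OF bounded_linear_Endo])
  then show "convergent X"
    by (auto simp: mat_of_inverse convergent_def)
qed

definition ap :: "'d::finite endo \<Rightarrow> complex^'d \<Rightarrow> complex^'d" (infixr "\<rhd>" 75) where
  "A \<rhd> v = mat_of A *v v"

text \<open>\<open>'d endo\<close> is a real algebra; complex scalars act through these central
  elements.\<close>

lift_definition cs :: "complex \<Rightarrow> 'd::finite endo" is mat .

lemma mat_mult_vec: "mat c *v v = c *s (v :: complex^'d)"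
  by (simp add: mat_def matrix_vector_mult_def vec_eq_iff if_distrib if_distribR cong: if_cong)

lemma mat_matrix_mult: "mat c ** A = cscale c A" "A ** mat c = cscale c (A :: complex^'d^'d)"
  by (simp_all add: cscale_def matrix_matrix_mult_def mat_def vec_eq_iff if_distrib if_distribR mult.commute
      cong: if_cong)

lemma ap_simps [simp]:
  "(A + B) \<rhd> v = A \<rhd> v + B \<rhd> v" "(A - B) \<rhd> v = A \<rhd> v - B \<rhd> v" "(- A) \<rhd> v = - (A \<rhd> v)"
  "(A * B) \<rhd> v = A \<rhd> B \<rhd> v" "0 \<rhd> v = 0" "1 \<rhd> v = v" "(t *\<^sub>R A) \<rhd> v = t *\<^sub>R (A \<rhd> v)"
  "cs c \<rhd> v = c *s v" "A \<rhd> 0 = 0"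
  by (simp_all add: ap_def plus_endo.rep_eq minus_endo.rep_eq uminus_endo.rep_eq times_endo.rep_eq
      zero_endo.rep_eq one_endo.rep_eq scaleR_endo.rep_eq cs.rep_eq matrix_vector_scaleR
      matrix_vector_mult_add_rdistrib matrix_vector_mult_diff_rdistrib matrix_vector_mul_assoc mat_mult_vec)
    (simp add: matrix_vector_mult_def vec_eq_iff sum_negf)

lemma ap_add: "A \<rhd> (v + w) = A \<rhd> v + A \<rhd> w"
  by (simp add: ap_def algebra_simps)

lemma ap_diff: "A \<rhd> (v - w) = A \<rhd> v - A \<rhd> w"
  by (simp add: ap_def algebra_simps)

lemma ap_scale: "A \<rhd> (c *s v) = c *s (A \<rhd> v)"
  by (simp add: ap_def vector_scalar_commute)

lemma ap_minus: "A \<rhd> (- v) = - (A \<rhd> v)"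
  using ap_diff[of A 0 v] by simp

lemma ap_sum: "A \<rhd> (\<Sum>i\<in>I. f i) = (\<Sum>i\<in>I. A \<rhd> f i)"
  by (induction I rule: infinite_finite_induct) (auto simp: ap_add)

lemma sum_ap: "(\<Sum>i\<in>I. f i) \<rhd> v = (\<Sum>i\<in>I. f i \<rhd> v)"
  by (induction I rule: infinite_finite_induct) auto

lemma endo_eqI: "(\<And>v. A \<rhd> v = B \<rhd> v) \<Longrightarrow> A = B"
  unfolding ap_def by (metis mat_of_inject matrix_eq)

lemma cs_commute: "cs c * A = A * cs c"
  by transfer (simp add: mat_matrix_mult)

lemma scaleR_vec_eq: "t *\<^sub>R v = complex_of_real t *s (v :: complex^'d)"
  by (simp add: vec_eq_iff) (simp add: scaleR_conv_of_real)

lemma subspace_kernel: "vec.subspace {w. A \<rhd> w = 0}"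
  by (auto simp: vec.subspace_def ap_add ap_scale)

lemma subspace_vimage: "vec.subspace S \<Longrightarrow> vec.subspace {w. A \<rhd> w \<in> S}"
  by (auto simp: vec.subspace_def ap_add ap_scale)

subsection \<open>Eigenvectors\<close>

text \<open>The product of all T - \<mu> k with k < n. It kills eigenvectors for these values and
  multiplies an eigenvector for any other value by a nonzero number, which is how eigenvalues are
  separated below.\<close>

primrec eig_ann :: "'d::finite endo \<Rightarrow> (nat \<Rightarrow> complex) \<Rightarrow> nat \<Rightarrow> 'd endo" where
  "eig_ann T \<mu> 0 = 1"
| "eig_ann T \<mu> (Suc n) = (T - cs (\<mu> n)) * eig_ann T \<mu> n"

lemma eig_ann_eigenvector:
  assumes "T \<rhd> w = c *s w"
  shows "eig_ann T \<mu> n \<rhd> w = (\<Prod>k<n. c - \<mu> k) *s w"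
proof (induction n)
  case (Suc n)
  then show ?case
    by (simp add: ap_scale assms) (simp add: vec_eq_iff algebra_simps)
qed simp

lemma eig_ann_mono:
  assumes "eig_ann T \<mu> n \<rhd> w = 0" "n \<le> k"
  shows "eig_ann T \<mu> k \<rhd> w = 0"
  using assms(2) by (induction k rule: dec_induct) (simp_all add: assms(1))

lemma eig_ann_span:
  assumes "w \<in> vec.span {w. \<exists>k. T \<rhd> w = \<mu> k *s w}"
  shows "\<exists>n. eig_ann T \<mu> n \<rhd> w = 0"
  using assms
proof (induction rule: vec.span_induct_alt)
  case (step c x y)
  then obtain k n where k: "T \<rhd> x = \<mu> k *s x" and n: "eig_ann T \<mu> n \<rhd> y = 0" by blast
  have "eig_ann T \<mu> (Suc k) \<rhd> x = 0"
    by (subst eig_ann_eigenvector[OF k]) auto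
  then have "eig_ann T \<mu> (max (Suc k) n) \<rhd> x = 0"
    by (rule eig_ann_mono) simp
  moreover have "eig_ann T \<mu> (max (Suc k) n) \<rhd> y = 0"
    by (rule eig_ann_mono[OF n]) simp
  ultimately have "eig_ann T \<mu> (max (Suc k) n) \<rhd> (c *s x + y) = 0"
    by (simp add: ap_add ap_scale)
  then show ?case ..
qed auto

text \<open>An element of the span is a finite combination and hence killed by some
  \<open>eig_ann T \<mu> n\<close>, whereas w is only multiplied by a product of nonzero numbers c -
  \<mu> k.\<close>

lemma eigenvector_notin_span:
  fixes \<mu> :: "nat \<Rightarrow> complex"
  assumes "T \<rhd> w = c *s w" "w \<noteq> 0" "\<And>k. c \<noteq> \<mu> k"
  shows "w \<notin> vec.span {w. \<exists>k. T \<rhd> w = \<mu> k *s w}"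
proof
  assume "w \<in> vec.span {w. \<exists>k. T \<rhd> w = \<mu> k *s w}"
  then obtain n where "eig_ann T \<mu> n \<rhd> w = 0" using eig_ann_span by blast
  then show False
    using assms by (simp add: eig_ann_eigenvector[OF assms(1)])
qed

lemma eigenvalues_finite:
  fixes w :: "nat \<Rightarrow> complex^'d::finite"
  assumes "\<And>k. T \<rhd> w k = \<mu> k *s w k" "\<And>k. w k \<noteq> 0" "inj \<mu>"
  shows False
proof -
  have "vec.independent (w ` {..<n}) \<and> card (w ` {..<n}) = n" for n
  proof (induction n)
    case (Suc n)
    \<comment> \<open>Beyond n - 1 the sequence is replaced by a value different from \<mu> n, so
      that \<mu> n is avoided by every term.\<close>
    define \<mu>' where "\<mu>' k = (if k < n then \<mu> k else \<mu> n + 1)" for k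
    have "w n \<notin> vec.span {w. \<exists>k. T \<rhd> w = \<mu>' k *s w}"
      by (rule eigenvector_notin_span[OF assms(1,2)])
        (use \<open>inj \<mu>\<close> in \<open>auto simp: \<mu>'_def inj_def\<close>)
    moreover have "vec.span (w ` {..<n}) \<subseteq> vec.span {w. \<exists>k. T \<rhd> w = \<mu>' k *s w}"
      by (rule vec.span_mono) (use assms(1) in \<open>auto simp: \<mu>'_def\<close>)
    ultimately have a: "w n \<notin> vec.span (w ` {..<n})" by blast
    moreover have "w n \<notin> w ` {..<n}" by (rule contra_subsetD[OF vec.span_superset a])
    ultimately show ?case
      using Suc by (simp add: lessThan_Suc vec.independent_insert)
  qed (simp add: vec.independent_empty)
  from this[of "Suc CARD('d)"] show False
    using vec.independent_card_le_dim[of "w ` {..<Suc CARD('d)}" UNIV] vec_dim_card[where 'n='d and 'a=complex]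
    by simp
qed

section \<open>Highest weight vectors\<close>

text \<open>
  \<open>F q r\<close> stands for the action of $z_q \wedge z_r \in \mathfrak{so}_{2M+1}$, where the $z_q$ with
  $|q| \le M$ are weight vectors of $\mathbb{C}^{2M+1}$ with $(z_q, z_r) = $ \<open>bf q r\<close>.  They are numbered so
  that the element \<open>hh\<close> of the Cartan subalgebra maps $z_q$ to $q z_q$; thus \<open>F q r\<close> is a raising operator
  if $q + r > 0$, belongs to the Cartan subalgebra if $q + r = 0$, and is a lowering operator otherwise.
  In \<open>hw_module\<close>, \<open>l q\<close> is the coordinate $\lambda_{M+1-q}$ of the highest weight.
\<close>

definition bf :: "int \<Rightarrow> int \<Rightarrow> real" where
  "bf q r = (if q + r = 0 then (if q = 0 then 1 else 2) else 0)"

locale split_so =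
  fixes M :: int and F :: "int \<Rightarrow> int \<Rightarrow> 'd::finite endo"
  assumes F_skew: "F r q = - F q r"
    and F_bracket: "\<lbrakk>\<bar>q\<bar> \<le> M; \<bar>r\<bar> \<le> M; \<bar>s\<bar> \<le> M; \<bar>t\<bar> \<le> M\<rbrakk> \<Longrightarrow> F q r * F s t - F s t * F q r =
      bf r s *\<^sub>R F q t - bf q s *\<^sub>R F r t - bf r t *\<^sub>R F q s + bf q t *\<^sub>R F r s"
    and M_nonneg: "0 \<le> M"
begin

text \<open>The weight q / 2 compensates that \<open>F q (- q)\<close> multiplies z_q by
  \<open>bf (- q) q\<close> = 2.\<close>

definition hh :: "'d endo" where
  "hh = (\<Sum>q=1..M. (of_int q / 2) *\<^sub>R F q (- q))"

lemma F_same [simp]: "F q q = 0"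
proof -
  have "F q q + F q q = 0" using F_skew[of q q] by (metis add.right_inverse)
  then show ?thesis by (simp flip: scaleR_2)
qed

lemma sum_delta_weight:
  assumes "\<bar>s\<bar> \<le> M"
  shows "(\<Sum>q=1..M. (of_int q / 2) * (bf (- q) s - bf q s)) = (of_int s :: real)"
proof -
  have "(\<Sum>q=1..M. (of_int q / 2) * (bf (- q) s - bf q s)) =
      (\<Sum>q=1..M. (if q = s then of_int q else 0) - (if q = - s then of_int q else (0::real)))"
    by (intro sum.cong refl) (auto simp: bf_def)
  also have "\<dots> = (if s \<in> {1..M} then of_int s else 0) - (if - s \<in> {1..M} then of_int (- s) else 0)"
    by (subst sum_subtractf, subst (1 2) sum.delta) auto
  also have "\<dots> = of_int s" using assms by auto
  finally show ?thesis .
qed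

lemma hh_F_commutator:
  assumes "\<bar>s\<bar> \<le> M" "\<bar>t\<bar> \<le> M"
  shows "hh * F s t - F s t * hh = of_int (s + t) *\<^sub>R F s t"
proof -
  \<comment> \<open>\<open>bf x y\<close> is nonzero only if y = - x, so under this coefficient the
    index - x may be read as y.\<close>
  have bfF: "bf x y *\<^sub>R F (- x) z = bf x y *\<^sub>R F y z" "bf x y *\<^sub>R F z (- x) = bf x y *\<^sub>R F z y" for x y z
    by (auto simp: bf_def add_eq_0_iff)
  have key: "F q (- q) * F s t - F s t * F q (- q) = (bf (- q) s - bf q s + (bf (- q) t - bf q t)) *\<^sub>R F s t"
    if "q \<in> {1..M}" for q
  proof -
    have "F q (- q) * F s t - F s t * F q (- q) =
        bf (- q) s *\<^sub>R F q t - bf q s *\<^sub>R F (- q) t - bf (- q) t *\<^sub>R F q s + bf q t *\<^sub>R F (- q) s"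
      by (rule F_bracket) (use that assms in auto)
    also have "bf (- q) s *\<^sub>R F q t = bf (- q) s *\<^sub>R F s t"
      using bfF(1)[of "- q" s t] by simp
    also have "bf (- q) t *\<^sub>R F q s = bf (- q) t *\<^sub>R F t s"
      using bfF(1)[of "- q" t s] by simp
    finally show ?thesis
      unfolding bfF F_skew[of t s] by (simp add: algebra_simps)
  qed
  have "(\<Sum>q=1..M. (of_int q / 2) *\<^sub>R (F q (- q) * F s t - F s t * F q (- q))) =
      (\<Sum>q=1..M. (of_int q / 2 * (bf (- q) s - bf q s) + of_int q / 2 * (bf (- q) t - bf q t)) *\<^sub>R F s t)"
    by (intro sum.cong refl, simp only: key scaleR_scaleR) (simp add: algebra_simps)
  also have "\<dots> = of_int (s + t) *\<^sub>R F s t"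
    by (simp only: sum.distrib scaleR_left.sum[symmetric] sum_delta_weight[OF assms(1)]
        sum_delta_weight[OF assms(2)] of_int_add)
  finally show ?thesis
    by (simp add: hh_def sum_distrib_left sum_distrib_right sum_subtractf scaleR_diff_right)
qed

lemma hh_F:
  assumes "\<bar>s\<bar> \<le> M" "\<bar>t\<bar> \<le> M" "hh \<rhd> w = c *s w"
  shows "hh \<rhd> F s t \<rhd> w = (c + of_int (s + t)) *s (F s t \<rhd> w)"
proof -
  have "hh \<rhd> F s t \<rhd> w = (hh * F s t - F s t * hh) \<rhd> w + F s t \<rhd> hh \<rhd> w"
    by simp
  then show ?thesis
    unfolding hh_F_commutator[OF assms(1,2)] using assms(3)
    by (simp add: ap_scale scaleR_vec_eq vec_eq_iff algebra_simps)
qed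

lemma F_commute_ap:
  assumes "\<bar>q\<bar> \<le> M" "\<bar>r\<bar> \<le> M" "\<bar>s\<bar> \<le> M" "\<bar>t\<bar> \<le> M"
  shows "F q r \<rhd> F s t \<rhd> w = F s t \<rhd> F q r \<rhd> w + bf r s *\<^sub>R (F q t \<rhd> w) - bf q s *\<^sub>R (F r t \<rhd> w)
     - bf r t *\<^sub>R (F q s \<rhd> w) + bf q t *\<^sub>R (F r s \<rhd> w)"
proof -
  have "F q r \<rhd> F s t \<rhd> w = (F q r * F s t - F s t * F q r) \<rhd> w + F s t \<rhd> F q r \<rhd> w"
    by simp
  then show ?thesis
    unfolding F_bracket[OF assms] by simp
qed

section \<open>Subspaces generated by lowering operators\<close>

inductive_set low_closure :: "(complex^'d) set \<Rightarrow> (complex^'d) set" for S where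
  base: "w \<in> S \<Longrightarrow> w \<in> low_closure S"
| add: "\<lbrakk>w \<in> low_closure S; w' \<in> low_closure S\<rbrakk> \<Longrightarrow> w + w' \<in> low_closure S"
| scale: "w \<in> low_closure S \<Longrightarrow> c *s w \<in> low_closure S"
| low: "\<lbrakk>w \<in> low_closure S; \<bar>q\<bar> \<le> M; \<bar>r\<bar> \<le> M; q + r < 0\<rbrakk> \<Longrightarrow> F q r \<rhd> w \<in> low_closure S"

lemma low_closure_scaleR: "w \<in> low_closure S \<Longrightarrow> c *\<^sub>R w \<in> low_closure S"
  by (simp add: scaleR_vec_eq low_closure.scale)

lemma low_closure_diff: "w \<in> low_closure S \<Longrightarrow> w' \<in> low_closure S \<Longrightarrow> w - w' \<in> low_closure S"
  using low_closure.add[of w S "(- 1) *s w'"] low_closure.scale[of w' S "- 1"] by (simp add: vec_eq_iff)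

text \<open>Moving \<open>F q r\<close> past a lowering operator costs a bracket, which is again a
  combination of operators F applied to the shorter expression. The induction hypothesis for
  arbitrary q and r covers all terms, so stability of S under the raising and Cartan operators is
  enough.\<close>

lemma low_closure_invariant:
  assumes borel: "\<And>w q r. \<lbrakk>w \<in> S; \<bar>q\<bar> \<le> M; \<bar>r\<bar> \<le> M; q + r \<ge> 0\<rbrakk> \<Longrightarrow> F q r \<rhd> w \<in> S"
    and "w \<in> low_closure S" "\<bar>q\<bar> \<le> M" "\<bar>r\<bar> \<le> M"
  shows "F q r \<rhd> w \<in> low_closure S"
  using assms(2-)
proof (induction arbitrary: q r rule: low_closure.induct)
  case (base w)
  then show ?case
    using borel[of w q r] by (cases "q + r < 0") (auto intro: low_closure.low low_closure.base)
next
  case (low w s t)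
  note I = low_closure.add low_closure_diff low_closure_scaleR
  show ?case
    unfolding F_commute_ap[OF low.prems low.hyps(2,3)]
    by (intro I low.IH low.prems low.hyps low_closure.low)
qed (simp_all add: ap_add ap_scale low_closure.add low_closure.scale)

end

locale hw_module = split_so M F for M :: int and F :: "int \<Rightarrow> int \<Rightarrow> 'd::finite endo" +
  fixes v :: "complex^'d" and l :: "int \<Rightarrow> int"
  assumes irreducible: "\<lbrakk>vec.subspace S; \<And>q r w. \<lbrakk>\<bar>q\<bar> \<le> M; \<bar>r\<bar> \<le> M; w \<in> S\<rbrakk> \<Longrightarrow> F q r \<rhd> w \<in> S\<rbrakk> \<Longrightarrow>
      S = {0} \<or> S = UNIV"
    and v_nonzero: "v \<noteq> 0"
    and raise: "\<lbrakk>\<bar>q\<bar> \<le> M; \<bar>r\<bar> \<le> M; 0 < q + r\<rbrakk> \<Longrightarrow> F q r \<rhd> v = 0"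
    and weight: "\<lbrakk>0 < q; q \<le> M\<rbrakk> \<Longrightarrow> F q (- q) \<rhd> v = of_int (2 * l q) *s v"
begin

section \<open>The highest weight vector and its complement\<close>

definition hv :: complex where
  "hv = (\<Sum>q=1..M. of_int q * of_int (l q))"

lemma hh_v: "hh \<rhd> v = hv *s v"
proof -
  have "hh \<rhd> v = (\<Sum>q=1..M. (of_int q * of_int (l q)) *s v)"
    unfolding hh_def sum_ap
    by (intro sum.cong refl) (simp add: weight scaleR_vec_eq vec.scale_scale)
  then show ?thesis by (simp add: hv_def vec.scale_sum_left)
qed

lemma low_closure_UNIV:
  assumes "\<And>w q r. \<lbrakk>w \<in> S; \<bar>q\<bar> \<le> M; \<bar>r\<bar> \<le> M; q + r \<ge> 0\<rbrakk> \<Longrightarrow> F q r \<rhd> w \<in> S"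
    and "w \<in> S" "w \<noteq> 0"
  shows "low_closure S = UNIV"
proof -
  have "0 \<in> low_closure S"
    using low_closure.scale[OF low_closure.base[OF assms(2)], of 0] by simp
  then have "vec.subspace (low_closure S)"
    by (auto simp: vec.subspace_def low_closure.add low_closure.scale)
  then have "low_closure S = {0} \<or> low_closure S = UNIV"
    by (rule irreducible) (rule low_closure_invariant[OF assms(1)])
  moreover have "w \<in> low_closure S" using assms(2) by (rule low_closure.base)
  ultimately show ?thesis using assms(3) by auto
qed

definition lower_part :: "(complex^'d) set" where
  "lower_part = vec.span {w. \<exists>k. hh \<rhd> w = (hv - of_nat (Suc k)) *s w}"

lemma v_notin_lower: "v \<notin> lower_part"
  unfolding lower_part_def by (rule eigenvector_notin_span[OF hh_v v_nonzero]) (simp del: of_nat_Suc)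

lemma F_lower_part:
  assumes "w \<in> lower_part" "\<bar>q\<bar> \<le> M" "\<bar>r\<bar> \<le> M" "q + r \<le> 0"
  shows "F q r \<rhd> w \<in> lower_part"
proof -
  have "F q r \<rhd> w \<in> lower_part" if "hh \<rhd> w = (hv - of_nat (Suc k)) *s w" for w k
  proof -
    have "hh \<rhd> F q r \<rhd> w = (hv - of_nat (Suc k) + of_int (q + r)) *s (F q r \<rhd> w)"
      by (rule hh_F[OF assms(2,3) that])
    also have "hv - of_nat (Suc k) + of_int (q + r) = hv - of_nat (Suc (k + nat (- q - r)))"
      using assms(4) by (simp add: of_nat_nat)
    finally show ?thesis unfolding lower_part_def by (blast intro: vec.span_base)
  qed
  then have "lower_part \<subseteq> {w. F q r \<rhd> w \<in> lower_part}"
    by (subst lower_part_def, intro vec.span_minimal subspace_vimage)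
      (auto simp: lower_part_def)
  with assms(1) show ?thesis by blast
qed

text \<open>The line of v is stable under raising and Cartan operators, so by irreducibility
  lowering operators generate everything from it, and each lowering step ends in
  \<open>lower_part\<close>.\<close>

lemma decompose: "\<exists>c. w - c *s v \<in> lower_part"
proof -
  let ?S = "range (\<lambda>c. c *s v)"
  have sub: "vec.subspace lower_part" unfolding lower_part_def by simp
  have "F q r \<rhd> w \<in> ?S" if "w \<in> ?S" "\<bar>q\<bar> \<le> M" "\<bar>r\<bar> \<le> M" "q + r \<ge> 0" for w q r
  proof -
    have "F q r \<rhd> v \<in> ?S"
    proof (cases "q + r > 0")
      case True
      with that show ?thesis by (auto simp: raise intro!: image_eqI[of _ _ 0])
    next
      case False
      then have r: "r = - q" using that by simp
      consider "q > 0" | "q = 0" | "q < 0" by linarith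
      then show ?thesis
      proof cases
        case 1
        then have "F q r \<rhd> v = of_int (2 * l q) *s v"
          using weight[of q] that r by simp
        then show ?thesis by blast
      next
        case 3
        then have "F (- q) q \<rhd> v = of_int (2 * l (- q)) *s v"
          using weight[of "- q"] that by simp
        then have "F q r \<rhd> v = (- of_int (2 * l (- q))) *s v"
          unfolding r F_skew[of q "- q"] by (simp add: vec.scale_minus_left)
        then show ?thesis by blast
      qed (use r in \<open>auto intro!: image_eqI[of _ _ 0]\<close>)
    qed
    then show ?thesis using that(1) by (auto simp: ap_scale vec.scale_scale)
  qed
  then have "low_closure ?S = UNIV"
    by (rule low_closure_UNIV[of _ v]) (auto simp: v_nonzero intro: image_eqI[of _ _ 1])
  then have "w \<in> low_closure ?S" by simp
  then show ?thesis
  proof (induction rule: low_closure.induct)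
    case (base w)
    then obtain c where "w - c *s v = 0" by auto
    then show ?case using vec.subspace_0[OF sub] by metis
  next
    case (add w w')
    then obtain c c' where "w - c *s v \<in> lower_part" "w' - c' *s v \<in> lower_part" by blast
    then have "(w - c *s v) + (w' - c' *s v) \<in> lower_part" by (rule vec.subspace_add[OF sub])
    moreover have "(w - c *s v) + (w' - c' *s v) = w + w' - (c + c') *s v"
      by (simp add: vec_eq_iff algebra_simps)
    ultimately show ?case by metis
  next
    case (scale w a)
    then obtain c where "w - c *s v \<in> lower_part" by blast
    then have "a *s (w - c *s v) \<in> lower_part" by (rule vec.subspace_scale[OF sub])
    moreover have "a *s (w - c *s v) = a *s w - (a * c) *s v"
      by (simp add: vec_eq_iff algebra_simps)
    ultimately show ?case by metis
  next
    case (low w q r)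
    then obtain c where "w - c *s v \<in> lower_part" by blast
    then have "F q r \<rhd> (w - c *s v) \<in> lower_part"
      using low.hyps by (intro F_lower_part) auto
    \<comment> \<open>As q + r < 0, the eigenvalue drops by at least 1; this is the form
      \<open>Suc k\<close> that \<open>lower_part\<close> demands.\<close>
    moreover have "hh \<rhd> F q r \<rhd> v = (hv - of_nat (Suc (nat (- q - r) - 1))) *s (F q r \<rhd> v)"
      using hh_F[OF low.hyps(2,3) hh_v] low.hyps(4) by (simp add: of_nat_diff of_nat_nat algebra_simps)
    then have "F q r \<rhd> v \<in> lower_part"
      unfolding lower_part_def by (blast intro: vec.span_base)
    then have "c *s (F q r \<rhd> v) \<in> lower_part" by (rule vec.subspace_scale[OF sub])
    ultimately have "F q r \<rhd> (w - c *s v) + c *s (F q r \<rhd> v) \<in> lower_part"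
      by (rule vec.subspace_add[OF sub])
    then have "F q r \<rhd> w - 0 *s v \<in> lower_part" by (simp add: ap_diff ap_scale)
    then show ?case by blast
  qed
qed

text \<open>After subtracting a multiple of v the vector lies in \<open>lower_part\<close> and is
  still killed by raising operators. Such vectors form a set S stable under raising and Cartan
  operators. A nonzero one would generate the whole module by lowering operators, but these never
  leave \<open>lower_part\<close>, which misses v.\<close>

lemma singular_unique:
  assumes "\<And>q r. \<lbrakk>\<bar>q\<bar> \<le> M; \<bar>r\<bar> \<le> M; 0 < q + r\<rbrakk> \<Longrightarrow> F q r \<rhd> w = 0"
  shows "\<exists>c. w = c *s v"
proof -
  define S where "S = {x \<in> lower_part. \<forall>q r. \<bar>q\<bar> \<le> M \<and> \<bar>r\<bar> \<le> M \<and> 0 < q + r \<longrightarrow> F q r \<rhd> x = 0}"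
  have sub: "vec.subspace lower_part" unfolding lower_part_def by simp
  have SD: "F q r \<rhd> x = 0" if "x \<in> S" "\<bar>q\<bar> \<le> M" "\<bar>r\<bar> \<le> M" "0 < q + r" for x q r
    using that by (auto simp: S_def)
  \<comment> \<open>A bracket of a raising with a Cartan operator survives only where
    \<open>bf\<close> is nonzero, and there the remaining operator is again raising.\<close>
  have zero: "bf a b *\<^sub>R (F c d \<rhd> x) = 0" if "x \<in> S" "\<bar>c\<bar> \<le> M" "\<bar>d\<bar> \<le> M" "a + b = 0 \<Longrightarrow> 0 < c + d" for x a b c d
    using that SD[of x c d] by (auto simp: bf_def)
  have borel: "F q r \<rhd> x \<in> S" if qr: "x \<in> S" "\<bar>q\<bar> \<le> M" "\<bar>r\<bar> \<le> M" "q + r \<ge> 0" for x q r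
  proof (cases "q + r = 0")
    case True
    have "F s t \<rhd> F q r \<rhd> x = 0" if st: "\<bar>s\<bar> \<le> M" "\<bar>t\<bar> \<le> M" "0 < s + t" for s t
      unfolding F_commute_ap[OF st(1,2) qr(2,3)] using st qr True
      by (simp add: SD zero)
    then show ?thesis
      using that True F_lower_part[of x q r] by (auto simp: S_def)
  next
    case False
    then have "F q r \<rhd> x = 0" using that by (intro SD) auto
    then show ?thesis using vec.subspace_0[OF sub] by (simp add: S_def)
  qed
  have "x = 0" if "x \<in> S" for x
  proof (rule ccontr)
    assume "x \<noteq> 0"
    with borel that have "low_closure S = UNIV" by (intro low_closure_UNIV)
    moreover have "y \<in> lower_part" if "y \<in> low_closure S" for y
      using that
      by induction (auto simp: S_def vec.subspace_add[OF sub] vec.subspace_scale[OF sub] F_lower_part)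
    ultimately show False using v_notin_lower by blast
  qed
  moreover obtain c where c: "w - c *s v \<in> lower_part" using decompose by blast
  then have "w - c *s v \<in> S"
    by (simp add: S_def ap_diff ap_scale assms raise)
  ultimately have "w - c *s v = 0" by blast
  then show ?thesis by auto
qed

lemma singular_zero:
  assumes "\<And>q r. \<lbrakk>\<bar>q\<bar> \<le> M; \<bar>r\<bar> \<le> M; 0 < q + r\<rbrakk> \<Longrightarrow> F q r \<rhd> w = 0"
    and "hh \<rhd> w = c *s w" "c \<noteq> hv"
  shows "w = 0"
proof -
  obtain a where a: "w = a *s v" using singular_unique[OF assms(1)] by blast
  then have "(a * hv) *s v = (c * a) *s v"
    using assms(2) by (simp add: ap_scale hh_v vec.scale_scale)
  then have "a * hv = c * a" using v_nonzero by simp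
  then have "a = 0" using assms(3) by auto
  then show ?thesis using a by simp
qed

text \<open>\<open>F q 0\<close>, \<open>F (- q) 0\<close> and \<open>F q (- q)\<close> span a copy
  of sl_2. For negative \<open>l q\<close> none of the factors 2 * l q - k vanishes, so the string f
  k would never end and \<open>F q (- q)\<close> would have infinitely many eigenvalues.\<close>

lemma weight_nonneg:
  assumes "0 < q" "q \<le> M"
  shows "0 \<le> l q"
proof (rule ccontr)
  assume neg: "\<not> 0 \<le> l q"
  define f where "f k = ((\<lambda>w. F (- q) 0 \<rhd> w) ^^ k) v" for k
  have f_Suc: "f (Suc k) = F (- q) 0 \<rhd> f k" and f_0: "f 0 = v" for k by (simp_all add: f_def)
  have kf: "F q (- q) \<rhd> f k = of_int (2 * l q - 2 * int k) *s f k" for k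
  proof (induction k)
    case (Suc k)
    have "F q (- q) \<rhd> f (Suc k) = F (- q) 0 \<rhd> F q (- q) \<rhd> f k - 2 *\<^sub>R f (Suc k)"
      unfolding f_Suc using assms by (subst F_commute_ap) (auto simp: bf_def)
    also have "\<dots> = of_int (2 * l q - 2 * int (Suc k)) *s f (Suc k)"
      unfolding Suc ap_scale f_Suc[symmetric] scaleR_vec_eq by (simp add: vec_eq_iff algebra_simps)
    finally show ?case .
  qed (use weight[OF assms] in \<open>simp add: f_0\<close>)
  have ef: "F q 0 \<rhd> f (Suc k) = of_int (- int (Suc k) * (2 * l q - int k)) *s f k" for k
  proof (induction k)
    case 0
    then show ?case
      unfolding f_Suc f_0 using assms weight[OF assms]
      by (subst F_commute_ap) (auto simp: bf_def raise vec.scale_minus_left)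
  next
    case (Suc k)
    have "F q 0 \<rhd> f (Suc (Suc k)) = F (- q) 0 \<rhd> F q 0 \<rhd> f (Suc k) - F q (- q) \<rhd> f (Suc k)"
      unfolding f_Suc[of "Suc k"] using assms by (subst F_commute_ap) (auto simp: bf_def)
    also have "\<dots> = of_int (- int (Suc (Suc k)) * (2 * l q - int (Suc k))) *s f (Suc k)"
      unfolding Suc kf ap_scale f_Suc[symmetric] by (simp add: vec_eq_iff algebra_simps)
    finally show ?case .
  qed
  have nz: "f k \<noteq> 0" for k
  proof (induction k)
    case (Suc k)
    have "2 * l q - int k \<noteq> 0" using neg by linarith
    then have "- int (Suc k) * (2 * l q - int k) \<noteq> 0" by (simp only: mult_eq_0_iff) simp
    then have "complex_of_int (- int (Suc k) * (2 * l q - int k)) \<noteq> 0" by (subst of_int_eq_0_iff)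
    with Suc have "F q 0 \<rhd> f (Suc k) \<noteq> 0" unfolding ef by (subst vec.scale_eq_0_iff) simp
    then show ?case by auto
  qed (simp add: f_0 v_nonzero)
  show False
    by (rule eigenvalues_finite[OF kf nz]) (auto simp: inj_def simp del: of_int_mult of_int_diff)
qed

section \<open>Vector operators and their uniqueness\<close>

definition vector_op :: "(int \<Rightarrow> 'd endo) \<Rightarrow> bool" where
  "vector_op B \<longleftrightarrow> (\<forall>q r s. \<bar>q\<bar> \<le> M \<and> \<bar>r\<bar> \<le> M \<and> \<bar>s\<bar> \<le> M \<longrightarrow>
     F q r * B s - B s * F q r = bf r s *\<^sub>R B q - bf q s *\<^sub>R B r)"

lemma vector_op_ap:
  assumes "vector_op B" "\<bar>q\<bar> \<le> M" "\<bar>r\<bar> \<le> M" "\<bar>s\<bar> \<le> M"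
  shows "F q r \<rhd> B s \<rhd> w = B s \<rhd> F q r \<rhd> w + bf r s *\<^sub>R (B q \<rhd> w) - bf q s *\<^sub>R (B r \<rhd> w)"
proof -
  have "F q r \<rhd> B s \<rhd> w = (F q r * B s - B s * F q r) \<rhd> w + B s \<rhd> F q r \<rhd> w"
    by simp
  also have "F q r * B s - B s * F q r = bf r s *\<^sub>R B q - bf q s *\<^sub>R B r"
    using assms unfolding vector_op_def by blast
  finally show ?thesis by simp
qed

lemma hh_vector_op:
  assumes "vector_op B" "\<bar>s\<bar> \<le> M"
  shows "hh \<rhd> B s \<rhd> v = (hv + of_int s) *s (B s \<rhd> v)"
proof -
  have *: "F q (- q) \<rhd> B s \<rhd> v = of_int (2 * l q) *s (B s \<rhd> v) + (bf (- q) s - bf q s) *\<^sub>R (B s \<rhd> v)"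
    if "q \<in> {1..M}" for q
  proof -
    have "bf (- q) s *\<^sub>R (B q \<rhd> v) = bf (- q) s *\<^sub>R (B s \<rhd> v)" "bf q s *\<^sub>R (B (- q) \<rhd> v) = bf q s *\<^sub>R (B s \<rhd> v)"
      by (auto simp: bf_def add_eq_0_iff)
    with that weight[of q] show ?thesis
      by (subst vector_op_ap[OF assms(1)]) (use assms in \<open>auto simp: ap_scale algebra_simps\<close>)
  qed
  have "hh \<rhd> B s \<rhd> v = (\<Sum>q=1..M. (of_int q * of_int (l q)) *s (B s \<rhd> v) + (of_int q / 2 * (bf (- q) s - bf q s)) *\<^sub>R (B s \<rhd> v))"
    unfolding hh_def sum_ap
    by (intro sum.cong refl) (simp add: *, simp add: scaleR_vec_eq, simp add: vec_eq_iff algebra_simps)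
  also have "\<dots> = hv *s (B s \<rhd> v) + of_int s *\<^sub>R (B s \<rhd> v)"
    by (simp only: sum.distrib scaleR_left.sum[symmetric] vec.scale_sum_left[symmetric]
        sum_delta_weight[OF assms(2)] hv_def)
  finally show ?thesis by (simp add: scaleR_vec_eq vec.scale_left_distrib)
qed

text \<open>If \<open>bf r s\<close> is nonzero, then r = - s and q > s because q + r > 0; so the
  bracket contains only operators B of index above s, and these kill v. The same holds with q and r
  exchanged.\<close>

lemma vector_op_singular:
  assumes "vector_op B" "\<bar>s\<bar> \<le> M" "\<And>t. \<lbrakk>s < t; t \<le> M\<rbrakk> \<Longrightarrow> B t \<rhd> v = 0"
    and "\<bar>q\<bar> \<le> M" "\<bar>r\<bar> \<le> M" "0 < q + r"
  shows "F q r \<rhd> B s \<rhd> v = 0"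
  using assms(2-) by (subst vector_op_ap[OF assms(1)]) (auto simp: raise bf_def)

lemma vector_op_pos:
  assumes "vector_op B" "0 < s" "s \<le> M"
  shows "B s \<rhd> v = 0"
  using assms(2,3)
proof (induction "nat (M - s)" arbitrary: s rule: less_induct)
  case less
  show ?case
    by (rule singular_zero[OF vector_op_singular[OF assms(1)] hh_vector_op[OF assms(1)]])
      (use less in auto)
qed

text \<open>At s = 0 the singular vector has the eigenvalue \<open>hv\<close> itself, so a multiple
  of v is possible.\<close>

lemma vector_op_0: "vector_op B \<Longrightarrow> \<exists>c. B 0 \<rhd> v = c *s v"
  by (rule singular_unique, rule vector_op_singular) (auto simp: vector_op_pos M_nonneg)

lemma vector_op_unique:
  assumes B: "vector_op B" and "B 0 \<rhd> v = 0" and "\<bar>s\<bar> \<le> M"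
  shows "B s = 0"
proof -
  have Bv: "B s \<rhd> v = 0" if "\<bar>s\<bar> \<le> M" for s
    using that
  proof (induction "nat (M - s)" arbitrary: s rule: less_induct)
    case less
    show ?case
    proof (cases "s = 0")
      case False
      show ?thesis
        by (rule singular_zero[OF vector_op_singular[OF B] hh_vector_op[OF B]])
          (use less False in auto)
    qed (simp add: assms)
  qed
  \<comment> \<open>The common kernel of all B s is a submodule; since it contains v, it is
    everything.\<close>
  define S where "S = {w. \<forall>s. \<bar>s\<bar> \<le> M \<longrightarrow> B s \<rhd> w = 0}"
  have "vec.subspace S"
    by (auto simp: S_def vec.subspace_def ap_add ap_scale)
  moreover have "F q r \<rhd> w \<in> S" if "\<bar>q\<bar> \<le> M" "\<bar>r\<bar> \<le> M" "w \<in> S" for q r w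
    unfolding S_def
  proof (clarify)
    fix s :: int assume s: "\<bar>s\<bar> \<le> M"
    have "B t \<rhd> w = 0" if "\<bar>t\<bar> \<le> M" for t using that \<open>w \<in> S\<close> by (simp add: S_def)
    then show "B s \<rhd> F q r \<rhd> w = 0"
      using vector_op_ap[OF B that(1,2) s, of w] that s by simp
  qed
  ultimately have "S = {0} \<or> S = UNIV" by (rule irreducible)
  moreover have "v \<in> S" by (simp add: S_def Bv)
  ultimately have "S = UNIV" using v_nonzero by auto
  then show ?thesis using assms(3) by (intro endo_eqI) (auto simp: S_def)
qed

text \<open>For \<open>l 1 = 0\<close> the vector \<open>F (- 1) 0 \<rhd> v\<close> is singular with
  eigenvalue hv - 1, hence 0. Applying \<open>F (- 1) 0\<close> to B 1 v = 0 then leaves only the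
  bracket term, which is - 2 B 0 v.\<close>

lemma vector_op_0_zero:
  assumes B: "vector_op B" and "1 \<le> M" "l 1 = 0"
  shows "B 0 \<rhd> v = 0"
proof -
  have F1: "F 1 (- 1) \<rhd> v = 0"
    using weight[of 1] assms by simp
  have "F (- 1) 0 \<rhd> v = 0"
  proof (rule singular_zero)
    fix q r assume qr: "\<bar>q\<bar> \<le> M" "\<bar>r\<bar> \<le> M" "0 < q + r"
    show "F q r \<rhd> F (- 1) 0 \<rhd> v = 0"
      using qr assms(2)
      by (subst F_commute_ap) (auto simp: raise bf_def F1)
  next
    show "hh \<rhd> F (- 1) 0 \<rhd> v = (hv + of_int (- 1 + 0)) *s (F (- 1) 0 \<rhd> v)"
      by (rule hh_F[OF _ _ hh_v]) (use assms(2) in auto)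
  qed auto
  moreover have "F (- 1) 0 \<rhd> B 1 \<rhd> v = B 1 \<rhd> F (- 1) 0 \<rhd> v + bf 0 1 *\<^sub>R (B (- 1) \<rhd> v) - bf (- 1) 1 *\<^sub>R (B 0 \<rhd> v)"
    by (rule vector_op_ap[OF B]) (use assms(2) in auto)
  moreover have "B 1 \<rhd> v = 0" by (rule vector_op_pos[OF B]) (use assms(2) in auto)
  ultimately show ?thesis by (simp add: bf_def)
qed

lemma vector_op_proportional:
  assumes "vector_op B" "vector_op B'" "B' 0 \<rhd> v = c *s v" "c = 0 \<Longrightarrow> 1 \<le> M \<and> l 1 = 0"
  shows "\<exists>d. \<forall>s. \<bar>s\<bar> \<le> M \<longrightarrow> B s = cs d * B' s"
proof -
  obtain b where b: "B 0 \<rhd> v = b *s v" using vector_op_0[OF assms(1)] by blast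
  \<comment> \<open>If c = 0, then B 0 v = 0 as well by \<open>vector_op_0_zero\<close>, and the
    factor 0 is right.\<close>
  define d where "d = (if c = 0 then 0 else b / c)"
  have "b = d * c"
    using assms(4) vector_op_0_zero[OF assms(1)] b v_nonzero by (auto simp: d_def)
  then have z: "(B 0 - cs d * B' 0) \<rhd> v = 0"
    by (simp add: b assms(3) vec.scale_scale)
  have "vector_op (\<lambda>s. B s - cs d * B' s)"
    unfolding vector_op_def
  proof (intro allI impI)
    fix q r s assume "\<bar>q\<bar> \<le> M \<and> \<bar>r\<bar> \<le> M \<and> \<bar>s\<bar> \<le> M"
    then have 1: "F q r * B s - B s * F q r = bf r s *\<^sub>R B q - bf q s *\<^sub>R B r"
      "F q r * B' s - B' s * F q r = bf r s *\<^sub>R B' q - bf q s *\<^sub>R B' r"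
      using assms unfolding vector_op_def by blast+
    have "F q r * (B s - cs d * B' s) - (B s - cs d * B' s) * F q r =
       (F q r * B s - B s * F q r) - cs d * (F q r * B' s - B' s * F q r)"
      by (simp add: algebra_simps) (metis cs_commute mult.assoc)
    then show "F q r * (B s - cs d * B' s) - (B s - cs d * B' s) * F q r =
        bf r s *\<^sub>R (B q - cs d * B' q) - bf q s *\<^sub>R (B r - cs d * B' r)"
      unfolding 1 by (simp add: algebra_simps)
  qed
  from vector_op_unique[OF this z] have "\<forall>s. \<bar>s\<bar> \<le> M \<longrightarrow> B s = cs d * B' s" by simp
  then show ?thesis ..
qed

end

section \<open>Vector operators on irreducible modules of odd orthogonal Lie algebras\<close>

lemma cs_add: "cs (a + b) = cs a + cs b"
  by (rule endo_eqI) (simp add: vec.scale_left_distrib)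

lemma cs_mult: "cs (a * b) = cs a * cs b"
  by (rule endo_eqI) (simp add: vec.scale_scale)

lemma cs_0 [simp]: "cs 0 = 0" and cs_1 [simp]: "cs 1 = 1"
  by (auto intro: endo_eqI)

lemma cs_minus: "cs (- a) = - cs a"
  by (rule endo_eqI) (simp add: vec.scale_minus_left)

lemma cs_sum: "cs (\<Sum>i\<in>I. f i) = (\<Sum>i\<in>I. cs (f i))"
  by (induction I rule: infinite_finite_induct) (auto simp: cs_add)

lemma cs_of_real: "cs (of_real t) = t *\<^sub>R 1"
  by (rule endo_eqI) (simp add: scaleR_vec_eq)

lemma cs_left_commute: "cs c * (A * B) = A * (cs c * B)"
  by (metis cs_commute mult.assoc)

text \<open>A family indexed by an orthonormal basis is extended linearly to the complex vector u.
  This carries relations known for basis indices over to isotropic vectors.\<close>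

definition ext :: "nat set \<Rightarrow> (nat \<Rightarrow> complex) \<Rightarrow> (nat \<Rightarrow> 'd::finite endo) \<Rightarrow> 'd endo" where
  "ext U u f = (\<Sum>x\<in>U. cs (u x) * f x)"

lemma ext_arith:
  "ext U u (\<lambda>x. f x + g x) = ext U u f + ext U u g"
  "ext U u (\<lambda>x. f x - g x) = ext U u f - ext U u g"
  "ext U u (\<lambda>x. - f x) = - ext U u f"
  by (simp_all add: ext_def distrib_left right_diff_distrib sum.distrib sum_subtractf sum_negf)

lemma ext_mult_left: "A * ext U u f = ext U u (\<lambda>x. A * f x)"
  unfolding ext_def sum_distrib_left by (intro sum.cong refl) (metis cs_commute mult.assoc)

lemma ext_mult_right: "ext U u f * A = ext U u (\<lambda>x. f x * A)"
  by (simp add: ext_def sum_distrib_right mult.assoc)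

lemma ext_swap: "ext U u (\<lambda>x. ext U w (f x)) = ext U w (\<lambda>y. ext U u (\<lambda>x. f x y))"
proof -
  have "cs (u x) * (cs (w y) * f x y) = cs (w y) * (cs (u x) * f x y)" for x y
    by (metis cs_commute mult.assoc)
  then show ?thesis
    unfolding ext_def by (simp add: sum_distrib_left) (rule sum.swap)
qed

lemma ext_delta:
  assumes "finite U" "z \<in> U"
  shows "ext U u (\<lambda>x. if z = x then f x else 0) = cs (u z) * f z"
proof -
  have "ext U u (\<lambda>x. if z = x then f x else 0) = (\<Sum>x\<in>U. if z = x then cs (u x) * f x else 0)"
    unfolding ext_def by (intro sum.cong) auto
  then show ?thesis using assms by simp
qed

lemma ext_cs: "ext U u (\<lambda>x. cs c * f x) = cs c * ext U u f"
  by (simp add: ext_mult_left)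

lemma ext_dot: "ext U u (\<lambda>x. cs (w x) * A) = cs (\<Sum>x\<in>U. u x * w x) * A"
  by (simp add: ext_def cs_sum cs_mult sum_distrib_right mult.assoc)

lemma ext_cong: "(\<And>x. x \<in> U \<Longrightarrow> f x = g x) \<Longrightarrow> ext U u f = ext U u g"
  by (simp add: ext_def)

lemma ext_lin: "ext U (\<lambda>x. a * u x + b * w x) f = cs a * ext U u f + cs b * ext U w f"
  by (simp add: ext_def cs_add cs_mult distrib_right sum.distrib sum_distrib_left mult.assoc)

lemma ext_if: "ext U u (\<lambda>x. if P then f x else 0) = (if P then ext U u f else 0)"
  by (simp add: ext_def)

lemma ext_unit:
  assumes "finite U" "x \<in> U"
  shows "ext U (\<lambda>k. if x = k then 1 else 0) f = f x"
proof -
  have "ext U (\<lambda>k. if x = k then 1 else 0) f = (\<Sum>k\<in>U. if x = k then f k else 0)"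
    unfolding ext_def by (intro sum.cong) auto
  then show ?thesis using assms by simp
qed

lemma ext_ap: "ext U u f \<rhd> w = (\<Sum>x\<in>U. u x *s (f x \<rhd> w))"
  by (simp add: ext_def sum_ap)

locale so_ops = so_family D U for D :: "nat \<Rightarrow> nat \<Rightarrow> 'd::finite endo" and U +
  assumes finite_U: "finite U"
begin

definition DD :: "(nat \<Rightarrow> complex) \<Rightarrow> (nat \<Rightarrow> complex) \<Rightarrow> 'd endo" where
  "DD u w = ext U u (\<lambda>x. ext U w (D x))"

definition dot :: "(nat \<Rightarrow> complex) \<Rightarrow> (nat \<Rightarrow> complex) \<Rightarrow> complex" where
  "dot u w = (\<Sum>x\<in>U. u x * w x)"

definition index_vector_op :: "(nat \<Rightarrow> 'd endo) \<Rightarrow> bool" where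
  "index_vector_op B \<longleftrightarrow> (\<forall>x\<in>U. \<forall>y\<in>U. \<forall>a\<in>U.
     D x y * B a - B a * D x y = (if y = a then B x else 0) - (if x = a then B y else 0))"

lemma DD_skew: "DD w u = - DD u w"
proof -
  have "DD w u = ext U u (\<lambda>x. ext U w (\<lambda>y. D y x))"
    unfolding DD_def by (rule ext_swap)
  also have "\<dots> = ext U u (\<lambda>x. ext U w (\<lambda>y. - D x y))"
    by (intro ext_cong) (rule D_skew)
  finally show ?thesis by (simp add: DD_def ext_arith)
qed

lemma DD_lin: "DD (\<lambda>x. a * u x + b * w x) t = cs a * DD u t + cs b * DD w t"
  by (simp add: DD_def ext_lin)

lemma DD_lin2: "DD t (\<lambda>x. a * u x + b * w x) = cs a * DD t u + cs b * DD t w"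
  using DD_lin[of a u b w t] by (simp add: DD_skew[of t])

lemma DD_unit:
  assumes "x \<in> U" "y \<in> U"
  shows "DD (\<lambda>a. if x = a then 1 else 0) (\<lambda>a. if y = a then 1 else 0) = D x y"
  using assms by (simp add: DD_def ext_unit finite_U)

lemma DD_bracket:
  "DD u w * DD s t - DD s t * DD u w =
    cs (dot w s) * DD u t - cs (dot u s) * DD w t - cs (dot w t) * DD u s + cs (dot u t) * DD w s"
proof -
  note delta = ext_delta[OF finite_U]
  let ?E = "\<lambda>f. ext U u (\<lambda>x. ext U w (\<lambda>y. ext U s (\<lambda>z. ext U t (f x y z))))"
  have "DD s t * DD u w = ?E (\<lambda>x y z p. D z p * D x y)"
    by (simp add: DD_def ext_mult_left) (simp add: ext_mult_right)
  moreover have "DD u w * DD s t = ?E (\<lambda>x y z p. D x y * D z p)"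
    by (simp add: DD_def ext_mult_right) (simp add: ext_mult_left)
  ultimately have "DD u w * DD s t - DD s t * DD u w = ?E (\<lambda>x y z p. D x y * D z p - D z p * D x y)"
    by (simp add: ext_arith)
  also have "\<dots> = ?E (\<lambda>x y z p. (if y = z then D x p else 0) - (if x = z then D y p else 0)
      - (if y = p then D x z else 0) + (if x = p then D y z else 0))"
    by (intro ext_cong D_bracket)
  also have "\<dots> = ext U u (\<lambda>x. ext U w (\<lambda>y. cs (s y) * ext U t (D x) - cs (s x) * ext U t (D y)
      - cs (t y) * ext U s (D x) + cs (t x) * ext U s (D y)))"
    by (intro ext_cong) (simp add: ext_arith ext_if delta ext_cs)
  also have "\<dots> = cs (dot w s) * DD u t - cs (dot u s) * DD w t - cs (dot w t) * DD u s + cs (dot u t) * DD w s"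
    by (simp add: ext_arith ext_dot ext_cs DD_def dot_def)
  finally show ?thesis .
qed

lemma DD_vector_op:
  assumes "index_vector_op B"
  shows "DD u w * ext U s B - ext U s B * DD u w = cs (dot w s) * ext U u B - cs (dot u s) * ext U w B"
proof -
  note delta = ext_delta[OF finite_U]
  let ?E = "\<lambda>f. ext U u (\<lambda>x. ext U w (\<lambda>y. ext U s (f x y)))"
  have "ext U s B * DD u w = ?E (\<lambda>x y a. B a * D x y)"
    by (simp add: DD_def ext_mult_left) (simp add: ext_mult_right)
  moreover have "DD u w * ext U s B = ?E (\<lambda>x y a. D x y * B a)"
    by (simp add: DD_def ext_mult_right) (simp add: ext_mult_left)
  ultimately have "DD u w * ext U s B - ext U s B * DD u w = ?E (\<lambda>x y a. D x y * B a - B a * D x y)"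
    by (simp add: ext_arith)
  also have "\<dots> = ?E (\<lambda>x y a. (if y = a then B x else 0) - (if x = a then B y else 0))"
    by (intro ext_cong) (use assms in \<open>simp add: index_vector_op_def\<close>)
  also have "\<dots> = ext U u (\<lambda>x. ext U w (\<lambda>y. cs (s y) * B x - cs (s x) * B y))"
    by (intro ext_cong) (simp add: ext_arith delta)
  also have "\<dots> = cs (dot w s) * ext U u B - cs (dot u s) * ext U w B"
    by (simp add: ext_arith ext_dot ext_cs dot_def)
  finally show ?thesis .
qed

section \<open>The Casimir operator\<close>

lemma sum_delta_ops:
  fixes g :: "nat \<Rightarrow> 'd endo"
  assumes "a \<in> U"
  shows "(\<Sum>x\<in>U. (if a = x then f x else 0) * g x) = f a * g a"
    "(\<Sum>x\<in>U. g x * (if a = x then f x else 0)) = g a * f a"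
    "(\<Sum>x\<in>U. (if x = a then f x else 0) * g x) = f a * g a"
    "(\<Sum>x\<in>U. g x * (if x = a then f x else 0)) = g a * f a"
  using assms finite_U by (simp_all add: if_distrib if_distribR sum.delta sum.delta' cong: if_cong)

definition casimir :: "'d endo" where
  "casimir = (\<Sum>x\<in>U. \<Sum>y\<in>U. D x y * D x y)"

text \<open>The commutator acts on either factor of \<open>D x y * D x y\<close>. It leaves sums
  over one free index of products with one index a and one index b, and skew-symmetry makes these
  cancel.\<close>

lemma casimir_commute:
  assumes "a \<in> U" "b \<in> U"
  shows "D a b * casimir = casimir * D a b"
proof -
  define c where "c x y = D a b * D x y - D x y * D a b" for x y
  have c: "c x y = (if b = x then D a y else 0) - (if a = x then D b y else 0)
      - (if b = y then D a x else 0) + (if a = y then D b x else 0)" if "x \<in> U" "y \<in> U" for x y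
    unfolding c_def by (rule D_bracket) (use assms that in auto)
  have skew: "(\<Sum>x\<in>U. D a x * D x b) = - (\<Sum>x\<in>U. D a x * D b x)" "(\<Sum>x\<in>U. D b x * D x a) = - (\<Sum>x\<in>U. D b x * D a x)"
    "(\<Sum>x\<in>U. D x b * D a x) = - (\<Sum>x\<in>U. D b x * D a x)" "(\<Sum>x\<in>U. D x a * D b x) = - (\<Sum>x\<in>U. D a x * D b x)"
    using assms by (simp_all add: sum_negf[symmetric] D_skew[of b] D_skew[of a])
  have "D a b * casimir - casimir * D a b = (\<Sum>x\<in>U. \<Sum>y\<in>U. c x y * D x y) + (\<Sum>x\<in>U. \<Sum>y\<in>U. D x y * c x y)"
    by (simp add: casimir_def c_def sum_distrib_left sum_distrib_right sum.distrib[symmetric] sum_subtractf[symmetric]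
        algebra_simps)
  also have "(\<Sum>x\<in>U. \<Sum>y\<in>U. c x y * D x y) = (\<Sum>x\<in>U. \<Sum>y\<in>U. ((if b = x then D a y else 0) - (if a = x then D b y else 0)
      - (if b = y then D a x else 0) + (if a = y then D b x else 0)) * D x y)"
    by (intro sum.cong refl) (simp add: c)
  also have "\<dots> = (\<Sum>y\<in>U. D a y * D b y) - (\<Sum>y\<in>U. D b y * D a y) - (\<Sum>x\<in>U. D a x * D x b) + (\<Sum>x\<in>U. D b x * D x a)"
    apply (simp add: distrib_right left_diff_distrib sum.distrib sum_subtractf sum_delta_ops assms)
    apply (subst (1 2) sum.swap)
    apply (simp add: sum_delta_ops assms)
    done
  also have "(\<Sum>x\<in>U. \<Sum>y\<in>U. D x y * c x y) = (\<Sum>x\<in>U. \<Sum>y\<in>U. D x y * ((if b = x then D a y else 0) - (if a = x then D b y else 0)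
      - (if b = y then D a x else 0) + (if a = y then D b x else 0)))"
    by (intro sum.cong refl) (simp add: c)
  also have "\<dots> = (\<Sum>y\<in>U. D b y * D a y) - (\<Sum>y\<in>U. D a y * D b y) - (\<Sum>x\<in>U. D x b * D a x) + (\<Sum>x\<in>U. D x a * D b x)"
    apply (simp add: distrib_left right_diff_distrib sum.distrib sum_subtractf sum_delta_ops assms)
    apply (subst (1 2) sum.swap)
    apply (simp add: sum_delta_ops assms)
    done
  finally show ?thesis unfolding skew by simp
qed

text \<open>Expanding [casimir, B a] = 0 by the brackets [D x y, B a] shows that the sums of
  \<open>B x * D x a\<close> and of \<open>D x a * B x\<close> are opposite. Commuting the factors
  also shows that they differ by (card U - 1) B a, since every x other than a contributes - B
  a.\<close>

lemma vector_op_casimir: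
  assumes B: "index_vector_op B" and a: "a \<in> U" and "casimir * B a = B a * casimir"
  shows "(\<Sum>x\<in>U. B x * D x a) = ((real (card U) - 1) / 2) *\<^sub>R B a"
proof -
  define c where "c x y = D x y * B a - B a * D x y" for x y
  have c: "c x y = (if y = a then B x else 0) - (if x = a then B y else 0)" if "x \<in> U" "y \<in> U" for x y
    unfolding c_def using B a that by (simp add: index_vector_op_def)
  have skew: "(\<Sum>x\<in>U. D a x * B x) = - (\<Sum>x\<in>U. D x a * B x)" "(\<Sum>x\<in>U. B x * D a x) = - (\<Sum>x\<in>U. B x * D x a)"
    using a by (simp_all add: sum_negf[symmetric] D_skew[of a])
  have "0 = casimir * B a - B a * casimir" using assms(3) by simp
  also have "\<dots> = (\<Sum>x\<in>U. \<Sum>y\<in>U. c x y * D x y) + (\<Sum>x\<in>U. \<Sum>y\<in>U. D x y * c x y)"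
    by (simp add: casimir_def c_def sum_distrib_left sum_distrib_right sum.distrib[symmetric] sum_subtractf[symmetric]
        algebra_simps)
  also have "(\<Sum>x\<in>U. \<Sum>y\<in>U. c x y * D x y) = (\<Sum>x\<in>U. \<Sum>y\<in>U. ((if y = a then B x else 0) - (if x = a then B y else 0)) * D x y)"
    by (intro sum.cong refl) (simp add: c)
  also have "\<dots> = (\<Sum>x\<in>U. B x * D x a) - (\<Sum>x\<in>U. B x * D a x)"
    apply (simp add: left_diff_distrib sum_subtractf sum_delta_ops a)
    apply (subst sum.swap)
    apply (simp add: sum_delta_ops a)
    done
  also have "(\<Sum>x\<in>U. \<Sum>y\<in>U. D x y * c x y) = (\<Sum>x\<in>U. \<Sum>y\<in>U. D x y * ((if y = a then B x else 0) - (if x = a then B y else 0)))"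
    by (intro sum.cong refl) (simp add: c)
  also have "\<dots> = (\<Sum>x\<in>U. D x a * B x) - (\<Sum>x\<in>U. D a x * B x)"
    apply (simp add: right_diff_distrib sum_subtractf sum_delta_ops a)
    apply (subst sum.swap)
    apply (simp add: sum_delta_ops a)
    done
  finally have "2 *\<^sub>R ((\<Sum>x\<in>U. B x * D x a) + (\<Sum>x\<in>U. D x a * B x)) = 0"
    unfolding skew by (simp add: scaleR_2 algebra_simps)
  then have s: "(\<Sum>x\<in>U. B x * D x a) + (\<Sum>x\<in>U. D x a * B x) = 0" by simp
  have "D x a * B x = B x * D x a + ((if x = a then B a else 0) - B a)" if "x \<in> U" for x
  proof -
    have "D x a * B x - B x * D x a = (if a = x then B x else 0) - (if x = x then B a else 0)"
      using B a that unfolding index_vector_op_def by blast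
    then show ?thesis by (auto simp: algebra_simps)
  qed
  then have "(\<Sum>x\<in>U. D x a * B x) = (\<Sum>x\<in>U. B x * D x a + ((if x = a then B a else 0) - B a))"
    by simp
  also have "\<dots> = (\<Sum>x\<in>U. B x * D x a) + (B a - real (card U) *\<^sub>R B a)"
    using finite_U a by (simp add: sum.distrib sum_subtractf scaleR_conv_of_real)
  finally have E: "(\<Sum>x\<in>U. D x a * B x) = (\<Sum>x\<in>U. B x * D x a) + (B a - real (card U) *\<^sub>R B a)" .
  have "(\<Sum>x\<in>U. B x * D x a) + (\<Sum>x\<in>U. B x * D x a) = (\<Sum>x\<in>U. B x * D x a) - (\<Sum>x\<in>U. D x a * B x)"
    unfolding minus_unique[OF s, symmetric] by simp
  then have "2 *\<^sub>R (\<Sum>x\<in>U. B x * D x a) = (real (card U) - 1) *\<^sub>R B a"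
    unfolding E by (simp add: scaleR_2 scaleR_diff_left)
  then have "(1 / 2) *\<^sub>R 2 *\<^sub>R (\<Sum>x\<in>U. B x * D x a) = (1 / 2) *\<^sub>R (real (card U) - 1) *\<^sub>R B a"
    by simp
  then show ?thesis by simp
qed

end

text \<open>Each factor is a sum of two nonnegative numbers, and M - j is positive unless j =
  M.\<close>

lemma prod_nonzero_iff_shift:
  fixes lam :: "nat \<Rightarrow> int"
  assumes "\<And>j. j \<in> {1..M} \<Longrightarrow> 0 \<le> lam j" "(\<Prod>j=1..M. (of_int (lam j) + of_nat (M - j) :: complex)) = 0"
  shows "1 \<le> M \<and> lam M = 0"
proof -
  obtain j where j: "j \<in> {1..M}" "of_int (lam j) + of_nat (M - j) = (0 :: complex)"
    using assms(2) by auto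
  then have "complex_of_int (lam j + int (M - j)) = 0" by simp
  then have "lam j + int (M - j) = 0" by (simp only: of_int_eq_0_iff)
  with assms(1)[OF j(1)] j(1) have "j = M" "lam j = 0" by auto
  then show ?thesis using j by auto
qed

text \<open>\<open>raise_v\<close> is the highest weight condition in orthonormal coordinates: the
  operator of the wedge of e_{2j-1} + i e_{2j} with e_y kills v for all y > 2j. The factor - i in
  \<open>weight_v\<close> appears because the Cartan element is i A_{2j,2j-1}.\<close>

locale so_module = so_ops D U for D :: "nat \<Rightarrow> nat \<Rightarrow> 'd::finite endo" and U +
  fixes M :: nat and v :: "complex^'d" and lam :: "nat \<Rightarrow> int"
  assumes U_eq: "U = {1..2 * M + 1}"
    and irred: "\<lbrakk>vec.subspace S; \<And>x y w. \<lbrakk>x \<in> U; y \<in> U; w \<in> S\<rbrakk> \<Longrightarrow> D x y \<rhd> w \<in> S\<rbrakk> \<Longrightarrow>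
      S = {0} \<or> S = UNIV"
    and v_nz: "v \<noteq> 0"
    and weight_v: "j \<in> {1..M} \<Longrightarrow> D (2 * j) (2 * j - 1) \<rhd> v = (- \<i> * of_int (lam j)) *s v"
    and raise_v: "\<lbrakk>j \<in> {1..M}; y \<in> {2 * j<..2 * M + 1}\<rbrakk> \<Longrightarrow> D (2 * j) y \<rhd> v = \<i> *s (D (2 * j - 1) y \<rhd> v)"
begin

text \<open>In the expansion along the rows 2j - 1 and 2j, the entry of these two rows contributes -
  i lam j. In the double sum the entries of row 2j commute with the minors and reach v, where
  \<open>raise_v\<close> turns them into i times entries of row 2j - 1;
  \<open>pf_same_row_sum\<close> then contributes - i (M - j).\<close>

lemma pf_tail:
  assumes "k \<le> M"
  shows "pf D {2 * (M - k) + 1..2 * M} \<rhd> v =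
    (\<Prod>j\<in>{M - k<..M}. - \<i> * (of_int (lam j) + of_nat (M - j))) *s v"
  using assms
proof (induction k)
  case (Suc k)
  define j where "j = M - k"
  define S where "S = {2 * (j - 1) + 1..2 * M}"
  define R where "R = {2 * j + 1..2 * M}"
  let ?x = "2 * j - 1" and ?y = "2 * j"
  have j: "j \<in> {1..M}" using Suc.prems by (auto simp: j_def)
  have S: "finite S" "S \<subseteq> U" "?x \<in> S" "?y \<in> S" "?x \<noteq> ?y" "S - {?x, ?y} = R"
    using j by (auto simp: S_def R_def U_eq)
  have R: "finite R" "R \<subseteq> U" "?x \<in> U" "?y \<in> U" "?x \<notin> R" "?y \<notin> R"
    using j by (auto simp: R_def U_eq)
  have card: "card R = 2 * (M - j)" by (simp add: R_def)
  have sign: "pf_sign S ?x ?y = - 1"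
  proof -
    have "{c \<in> S. c < ?x} = {}" "{c \<in> S. c < ?y} = {?x}" using j by (auto simp: S_def)
    then have "pos_sign S ?x = 1" "pos_sign S ?y = - 1" by (simp_all only: pos_sign_def) simp_all
    then show ?thesis using j by (simp add: pf_sign_def sgl_def)
  qed
  have "(D ?x a * D ?y b * pf D (R - {a, b})) \<rhd> v = \<i> *s ((D ?x a * D ?x b * pf D (R - {a, b})) \<rhd> v)"
    if "a \<in> R" "b \<in> R - {a}" for a b
  proof -
    have c: "D z b * pf D (R - {a, b}) = pf D (R - {a, b}) * D z b" if "z \<in> {?x, ?y}" for z
      by (rule D_pf_commute) (use R that \<open>b \<in> R - {a}\<close> in auto)
    have "(D ?y b * pf D (R - {a, b})) \<rhd> v = \<i> *s ((D ?x b * pf D (R - {a, b})) \<rhd> v)"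
      using raise_v[OF j, of b] that by (simp only: c insertI1 insertI2 ap_simps(4)) (simp add: ap_scale R_def)
    then show ?thesis by (simp add: ap_scale)
  qed
  then have "(\<Sum>a\<in>R. \<Sum>b\<in>R - {a}. pf_sign R a b *\<^sub>R (D ?x a * D ?y b * pf D (R - {a, b}))) \<rhd> v =
      \<i> *s ((\<Sum>a\<in>R. \<Sum>b\<in>R - {a}. pf_sign R a b *\<^sub>R (D ?x a * D ?x b * pf D (R - {a, b}))) \<rhd> v)"
    unfolding sum_ap vec.scale_sum_right
    by (intro sum.cong refl) (simp add: scaleR_vec_eq vec.scale_scale mult.commute)
  also have "\<dots> = \<i> *s ((- real (M - j)) *\<^sub>R (pf D R \<rhd> v))"
    by (subst pf_same_row_sum) (use R card in auto)
  finally have sum: "(\<Sum>a\<in>R. \<Sum>b\<in>R - {a}. pf_sign R a b *\<^sub>R (D ?x a * D ?y b * pf D (R - {a, b}))) \<rhd> v =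
      (- \<i> * of_nat (M - j)) *s (pf D R \<rhd> v)"
    by (simp add: scaleR_vec_eq vec.scale_scale)
  have "D ?x ?y * pf D R = pf D R * D ?x ?y"
    by (rule D_pf_commute) (use R in auto)
  moreover have "D ?x ?y = - D ?y ?x" by (rule D_skew) (use R in auto)
  ultimately have "(D ?x ?y * pf D R) \<rhd> v = (\<i> * of_int (lam j)) *s (pf D R \<rhd> v)"
    using weight_v[OF j] by (simp add: ap_minus ap_scale vec.scale_minus_left)
  moreover have "pf D S \<rhd> v = (\<Sum>a\<in>R. \<Sum>b\<in>R - {a}. pf_sign R a b *\<^sub>R
      (D ?x a * D ?y b * pf D (R - {a, b}))) \<rhd> v - (D ?x ?y * pf D R) \<rhd> v"
    by (subst pf_two_rows[OF S(1-5)], unfold S(6) sign) simp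
  ultimately have "pf D S \<rhd> v = (- \<i> * (of_int (lam j) + of_nat (M - j))) *s (pf D R \<rhd> v)"
    unfolding sum by (simp only: vec.scale_left_diff_distrib[symmetric]) (simp add: algebra_simps)
  also have "pf D R \<rhd> v = (\<Prod>j\<in>{j<..M}. - \<i> * (of_int (lam j) + of_nat (M - j))) *s v"
    using Suc by (simp add: R_def j_def)
  also have "{M - Suc k<..M} = insert j {j<..M}"
    using j by (auto simp: j_def)
  moreover have "{2 * (M - Suc k) + 1..2 * M} = S" by (simp add: S_def j_def)
  ultimately show ?case
    by (simp add: vec.scale_scale)
qed simp

lemma pf_eigenvalue:
  "pf D {1..2 * M} \<rhd> v = ((- \<i>) ^ M * (\<Prod>j=1..M. (of_int (lam j) + of_nat (M - j)))) *s v"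
proof -
  have "{0<..M} = {1..M}" by auto
  moreover have "(\<Prod>j=1..M. - \<i> * (of_int (lam j) + of_nat (M - j))) =
      (- \<i>) ^ M * (\<Prod>j=1..M. (of_int (lam j) + of_nat (M - j)))"
    by (simp only: prod.distrib prod_constant card_atLeastAtMost) simp
  ultimately show ?thesis using pf_tail[of M] by simp
qed

section \<open>Passage to isotropic coordinates\<close>

definition row_idx :: "int \<Rightarrow> nat" where
  "row_idx q = nat (int M + 1 - \<bar>q\<bar>)"

text \<open>
  The isotropic vectors \<open>zc q\<close> for \<open>q \<noteq> 0\<close> are $e_{2j-1} \pm \sqrt{-1} e_{2j}$ with $j = M + 1 - |q|$,
  numbered so that \<open>q\<close> is the eigenvalue under the element \<open>hh\<close> of the Cartan subalgebra.
\<close>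

definition zc :: "int \<Rightarrow> nat \<Rightarrow> complex" where
  "zc q x = (if q = 0 then (if x = 2 * M + 1 then 1 else 0)
     else if x + 1 = 2 * row_idx q then 1 else if x = 2 * row_idx q then \<i> * of_int (sgn q) else 0)"

lemma row_idx: "q \<noteq> 0 \<Longrightarrow> \<bar>q\<bar> \<le> int M \<Longrightarrow> row_idx q \<in> {1..M}"
  by (auto simp: row_idx_def)

lemma zc_odd: "r \<noteq> 0 \<Longrightarrow> 1 \<le> a \<Longrightarrow> zc r (2 * a - Suc 0) = (if row_idx r = a then 1 else 0)"
  unfolding zc_def by (cases a) (simp, use even_Suc_div_two double_not_eq_Suc_double in \<open>auto\<close>)

lemma zc_even: "r \<noteq> 0 \<Longrightarrow> zc r (2 * a) = (if row_idx r = a then \<i> * of_int (sgn r) else 0)"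
  unfolding zc_def using double_not_eq_Suc_double by auto

lemma zc_sum:
  fixes f :: "nat \<Rightarrow> complex^'b"
  assumes "\<bar>q\<bar> \<le> int M"
  shows "(\<Sum>x\<in>U. zc q x *s f x) = (if q = 0 then f (2 * M + 1)
     else f (2 * row_idx q - 1) + (\<i> * of_int (sgn q)) *s f (2 * row_idx q))"
proof (cases "q = 0")
  case True
  have "(\<Sum>x\<in>U. zc q x *s f x) = (\<Sum>x\<in>U. if 2 * M + 1 = x then f x else 0)"
    by (intro sum.cong) (auto simp: zc_def True)
  then show ?thesis using True by (simp add: U_eq)
next
  case False
  note r = row_idx[OF False assms]
  have "(\<Sum>x\<in>U. zc q x *s f x) = (\<Sum>x\<in>U. (if 2 * row_idx q - 1 = x then f x else 0) +
      (if 2 * row_idx q = x then (\<i> * of_int (sgn q)) *s f x else 0))"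
    using r by (intro sum.cong) (auto simp: zc_def False)
  moreover have "2 * row_idx q - 1 \<in> U" "2 * row_idx q \<in> U"
    using r by (auto simp: U_eq)
  ultimately show ?thesis
    using False by (simp only: sum.distrib sum.delta' finite_U if_True if_False)
qed

lemma dot_zc:
  assumes "\<bar>q\<bar> \<le> int M" "\<bar>r\<bar> \<le> int M"
  shows "dot (zc q) (zc r) = complex_of_real (bf q r)"
proof -
  \<comment> \<open>\<open>zc_sum\<close> is stated for vectors, so the scalar product is read as
    the entry of a vector of dimension 1.\<close>
  have "dot (zc q) (zc r) = (\<Sum>x\<in>U. zc q x *s (\<chi> i. zc r x)) $ (undefined :: 1)"
    by (simp only: dot_def sum_component vector_smult_component vec_lambda_beta)
  also have "\<dots> = (if q = 0 then zc r (2 * M + 1)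
     else zc r (2 * row_idx q - 1) + (\<i> * of_int (sgn q)) * zc r (2 * row_idx q))"
    unfolding zc_sum[OF assms(1)] by simp
  also have "\<dots> = complex_of_real (bf q r)"
  proof -
    consider "q = 0" "r = 0" | "q = 0" "r \<noteq> 0" | "q \<noteq> 0" "r = 0" | "q \<noteq> 0" "r \<noteq> 0" by blast
    then show ?thesis
    proof cases
      case 2
      then show ?thesis using row_idx[of r] assms by (simp add: zc_def bf_def)
    next
      case 3
      then have "2 * row_idx q - Suc 0 \<noteq> Suc (2 * M)" using row_idx[of q] assms by auto
      then show ?thesis using 3 row_idx[of q] assms by (simp add: zc_def bf_def)
    next
      case 4
      then have "row_idx r = row_idx q \<longleftrightarrow> q = r \<or> q = - r" "1 \<le> row_idx q"
        using assms by (auto simp: row_idx_def)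
      then show ?thesis
        using 4 by (simp add: zc_odd zc_even bf_def sgn_if add_eq_0_iff)
    qed (simp add: zc_def bf_def)
  qed
  finally show ?thesis .
qed

text \<open>With z_q and z_{-q} belonging to the pair j, e_{2j-1} = (z_q + z_{-q}) / 2 and e_{2j} =
  (z_q - z_{-q}) / (2 i). The index q = M + 1 - j inverts \<open>row_idx\<close>.\<close>

lemma unit_vector_split:
  assumes "x \<in> U"
  shows "\<exists>q r a b. \<bar>q\<bar> \<le> int M \<and> \<bar>r\<bar> \<le> int M \<and>
    (\<lambda>k. if x = k then 1 else 0) = (\<lambda>k. a * zc q k + b * zc r k)"
proof -
  define j where "j = (x + 1) div 2"
  define q where "q = int M + 1 - int j"
  consider "x = 2 * M + 1" | "j \<in> {1..M}" "x + 1 = 2 * j" | "j \<in> {1..M}" "x = 2 * j"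
    using assms unfolding j_def U_eq by fastforce
  then show ?thesis
  proof cases
    case 1
    then have "(\<lambda>k. if x = k then 1 else 0) = (\<lambda>k. 1 * zc 0 k + 0 * zc 0 k)"
      by (auto simp: zc_def fun_eq_iff)
    then show ?thesis by (metis abs_zero of_nat_0_le_iff)
  next
    case 2
    then have q: "q > 0" "\<bar>q\<bar> \<le> int M" "row_idx q = j" "row_idx (- q) = j" by (auto simp: q_def row_idx_def)
    have "(\<lambda>k. if x = k then 1 else 0) = (\<lambda>k. (1 / 2) * zc q k + (1 / 2) * zc (- q) k)"
      using q 2 by (auto simp: zc_def fun_eq_iff)
    then show ?thesis
      using q by (intro exI[of _ q] exI[of _ "- q"] exI[of _ "1 / 2 :: complex"] conjI) simp_all
  next
    case 3
    then have q: "q > 0" "\<bar>q\<bar> \<le> int M" "row_idx q = j" "row_idx (- q) = j" by (auto simp: q_def row_idx_def)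
    have "(\<lambda>k. if x = k then 1 else 0) = (\<lambda>k. (- \<i> / 2) * zc q k + (\<i> / 2) * zc (- q) k)"
      using q 3 by (auto simp: zc_def fun_eq_iff)
    then show ?thesis
      using q by (intro exI[of _ q] exI[of _ "- q"] exI[of _ "- \<i> / 2"] exI[of _ "\<i> / 2"] conjI) simp_all
  qed
qed

definition FF :: "int \<Rightarrow> int \<Rightarrow> 'd endo" where
  "FF q r = DD (zc q) (zc r)"

text \<open>Larger |q| means an earlier pair of coordinates. For |r| < q the vector z_r is therefore
  supported beyond \<open>2 * row_idx q\<close>, where \<open>raise_v\<close> applies coordinate by
  coordinate.\<close>

lemma FF_raise:
  assumes "\<bar>r\<bar> < q" "q \<le> int M"
  shows "FF q r \<rhd> v = 0"
proof -
  have q: "row_idx q \<in> {1..M}" "q \<noteq> 0" "\<bar>q\<bar> \<le> int M" using assms row_idx[of q] by auto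
  have "zc r y *s (ext U (zc q) (\<lambda>x. D x y) \<rhd> v) = 0" if "y \<in> U" for y
  proof (cases "zc r y = 0")
    case False
    then have y: "y > 2 * row_idx q"
      using assms q(1) by (auto simp: zc_def row_idx_def split: if_splits)
    have "ext U (zc q) (\<lambda>x. D x y) \<rhd> v = D (2 * row_idx q - 1) y \<rhd> v + (\<i> * of_int (sgn q)) *s (D (2 * row_idx q) y \<rhd> v)"
      unfolding ext_ap zc_sum[OF q(3)] using q by simp
    also have "\<dots> = 0"
      using assms raise_v[OF q(1), of y] y that by (simp add: vec.scale_scale U_eq)
    finally show ?thesis by simp
  qed simp
  then show ?thesis
    unfolding FF_def DD_def by (subst ext_swap, subst ext_ap) (rule sum.neutral, blast)
qed

sublocale hw: hw_module "int M" FF v "\<lambda>q. lam (row_idx q)"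
proof
  fix q r s t :: int
  show "FF r q = - FF q r" unfolding FF_def by (rule DD_skew)
  assume qr: "\<bar>q\<bar> \<le> int M" "\<bar>r\<bar> \<le> int M"
  show "FF q r * FF s t - FF s t * FF q r =
      bf r s *\<^sub>R FF q t - bf q s *\<^sub>R FF r t - bf r t *\<^sub>R FF q s + bf q t *\<^sub>R FF r s"
    if "\<bar>s\<bar> \<le> int M" "\<bar>t\<bar> \<le> int M"
    using qr that by (simp add: FF_def DD_bracket dot_zc cs_of_real)
  show "FF q r \<rhd> v = 0" if pos: "0 < q + r"
  proof -
    consider "\<bar>r\<bar> < q" | "\<bar>q\<bar> < r" | "q = r" using pos by linarith
    then show ?thesis
    proof cases
      case 1
      then show ?thesis using FF_raise[of r q] qr by simp
    next
      case 2
      then have "FF r q \<rhd> v = 0" using FF_raise[of q r] qr by simp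
      moreover have "FF q r = - FF r q" unfolding FF_def by (rule DD_skew)
      ultimately show ?thesis by simp
    next
      case 3
      have "FF q q = - FF q q" unfolding FF_def by (rule DD_skew)
      then have "FF q q + FF q q = 0" by (metis add.right_inverse)
      then show ?thesis using 3 by (simp flip: scaleR_2)
    qed
  qed
next
  fix q :: int assume q: "0 < q" "q \<le> int M"
  let ?j = "row_idx q"
  have j: "?j \<in> {1..M}" "row_idx (- q) = ?j" using q row_idx[of q] by (auto simp: row_idx_def)
  have U: "2 * ?j - 1 \<in> U" "2 * ?j \<in> U" using j by (auto simp: U_eq)
  have G: "ext U (zc (- q)) (D x) \<rhd> v = D x (2 * ?j - 1) \<rhd> v - \<i> *s (D x (2 * ?j) \<rhd> v)" for x
    unfolding ext_ap using zc_sum[of "- q" "\<lambda>y. D x y \<rhd> v"] q j(2) by (simp add: vec.scale_minus_left)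
  have "FF q (- q) \<rhd> v = ext U (zc (- q)) (D (2 * ?j - 1)) \<rhd> v + \<i> *s (ext U (zc (- q)) (D (2 * ?j)) \<rhd> v)"
    unfolding FF_def DD_def ext_ap[of _ "zc q"]
    using zc_sum[of q "\<lambda>x. ext U (zc (- q)) (D x) \<rhd> v"] q by simp
  also have "\<dots> = (2 * \<i>) *s (D (2 * ?j) (2 * ?j - 1) \<rhd> v)"
    unfolding G D_skew[OF U(2,1)] using D_same[OF U(1)] D_same[OF U(2)]
    by (simp add: vec_eq_iff)
  also have "\<dots> = of_int (2 * lam (row_idx q)) *s v"
  proof -
    have "(2 * \<i>) * (- \<i> * of_int (lam (row_idx q))) = of_int (2 * lam (row_idx q))" by simp
    then show ?thesis unfolding weight_v[OF j(1)] vec.scale_scale by (simp only:)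
  qed
  finally show "FF q (- q) \<rhd> v = of_int (2 * lam (row_idx q)) *s v" .
next
  fix S :: "(complex^'d) set"
  assume S: "vec.subspace S" and inv: "\<And>q r w. \<lbrakk>\<bar>q\<bar> \<le> int M; \<bar>r\<bar> \<le> int M; w \<in> S\<rbrakk> \<Longrightarrow> FF q r \<rhd> w \<in> S"
  \<comment> \<open>Unit vectors are combinations of two isotropic ones, so every
    \<open>D x y\<close> is a combination of four operators \<open>FF\<close>.\<close>
  show "S = {0} \<or> S = UNIV"
  proof (rule irred[OF S])
    fix x y w assume xy: "x \<in> U" "y \<in> U" and w: "w \<in> S"
    obtain q r a b where 1: "\<bar>q\<bar> \<le> int M" "\<bar>r\<bar> \<le> int M" "(\<lambda>k. if x = k then 1 else 0) = (\<lambda>k. a * zc q k + b * zc r k)"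
      using unit_vector_split[OF xy(1)] by blast
    obtain q' r' a' b' where 2: "\<bar>q'\<bar> \<le> int M" "\<bar>r'\<bar> \<le> int M" "(\<lambda>k. if y = k then 1 else 0) = (\<lambda>k. a' * zc q' k + b' * zc r' k)"
      using unit_vector_split[OF xy(2)] by blast
    have "D x y = DD (\<lambda>k. a * zc q k + b * zc r k) (\<lambda>k. a' * zc q' k + b' * zc r' k)"
      unfolding DD_unit[OF xy, symmetric] 1(3) 2(3) ..
    also have "\<dots> = cs a * (cs a' * FF q q' + cs b' * FF q r') + cs b * (cs a' * FF r q' + cs b' * FF r r')"
      by (simp only: DD_lin DD_lin2 FF_def)
    finally show "D x y \<rhd> w \<in> S"
      using 1 2 w by (simp add: inv vec.subspace_add[OF S] vec.subspace_scale[OF S])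
  qed
qed (simp_all add: v_nz)

lemma index_vector_op_split:
  assumes "index_vector_op B"
  shows "hw.vector_op (\<lambda>s. ext U (zc s) B)"
  unfolding hw.vector_op_def FF_def
  using DD_vector_op[OF assms] by (simp add: dot_zc cs_of_real)

section \<open>Pfaffian minors as a vector operator\<close>

definition pf_op :: "nat \<Rightarrow> 'd endo" where
  "pf_op a = (- 1) ^ (a + 1) *\<^sub>R pf D (U - {a})"

lemma pf_op_bracket:
  assumes "x \<in> U" "y \<in> U" "x \<noteq> y"
  shows "D x y * pf_op x - pf_op x * D x y = - pf_op y"
proof -
  have *: "pos_sign U z = - ((- 1) ^ z)" if "z \<in> U" for z
  proof -
    have "{c \<in> U. c < z} = {1..<z}" using that by (auto simp: U_eq)
    then show ?thesis using that by (cases z) (simp_all add: pos_sign_def U_eq)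
  qed
  have U: "U - {x} - {y} = U - {x, y}" "insert x (U - {x, y}) = U - {y}" using assms by auto
  have "D x y * pf D (U - {x}) - pf D (U - {x}) * D x y =
      (pos_sign (U - {x, y}) x * pos_sign (U - {x, y}) y) *\<^sub>R pf D (U - {y})"
    using pf_bracket_outside[of "U - {x}" x y] assms finite_U unfolding U by auto
  also have "pos_sign (U - {x, y}) x * pos_sign (U - {x, y}) y = - ((- 1) ^ x * (- 1) ^ y)"
    using assms finite_U by (simp add: pos_sign_remove2 *) (simp add: sgl_def)
  finally have "D x y * pf_op x - pf_op x * D x y =
      (- 1) ^ (x + 1) *\<^sub>R (- ((- 1) ^ x * (- 1) ^ y) *\<^sub>R pf D (U - {y}))"
    by (simp only: pf_op_def mult_scaleR_right mult_scaleR_left scaleR_diff_right[symmetric])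
  also have "\<dots> = - pf_op y"
    by (cases "even x"; cases "even y"; simp add: pf_op_def)
  finally show ?thesis .
qed

text \<open>Operators with both indices in U - {a} commute with the minor that omits a, by
  \<open>pf_bracket_inside\<close>. Operators involving a exchange two minors, by
  \<open>pf_bracket_outside\<close>.\<close>

lemma pf_op_vector: "index_vector_op pf_op"
  unfolding index_vector_op_def
proof (intro ballI)
  fix x y a assume xya: "x \<in> U" "y \<in> U" "a \<in> U"
  consider "x = y" | "x \<noteq> y" "a = x" | "x \<noteq> y" "a = y" | "x \<noteq> a" "y \<noteq> a" by blast
  then show "D x y * pf_op a - pf_op a * D x y = (if y = a then pf_op x else 0) - (if x = a then pf_op y else 0)"
  proof cases
    case 1
    then show ?thesis using D_same xya by simp
  next
    case 2
    then show ?thesis using pf_op_bracket xya by simp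
  next
    case 3
    have "D x y * pf_op y - pf_op y * D x y = - (D y x * pf_op y - pf_op y * D y x)"
      using D_skew[OF xya(2,1)] by simp
    then show ?thesis using 3 pf_op_bracket[of y x] xya by simp
  next
    case 4
    have "D x y * pf D (U - {a}) - pf D (U - {a}) * D x y = 0"
      by (rule pf_bracket_inside) (use 4 xya finite_U in auto)
    then show ?thesis
      using 4 by (simp add: pf_op_def scaleR_diff_right[symmetric])
  qed
qed

theorem index_vector_op_pfaffian:
  assumes "index_vector_op B"
  shows "\<exists>d. \<forall>a\<in>U. B a = cs d * pf_op a"
proof -
  define c :: complex where "c = (- \<i>) ^ M * (\<Prod>j=1..M. (of_int (lam j) + of_nat (M - j)))"
  \<comment> \<open>\<open>zc 0\<close> is the last unit vector, so the member of weight 0 is the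
    Pfaffian of {1..2 * M}, whose eigenvalue on v is known.\<close>
  have "ext U (zc 0) pf_op = pf_op (2 * M + 1)"
    using ext_unit[OF finite_U, of "2 * M + 1" pf_op] by (simp add: zc_def[abs_def] eq_commute U_eq)
  also have "\<dots> = pf D {1..2 * M}"
  proof -
    have "U - {2 * M + 1} = {1..2 * M}" by (auto simp: U_eq)
    then show ?thesis by (simp add: pf_op_def)
  qed
  finally have "ext U (zc 0) pf_op \<rhd> v = c *s v"
    using pf_eigenvalue by (simp add: c_def)
  \<comment> \<open>A vanishing scalar forces lam M = 0. Since \<open>row_idx 1\<close> = M, this is
    the coordinate \<open>l 1\<close> of \<open>hw_module\<close>.\<close>
  moreover have "1 \<le> int M \<and> lam (row_idx 1) = 0" if "c = 0"
  proof -
    have "0 \<le> lam j" if "j \<in> {1..M}" for j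
      using hw.weight_nonneg[of "int M + 1 - int j"] that by (auto simp: row_idx_def)
    then have "1 \<le> M \<and> lam M = 0"
      using that by (intro prod_nonzero_iff_shift) (auto simp: c_def)
    then show ?thesis by (simp add: row_idx_def)
  qed
  ultimately obtain d where d: "\<And>s. \<bar>s\<bar> \<le> int M \<Longrightarrow> ext U (zc s) B = cs d * ext U (zc s) pf_op"
    using hw.vector_op_proportional[OF index_vector_op_split[OF assms] index_vector_op_split[OF pf_op_vector]]
    by blast
  have "B a = cs d * pf_op a" if a: "a \<in> U" for a
  proof -
    obtain q r s t where 1: "\<bar>q\<bar> \<le> int M" "\<bar>r\<bar> \<le> int M" "(\<lambda>k. if a = k then 1 else 0) = (\<lambda>k. s * zc q k + t * zc r k)"
      using unit_vector_split[OF a] by blast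
    have "B a = cs s * ext U (zc q) B + cs t * ext U (zc r) B"
      using ext_unit[OF finite_U a, of B] unfolding 1(3) ext_lin by simp
    also have "\<dots> = cs d * (cs s * ext U (zc q) pf_op + cs t * ext U (zc r) pf_op)"
      unfolding d[OF 1(1)] d[OF 1(2)] by (simp only: distrib_left cs_left_commute[of d])
    also have "cs s * ext U (zc q) pf_op + cs t * ext U (zc r) pf_op = pf_op a"
      using ext_unit[OF finite_U a, of pf_op] unfolding 1(3) ext_lin by simp
    finally show ?thesis .
  qed
  then show ?thesis by blast
qed

text \<open>The Casimir operator maps v to a singular vector, hence to a multiple c v; its
  eigenspace for c is then a nonzero submodule.\<close>

lemma casimir_scalar: "\<exists>c. casimir = cs c"
proof -
  have comm: "FF q r * casimir = casimir * FF q r" for q r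
  proof -
    have "FF q r * casimir = ext U (zc q) (\<lambda>x. ext U (zc r) (\<lambda>y. D x y * casimir))"
      by (simp add: FF_def DD_def ext_mult_right)
    also have "\<dots> = ext U (zc q) (\<lambda>x. ext U (zc r) (\<lambda>y. casimir * D x y))"
      by (intro ext_cong casimir_commute)
    finally show ?thesis by (simp add: FF_def DD_def ext_mult_left)
  qed
  have "FF q r \<rhd> casimir \<rhd> v = 0" if "\<bar>q\<bar> \<le> int M" "\<bar>r\<bar> \<le> int M" "0 < q + r" for q r
  proof -
    have "FF q r \<rhd> casimir \<rhd> v = (FF q r * casimir) \<rhd> v" by simp
    also have "\<dots> = casimir \<rhd> FF q r \<rhd> v" unfolding comm by simp
    finally show ?thesis using hw.raise[OF that] by simp
  qed
  then obtain c where c: "casimir \<rhd> v = c *s v" using hw.singular_unique by blast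
  have "vec.subspace {w. (casimir - cs c) \<rhd> w = 0}" by (rule subspace_kernel)
  then have "{w. (casimir - cs c) \<rhd> w = 0} = {0} \<or> {w. (casimir - cs c) \<rhd> w = 0} = UNIV"
  proof (rule hw.irreducible)
    fix q r w assume "w \<in> {w. (casimir - cs c) \<rhd> w = 0}"
    then have w: "casimir \<rhd> w = c *s w" by simp
    have "casimir \<rhd> FF q r \<rhd> w = (casimir * FF q r) \<rhd> w" by simp
    also have "\<dots> = FF q r \<rhd> casimir \<rhd> w" unfolding comm[symmetric] by simp
    finally show "FF q r \<rhd> w \<in> {w. (casimir - cs c) \<rhd> w = 0}" by (simp add: w ap_scale)
  qed
  moreover have "v \<in> {w. (casimir - cs c) \<rhd> w = 0}" by (simp add: c)
  ultimately have "{w. (casimir - cs c) \<rhd> w = 0} = UNIV" using v_nz by auto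
  then have "(casimir - cs c) \<rhd> w = 0" for w by blast
  then have "casimir = cs c" by (intro endo_eqI) simp
  then show ?thesis ..
qed

theorem index_vector_op_casimir:
  assumes "index_vector_op B" "a \<in> U"
  shows "(\<Sum>x\<in>U. B x * D x a) = real M *\<^sub>R B a"
proof -
  have "casimir * B a = B a * casimir" using casimir_scalar cs_commute by metis
  from vector_op_casimir[OF assms this] show ?thesis by (simp add: U_eq)
qed

end

section \<open>The exponential map\<close>

lemma mat_of_power: "mat_of (Endo X ^ k) = mat_pow X k"
  by (induction k) (simp_all add: one_endo.rep_eq times_endo.rep_eq)

lemma mat_exp_sums: "(\<lambda>k. mat_pow X k /\<^sub>R fact k) sums mat_of (exp (Endo X))"
proof -
  have "(\<lambda>k. Endo X ^ k /\<^sub>R fact k) sums exp (Endo X)"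
    unfolding exp_def by (rule summable_sums[OF summable_exp_generic])
  then have "(\<lambda>k. mat_of (Endo X ^ k /\<^sub>R fact k)) sums mat_of (exp (Endo X))"
    by (rule bounded_linear.sums[OF bounded_linear_mat_of])
  then show ?thesis by (simp add: scaleR_endo.rep_eq mat_of_power)
qed

lemma mat_exp_eq: "mat_exp X = mat_of (exp (Endo X))"
  unfolding mat_exp_def using mat_exp_sums by (rule sums_unique[symmetric])

lemma Endo_mat_exp: "Endo (mat_exp X) = exp (Endo X)"
  by (simp add: mat_exp_eq mat_of_inverse)

lemma Endo_simps:
  "Endo (X + Y) = Endo X + Endo Y" "Endo (X - Y) = Endo X - Endo Y" "Endo (- X) = - Endo X"
  "Endo (X ** Y) = Endo X * Endo Y" "Endo (t *\<^sub>R X) = t *\<^sub>R Endo X" "Endo (mat c) = cs c" "Endo 0 = 0"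
  "Endo (cscale c X) = cs c * Endo X"
  by (simp_all flip: mat_of_inject add: plus_endo.rep_eq minus_endo.rep_eq uminus_endo.rep_eq
      times_endo.rep_eq scaleR_endo.rep_eq cs.rep_eq zero_endo.rep_eq mat_matrix_mult)

lemma Endo_eq_iff: "Endo X = Endo Y \<longleftrightarrow> X = Y"
  by (metis mat_of_Endo)

lemma mat_exp_0 [simp]: "mat_exp 0 = mat 1"
  unfolding Endo_eq_iff[symmetric] Endo_mat_exp by (simp add: Endo_simps)

lemma mat_exp_add: "mat_exp ((s + t) *\<^sub>R W) = mat_exp (s *\<^sub>R W) ** mat_exp (t *\<^sub>R W)"
proof -
  have "exp ((s + t) *\<^sub>R Endo W) = exp (s *\<^sub>R Endo W) * exp (t *\<^sub>R Endo W)"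
    unfolding scaleR_add_left by (rule exp_add_commuting) simp
  then show ?thesis
    unfolding Endo_eq_iff[symmetric] by (simp add: Endo_mat_exp Endo_simps)
qed

lemma mat_exp_minus:
  "mat_exp (- W) ** mat_exp W = mat 1" "mat_exp W ** mat_exp (- W) = mat 1"
  using mat_exp_add[of "- 1" 1 W] mat_exp_add[of 1 "- 1" W] by simp_all

lemma mat_exp_has_vector_derivative:
  "((\<lambda>t. mat_exp (t *\<^sub>R W)) has_vector_derivative W ** mat_exp (t *\<^sub>R W)) (at t)"
proof -
  have "((\<lambda>t. exp (t *\<^sub>R Endo W)) has_vector_derivative Endo W * exp (t *\<^sub>R Endo W)) (at t)"
    by (rule exp_scaleR_has_vector_derivative_left)
  then have "((\<lambda>t. mat_of (exp (t *\<^sub>R Endo W))) has_vector_derivative mat_of (Endo W * exp (t *\<^sub>R Endo W))) (at t)"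
    by (rule bounded_linear.has_vector_derivative[OF bounded_linear_mat_of])
  then show ?thesis by (simp add: mat_exp_eq Endo_simps times_endo.rep_eq)
qed

text \<open>exp (- t a) g(t) has derivative 0.\<close>

lemma exp_ode_unique:
  fixes g :: "real \<Rightarrow> 'd::finite endo"
  assumes "\<And>t. (g has_vector_derivative a * g t) (at t)"
  shows "g t = exp (t *\<^sub>R a) * g 0"
proof -
  define u where "u t = exp (t *\<^sub>R (- a)) * g t" for t
  have "(u has_vector_derivative exp (t *\<^sub>R (- a)) * (a * g t) + exp (t *\<^sub>R (- a)) * (- a) * g t) (at t)" for t
    unfolding u_def
    by (intro has_vector_derivative_mult exp_scaleR_has_vector_derivative_right assms)
  then have "(u has_vector_derivative 0) (at t)" for t by (simp add: mult.assoc)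
  then obtain c where "\<And>t. u t = c"
    using has_vector_derivative_zero_constant[of UNIV u] by auto
  from this[of t] this[of 0] have "exp (t *\<^sub>R (- a)) * g t = g 0" by (simp add: u_def)
  then have "exp (t *\<^sub>R a) * (exp (t *\<^sub>R (- a)) * g t) = exp (t *\<^sub>R a) * g 0" by simp
  then show ?thesis by (simp add: mult.assoc[symmetric] exp_minus_inverse)
qed

text \<open>The hypothesis compares powers rather than products, so that \<open>transpose\<close>,
  which reverses products, is covered too.\<close>

lemma mat_exp_map:
  fixes f :: "complex^'n^'n \<Rightarrow> complex^'m^'m"
  assumes "linear f" "\<And>k. f (mat_pow X k) = mat_pow Y k"
  shows "f (mat_exp X) = mat_exp Y"
proof -
  have bl: "bounded_linear f" using assms(1) by (simp add: linear_conv_bounded_linear)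
  have "(\<lambda>k. f (mat_pow X k /\<^sub>R fact k)) sums f (mat_of (exp (Endo X)))"
    by (rule bounded_linear.sums[OF bl mat_exp_sums])
  then have "(\<lambda>k. mat_pow Y k /\<^sub>R fact k) sums f (mat_exp X)"
    by (simp add: linear_scale[OF assms(1)] assms(2) mat_exp_eq)
  then show ?thesis using mat_exp_sums sums_unique2 by (metis mat_exp_eq)
qed

lemma mat_pow_commute: "mat_pow X k ** X = X ** mat_pow X k"
  by (induction k) (simp_all add: matrix_mul_assoc[symmetric])

section \<open>The groups \<open>G\<close> and \<open>K\<close>\<close>

definition last_sign :: "'n::{finite,linorder} \<Rightarrow> complex" where
  "last_sign a = (if a = idx CARD('n) then - 1 else 1)"

lemma last_sign_sq [simp]: "last_sign a * last_sign a = 1" "last_sign a * (last_sign a * x) = x"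
  by (simp_all add: last_sign_def)

lemma I_mat_entry:
  "(I_mat ** X) $ a $ b = last_sign a * X $ a $ b"
  "(X ** I_mat) $ a $ b = (X :: ('n::{finite,linorder}) cmat) $ a $ b * last_sign b"
proof -
  have "(I_mat ** X) $ a $ b = (\<Sum>c\<in>UNIV. I_mat $ a $ c * X $ c $ b)"
    by (simp add: matrix_matrix_mult_def)
  also have "\<dots> = (\<Sum>c\<in>UNIV. if c = a then last_sign a * X $ a $ b else 0)"
    by (intro sum.cong) (auto simp: I_mat_def last_sign_def)
  finally show "(I_mat ** X) $ a $ b = last_sign a * X $ a $ b" by simp
  have "(X ** I_mat) $ a $ b = (\<Sum>c\<in>UNIV. X $ a $ c * I_mat $ c $ b)"
    by (simp add: matrix_matrix_mult_def)
  also have "\<dots> = (\<Sum>c\<in>UNIV. if c = b then X $ a $ b * last_sign b else 0)"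
    by (intro sum.cong) (auto simp: I_mat_def last_sign_def)
  finally show "(X ** I_mat) $ a $ b = X $ a $ b * last_sign b" by simp
qed

lemma I_mat_left [simp]: "I_mat ** (I_mat ** X) = (X :: ('n::{finite,linorder}) cmat)"
  by (simp add: vec_eq_iff I_mat_entry)

lemma I_conj_entry:
  "(I_mat ** X ** I_mat) $ a $ b = last_sign a * last_sign b * (X :: ('n::{finite,linorder}) cmat) $ a $ b"
  by (simp add: I_mat_entry)

definition real_conj :: "('n::{finite,linorder}) cmat \<Rightarrow> 'n cmat" where
  "real_conj X = I_mat ** cnj_mat X ** I_mat"

lemma real_conj_entry: "real_conj X $ a $ b = last_sign a * last_sign b * cnj (X $ a $ b)"
  unfolding real_conj_def I_conj_entry by (simp add: cnj_mat_def)

lemma theta_entry: "theta X $ a $ b = last_sign a * last_sign b * X $ a $ b"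
  unfolding theta_def by (rule I_conj_entry)

lemma cnj_mat_mult: "cnj_mat (X ** Y) = cnj_mat X ** cnj_mat Y"
  by (simp add: cnj_mat_def matrix_matrix_mult_def vec_eq_iff)

lemma real_conj_mult: "real_conj (X ** Y) = real_conj X ** real_conj Y"
  by (simp add: real_conj_def cnj_mat_mult matrix_mul_assoc[symmetric])

lemma theta_mult: "theta (X ** Y) = theta X ** theta Y"
  by (simp add: theta_def matrix_mul_assoc[symmetric])

lemma real_conj_mat_1 [simp]: "real_conj (mat 1) = mat 1" and theta_mat_1 [simp]: "theta (mat 1) = mat 1"
  by (auto simp: vec_eq_iff real_conj_entry theta_entry mat_def)

lemma linear_real_conj: "linear real_conj" and linear_theta: "linear theta"
  by (auto intro!: linearI simp: vec_eq_iff real_conj_entry theta_entry algebra_simps)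

lemma real_conj_pow: "real_conj (mat_pow X k) = mat_pow (real_conj X) k" and
  theta_pow: "theta (mat_pow X k) = mat_pow (theta X) k"
  by (induction k) (simp_all add: real_conj_mult theta_mult)

lemma linear_transpose: "linear (transpose :: complex^'n^'n \<Rightarrow> _)"
  by (auto intro!: linearI simp: transpose_def vec_eq_iff)

lemma transpose_pow: "transpose (mat_pow X k) = mat_pow (transpose X) k"
  by (induction k) (simp_all add: matrix_transpose_mul transpose_mat mat_pow_commute)

lemma mat_exp_transpose: "transpose (mat_exp X) = mat_exp (transpose X)"
  and mat_exp_real_conj: "real_conj (mat_exp X) = mat_exp (real_conj X)"
  and mat_exp_theta: "theta (mat_exp X) = mat_exp (theta X)"
  by (rule mat_exp_map, rule linear_transpose linear_real_conj linear_theta,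
      rule transpose_pow real_conj_pow theta_pow)+

section \<open>The real Lie algebras and the identity component\<close>

definition g_real :: "(('n::{finite,linorder}) cmat) set" where
  "g_real = {W. transpose W = - W \<and> real_conj W = W}"

definition k_real :: "(('n::{finite,linorder}) cmat) set" where
  "k_real = {W \<in> g_real. theta W = W}"

definition G_full :: "(('n::{finite,linorder}) cmat) set" where
  "G_full = {g. transpose g ** g = mat 1 \<and> det g = 1 \<and> real_conj g = g}"

lemma G_grp_eq: "G_grp = connected_component_set G_full (mat 1)"
  by (simp add: G_grp_def G_full_def real_conj_def)

lemma G_full_mult: "g \<in> G_full \<Longrightarrow> h \<in> G_full \<Longrightarrow> g ** h \<in> G_full"
  by (simp add: G_full_def real_conj_mult det_mul matrix_transpose_mul)
    (metis matrix_mul_assoc matrix_mul_lid)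

lemma G_full_1: "mat 1 \<in> G_full"
  by (simp add: G_full_def transpose_mat)

lemma G_subset: "g \<in> G_grp \<Longrightarrow> g \<in> G_full"
  unfolding G_grp_eq using connected_component_subset by blast

lemma G_1: "mat 1 \<in> G_grp"
  unfolding G_grp_eq using G_full_1 by (simp add: connected_component_refl)

lemma bounded_bilinear_matrix_mult:
  "bounded_bilinear (\<lambda>(A :: complex^'d^'d) (B :: complex^'d^'d). A ** B)"
proof -
  have "bilinear (\<lambda>(A :: complex^'d^'d) (B :: complex^'d^'d). A ** B)"
    by (auto simp: bilinear_def linear_iff matrix_add_ldistrib matrix_mul_add_rdistrib
        matrix_mul_scaleR_left matrix_mul_scaleR_right)
  then show ?thesis by (simp add: bilinear_conv_bounded_bilinear)
qed

lemmas bounded_linear_matrix_mult_left = bounded_bilinear.bounded_linear_left[OF bounded_bilinear_matrix_mult]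
  and bounded_linear_matrix_mult_right = bounded_bilinear.bounded_linear_right[OF bounded_bilinear_matrix_mult]

text \<open>Left translation by h maps a connected set through 1 and g to one through h and h **
  g.\<close>

lemma G_mult:
  assumes "h \<in> G_grp" "g \<in> G_grp"
  shows "h ** g \<in> G_grp"
proof -
  have h: "connected_component G_full (mat 1) h" and "connected_component G_full (mat 1) g"
    using assms by (simp_all add: G_grp_eq)
  then obtain T where T: "connected T" "T \<subseteq> G_full" "mat 1 \<in> T" "g \<in> T"
    by (auto simp: connected_component_def)
  have "connected ((\<lambda>x. h ** x) ` T)"
    by (intro connected_continuous_image T linear_continuous_on bounded_linear_matrix_mult_right)
  moreover have "(\<lambda>x. h ** x) ` T \<subseteq> G_full"
    using T(2) G_subset[OF assms(1)] G_full_mult by blast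
  moreover have "h \<in> (\<lambda>x. h ** x) ` T" using T(3) by (auto intro: image_eqI[of _ _ "mat 1"])
  ultimately have "connected_component G_full h (h ** g)"
    using T(4) unfolding connected_component_def by blast
  with h show ?thesis unfolding G_grp_eq by (auto intro: connected_component_trans)
qed

lemma mat_exp_G_full:
  assumes "W \<in> g_real"
  shows "mat_exp W \<in> G_full"
proof -
  have orth: "transpose (mat_exp X) ** mat_exp X = mat 1" if "X \<in> g_real" for X
    using that by (simp add: mat_exp_transpose g_real_def mat_exp_minus)
  \<comment> \<open>exp W is the square of h = exp (W / 2), and orthogonality gives (det h)^2 = 1;
    so det (exp W) = 1.\<close>
  have half: "(1 / 2) *\<^sub>R W \<in> g_real"
    using assms by (simp add: g_real_def linear_scale[OF linear_real_conj] linear_scale[OF linear_transpose])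
  define h where "h = mat_exp ((1 / 2) *\<^sub>R W)"
  have "det h * det h = det (transpose h ** h)" by (simp add: det_mul det_transpose)
  also have "\<dots> = 1" unfolding h_def orth[OF half] by simp
  finally have "det (h ** h) = 1" by (simp add: det_mul)
  moreover have "h ** h = mat_exp W"
    using mat_exp_add[of "1 / 2" "1 / 2" W] by (simp add: h_def)
  ultimately show ?thesis
    using orth[OF assms] assms by (simp add: G_full_def mat_exp_real_conj g_real_def)
qed

lemma g_real_scaleR: "W \<in> g_real \<Longrightarrow> t *\<^sub>R W \<in> g_real"
  and k_real_scaleR: "W \<in> k_real \<Longrightarrow> t *\<^sub>R W \<in> k_real"
  by (simp_all add: g_real_def k_real_def linear_scale[OF linear_real_conj]
      linear_scale[OF linear_transpose] linear_scale[OF linear_theta])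

lemma g_real_add: "W \<in> g_real \<Longrightarrow> W' \<in> g_real \<Longrightarrow> W + W' \<in> g_real"
  and k_real_add: "W \<in> k_real \<Longrightarrow> W' \<in> k_real \<Longrightarrow> W + W' \<in> k_real"
  by (simp_all add: g_real_def k_real_def linear_add[OF linear_real_conj]
      linear_add[OF linear_transpose] linear_add[OF linear_theta])

lemma continuous_on_mat_exp: "continuous_on S (\<lambda>t. mat_exp (t *\<^sub>R W))"
  using mat_exp_has_vector_derivative has_vector_derivative_continuous
  by (intro continuous_at_imp_continuous_on ballI) blast

lemma mat_exp_G:
  assumes "W \<in> g_real"
  shows "mat_exp W \<in> G_grp"
proof -
  let ?T = "(\<lambda>t. mat_exp (t *\<^sub>R W)) ` {0..1}"
  have "connected ?T" by (intro connected_continuous_image continuous_on_mat_exp) simp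
  moreover have "?T \<subseteq> G_full" using mat_exp_G_full g_real_scaleR[OF assms] by blast
  moreover have "mat 1 \<in> ?T" by (rule image_eqI[of _ _ 0]) auto
  moreover have "mat_exp W \<in> ?T" by (rule image_eqI[of _ _ 1]) auto
  ultimately show ?thesis unfolding G_grp_eq by (auto intro: connected_componentI)
qed

lemma mat_exp_K: "W \<in> k_real \<Longrightarrow> mat_exp W \<in> K_grp"
  by (simp add: K_grp_def k_real_def mat_exp_G mat_exp_theta)

lemma K_1: "mat 1 \<in> K_grp"
  by (simp add: K_grp_def G_1)

lemma K_mult: "k \<in> K_grp \<Longrightarrow> h \<in> K_grp \<Longrightarrow> k ** h \<in> K_grp"
  by (simp add: K_grp_def G_mult theta_mult)

text \<open>\<open>real_conj\<close> is \<open>theta\<close> followed by entrywise conjugation; what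
  both fix has real entries.\<close>

lemma K_real:
  assumes "k \<in> K_grp"
  shows "cnj_mat k = k"
proof -
  have "real_conj k = k" "theta k = k" using assms G_subset by (auto simp: K_grp_def G_full_def)
  then have "real_conj (theta k) = k" by simp
  moreover have "cnj (last_sign a) = last_sign a" for a :: 'a by (simp add: last_sign_def)
  ultimately show ?thesis by (simp add: vec_eq_iff real_conj_entry theta_entry cnj_mat_def mult_ac)
qed

lemma K_orthogonal: "k \<in> K_grp \<Longrightarrow> transpose k ** k = mat 1"
  using G_subset by (auto simp: K_grp_def G_full_def)

section \<open>Differentiating representations of \<open>K\<close>\<close>

text \<open>Intended for g a curve in K and f its image under a representation of which only a
  Lipschitz bound at 1 is known.\<close>

lemma has_vector_derivative_zero_compare:
  assumes "(g has_vector_derivative 0) (at x)" "eventually (\<lambda>y. norm (f y - f x) \<le> C * norm (g y - g x)) (at x)"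
  shows "(f has_vector_derivative 0) (at x)"
proof -
  have "((\<lambda>y. norm (g y - g x) / norm (y - x)) \<longlongrightarrow> 0) (at x)"
    using assms(1) by (simp add: has_vector_derivative_def has_derivative_iff_norm)
  then have "((\<lambda>y. C * (norm (g y - g x) / norm (y - x))) \<longlongrightarrow> C * 0) (at x)"
    by (rule tendsto_mult_left)
  then have "((\<lambda>y. norm (f y - f x) / norm (y - x)) \<longlongrightarrow> 0) (at x)"
  proof (rule metric_tendsto_imp_tendsto)
    show "eventually (\<lambda>y. dist (norm (f y - f x) / norm (y - x)) 0 \<le>
        dist (C * (norm (g y - g x) / norm (y - x))) (C * 0)) (at x)"
      using assms(2)
    proof eventually_elim
      case (elim y)
      also have "C * norm (g y - g x) \<le> \<bar>C\<bar> * norm (g y - g x)"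
        by (intro mult_right_mono) auto
      finally show ?case by (simp add: dist_norm abs_mult divide_right_mono)
    qed
  qed
  then show ?thesis by (simp add: has_vector_derivative_def has_derivative_iff_norm)
qed

lemma has_vector_derivative_shift:
  fixes f :: "real \<Rightarrow> 'a::real_normed_vector"
  assumes "(f has_vector_derivative D) (at (t + s))"
  shows "((\<lambda>s. f (t + s)) has_vector_derivative D) (at s)"
proof -
  have "((\<lambda>s. t + s) has_vector_derivative 0 + 1) (at s)"
    by (intro has_vector_derivative_add has_vector_derivative_const has_vector_derivative_id)
  from vector_diff_chain_at[OF this assms] show ?thesis by (simp add: comp_def)
qed

lemma endo_inverse_near_1:
  assumes "norm (Q - 1) < (1 :: real)"
  shows "\<exists>R. Q * R = (1 :: 'd::finite endo)"
proof -
  have "inj ((*v) (mat_of Q))"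
  proof (rule injI)
    fix x y assume "mat_of Q *v x = mat_of Q *v y"
    then have "Q \<rhd> (x - y) = 0" by (simp add: ap_def matrix_vector_mult_diff_distrib)
    then have "(Q - 1) \<rhd> (x - y) = - (x - y)" by simp
    then have "norm (x - y) \<le> norm (Q - 1) * norm (x - y)"
      using norm_mult_vec_le[of "Q - 1" "x - y"] by (simp add: ap_def norm_minus_commute)
    moreover have "norm (Q - 1) * norm (x - y) < 1 * norm (x - y)" if "x \<noteq> y"
      using that by (intro mult_strict_right_mono assms) simp
    ultimately show "x = y" by fastforce
  qed
  then obtain B where "B ** mat_of Q = mat 1" using matrix_left_invertible_injective by blast
  then have "mat_of Q ** B = mat 1" using matrix_left_right_inverse by blast
  then have "Q * Endo B = 1"
    by (simp flip: mat_of_inject add: times_endo.rep_eq one_endo.rep_eq)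
  then show ?thesis ..
qed

text \<open>Integrating $g(t + s) = g(t) g(s)$ over \<open>s\<close> expresses \<open>g\<close> through its primitive.\<close>

lemma one_parameter_differentiable:
  fixes g :: "real \<Rightarrow> 'd::finite endo"
  assumes cont: "continuous_on UNIV g" and add: "\<And>s t. g (s + t) = g s * g t" and "g 0 = 1"
  shows "\<exists>Y. (g has_vector_derivative Y) (at 0)"
proof -
  define P where "P t = integral {-1..t} g" for t
  have int: "g integrable_on {a..b}" for a b
    by (intro integrable_continuous_real continuous_on_subset[OF cont]) simp
  have P_deriv: "(P has_vector_derivative g t) (at t)" if "\<bar>t\<bar> < 1" for t
  proof -
    have "(P has_vector_derivative g t) (at t within {-1..1})"
      unfolding P_def by (rule integral_has_vector_derivative)
        (use that continuous_on_subset[OF cont] in auto)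
    moreover have "at t within {-1..1} = at t"
      by (rule at_within_Icc_at) (use that in auto)
    ultimately show ?thesis by simp
  qed
  have "((\<lambda>t. norm (P t - P 0 - t *\<^sub>R 1) / norm t) \<longlongrightarrow> 0) (at 0)"
    using P_deriv[of 0] \<open>g 0 = 1\<close> by (simp add: has_vector_derivative_def has_derivative_iff_norm)
  then have "eventually (\<lambda>t. dist (norm (P t - P 0 - t *\<^sub>R 1) / norm t) 0 < 1) (at 0)"
    by (rule tendstoD) simp
  then obtain e where e: "e > 0" "\<And>t. t \<noteq> 0 \<Longrightarrow> \<bar>t\<bar> < e \<Longrightarrow> norm (P t - P 0 - t *\<^sub>R 1) / \<bar>t\<bar> < 1"
    by (auto simp: eventually_at dist_norm)
  \<comment> \<open>For this a the mean value (P a - P 0) / a of g lies within distance 1 of the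
    identity and is therefore invertible.\<close>
  define a where "a = min (e / 2) (1 / 2)"
  have a: "0 < a" "a < e" "a < 1" using e(1) by (auto simp: a_def)
  obtain R where R: "((1 / a) *\<^sub>R (P a - P 0)) * R = 1"
  proof -
    have "(1 / a) *\<^sub>R (P a - P 0) - 1 = (1 / a) *\<^sub>R (P a - P 0 - a *\<^sub>R 1)"
      using a by (simp add: algebra_simps)
    then have "norm ((1 / a) *\<^sub>R (P a - P 0) - 1) < 1"
      using e(2)[of a] a by simp
    then show ?thesis using endo_inverse_near_1 that by blast
  qed
  have key: "g t = (1 / a) *\<^sub>R ((P (t + a) - P t) * R)" if "\<bar>t\<bar> < 1 - a" for t
  proof -
    define u where "u s = P (t + s) - P t - g t * (P s - P 0)" for s
    have "(u has_vector_derivative 0) (at s)" if s: "s \<in> {0..a}" for s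
    proof -
      have "((\<lambda>s. P (t + s)) has_vector_derivative g (t + s)) (at s)"
        by (intro has_vector_derivative_shift P_deriv) (use s a \<open>\<bar>t\<bar> < 1 - a\<close> in auto)
      moreover have "((\<lambda>s. g t * (P s - P 0)) has_vector_derivative g t * (g s - 0)) (at s)"
        by (intro bounded_linear.has_vector_derivative[OF bounded_linear_mult_right]
            has_vector_derivative_diff P_deriv has_vector_derivative_const) (use s a in auto)
      ultimately have "(u has_vector_derivative g (t + s) - 0 - g t * (g s - 0)) (at s)"
        unfolding u_def by (intro has_vector_derivative_diff has_vector_derivative_const)
      then show ?thesis by (simp add: add)
    qed
    then obtain c where "\<forall>s\<in>{0..a}. u s = c"
      using has_vector_derivative_zero_constant[of "{0..a}" u] has_vector_derivative_at_within
      by (metis convex_real_interval(5))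
    moreover have "u 0 = 0" by (simp add: u_def)
    ultimately have "u a = 0" using a by auto
    then have "P (t + a) - P t = g t * (P a - P 0)" by (simp add: u_def)
    then have "(1 / a) *\<^sub>R ((P (t + a) - P t) * R) = g t * (((1 / a) *\<^sub>R (P a - P 0)) * R)"
      by (simp add: mult.assoc)
    then show ?thesis unfolding R mult_1_right by (rule sym)
  qed
  have "((\<lambda>t. P (t + a)) has_vector_derivative g a) (at 0)"
    using has_vector_derivative_shift[of P "g a" a 0] P_deriv[of a] a by (simp add: add.commute)
  moreover have "(P has_vector_derivative 1) (at 0)" using P_deriv[of 0] \<open>g 0 = 1\<close> by simp
  ultimately have "((\<lambda>t. P (t + a) - P t) has_vector_derivative g a - 1) (at 0)"
    by (rule has_vector_derivative_diff)
  then have "((\<lambda>t. (1 / a) *\<^sub>R ((P (t + a) - P t) * R)) has_vector_derivative (1 / a) *\<^sub>R ((g a - 1) * R)) (at 0)"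
    by (intro bounded_linear.has_vector_derivative[OF bounded_linear_scaleR_right]
        bounded_linear.has_vector_derivative[OF bounded_linear_mult_left])
  then have "(g has_vector_derivative (1 / a) *\<^sub>R ((g a - 1) * R)) (at 0)"
    by (rule has_vector_derivative_transform_within_open[where S = "{-(1 - a)<..<1 - a}"])
      (use a key in auto)
  then show ?thesis ..
qed

section \<open>Continuous representations of K are Lipschitz at 1\<close>

lemma power_diff_1: "(T - 1) * (\<Sum>j<n. T ^ j) = T ^ n - (1 :: 'a::ring_1)"
  by (induction n) (simp_all add: algebra_simps power_commutes)

text \<open>
  A quantitative absence of small subgroups.  As the powers of an element of \<open>K\<close> move away from 1 at
  most linearly, it makes every continuous representation of \<open>K\<close> Lipschitz at 1.
\<close>

lemma near_1_of_powers:
  fixes T :: "'a::real_normed_algebra_1"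
  assumes "\<And>j. j \<le> J \<Longrightarrow> norm (T ^ j - 1) \<le> 1 / 2" "J > 0"
  shows "norm (T - 1) \<le> 1 / real J"
proof -
  define E where "E = (\<Sum>j<J. T ^ j - 1)"
  have "norm E \<le> (\<Sum>j<J. 1 / 2)"
    unfolding E_def by (rule sum_norm_le) (use assms in auto)
  then have E: "norm E \<le> real J / 2" by simp
  have "(\<Sum>j<J. T ^ j) = real J *\<^sub>R 1 + E"
    by (simp add: E_def sum_subtractf scaleR_conv_of_real)
  then have "T ^ J - 1 = (T - 1) * (real J *\<^sub>R 1 + E)"
    using power_diff_1[of T J] by simp
  then have "real J *\<^sub>R (T - 1) = (T ^ J - 1) - (T - 1) * E"
    by (simp add: algebra_simps)
  then have "real J * norm (T - 1) = norm ((T ^ J - 1) - (T - 1) * E)"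
    by (metis abs_of_nat norm_scaleR)
  also have "\<dots> \<le> norm (T ^ J - 1) + norm ((T - 1) * E)"
    by (rule norm_triangle_ineq4)
  \<comment> \<open>The second summand is half of the left side and is absorbed by it.\<close>
  also have "\<dots> \<le> 1 / 2 + norm (T - 1) * (real J / 2)"
    by (intro add_mono assms(1) order_trans[OF norm_mult_ineq] mult_left_mono E) auto
  finally show ?thesis using assms(2) by (simp add: field_simps)
qed

lemma K_isometry:
  fixes k :: "('n::{finite,linorder}) cmat"
  assumes "k \<in> K_grp"
  shows "norm (k *v x) = norm x"
proof -
  have sp: "complex_of_real ((norm y)\<^sup>2) = (\<Sum>i\<in>UNIV. y $ i * cnj (y $ i))" for y :: "complex^'n::{finite,linorder}"
    by (simp add: norm_vec_def L2_set_def sum_nonneg complex_norm_square del: of_real_power)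
  have orth: "(\<Sum>i\<in>UNIV. k $ i $ j * k $ i $ l) = (if j = l then 1 else 0)" for j l
  proof -
    have "(transpose k ** k) $ j $ l = (mat 1 :: 'n cmat) $ j $ l" by (simp add: K_orthogonal[OF assms])
    then show ?thesis by (simp add: matrix_matrix_mult_def transpose_def mat_def)
  qed
  have real: "cnj (k $ i $ j) = k $ i $ j" for i j
    using K_real[OF assms] by (simp add: cnj_mat_def vec_eq_iff)
  have "complex_of_real ((norm (k *v x))\<^sup>2) =
      (\<Sum>i\<in>UNIV. (\<Sum>j\<in>UNIV. k $ i $ j * x $ j) * (\<Sum>l\<in>UNIV. k $ i $ l * cnj (x $ l)))"
    unfolding sp by (simp add: matrix_vector_mult_def real)
  also have "\<dots> = (\<Sum>i\<in>UNIV. \<Sum>j\<in>UNIV. \<Sum>l\<in>UNIV. k $ i $ j * k $ i $ l * (x $ j * cnj (x $ l)))"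
    by (simp add: sum_product mult_ac)
  also have "\<dots> = (\<Sum>j\<in>UNIV. \<Sum>l\<in>UNIV. \<Sum>i\<in>UNIV. k $ i $ j * k $ i $ l * (x $ j * cnj (x $ l)))"
    by (subst sum.swap) (rule sum.cong[OF refl sum.swap])
  also have "\<dots> = (\<Sum>j\<in>UNIV. \<Sum>l\<in>UNIV. if j = l then x $ j * cnj (x $ l) else 0)"
    by (intro sum.cong refl) (simp add: sum_distrib_right[symmetric] orth)
  also have "\<dots> = complex_of_real ((norm x)\<^sup>2)"
    unfolding sp by simp
  finally have "(norm (k *v x))\<^sup>2 = (norm x)\<^sup>2" using of_real_eq_iff by blast
  then show ?thesis by simp
qed

lemma norm_Endo_K: "k \<in> K_grp \<Longrightarrow> norm (Endo k) \<le> 1"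
  unfolding norm_endo_def mat_of_Endo by (rule onorm_le) (simp add: K_isometry)

lemma K_power_near_1:
  assumes "k \<in> K_grp"
  shows "mat_pow k j \<in> K_grp \<and> norm (Endo (mat_pow k j) - 1) \<le> real j * norm (Endo k - 1)"
proof (induction j)
  case (Suc j)
  have "Endo (mat_pow k (Suc j)) - 1 = Endo k * (Endo (mat_pow k j) - 1) + (Endo k - 1)"
    by (simp add: Endo_simps algebra_simps)
  then have "norm (Endo (mat_pow k (Suc j)) - 1) \<le> norm (Endo k) * norm (Endo (mat_pow k j) - 1) + norm (Endo k - 1)"
    by (metis norm_triangle_le norm_mult_ineq add_right_mono)
  also have "norm (Endo k) * norm (Endo (mat_pow k j) - 1) \<le> 1 * (real j * norm (Endo k - 1))"
    by (intro mult_mono norm_Endo_K assms) (use Suc in auto)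
  finally show ?case using Suc assms by (simp add: K_mult algebra_simps)
qed (simp add: K_1 Endo_simps)

lemma has_vector_derivative_Endo:
  assumes "(c has_vector_derivative (W :: complex^'d^'d)) F"
  shows "((\<lambda>t. Endo (c t)) has_vector_derivative Endo W) F"
  using assms by (rule bounded_linear.has_vector_derivative[OF bounded_linear_Endo])

lemma has_vector_derivative_matrix_mult:
  fixes A B :: "real \<Rightarrow> complex^'d^'d"
  assumes "(A has_vector_derivative A') (at x)" "(B has_vector_derivative B') (at x)"
  shows "((\<lambda>t. A t ** B t) has_vector_derivative (A x ** B' + A' ** B x)) (at x)"
  using bounded_bilinear.has_vector_derivative[OF bounded_bilinear_matrix_mult assms] .

lemma matrix_mul_minus:
  fixes A B :: "complex^'d^'d"
  shows "A ** (- B) = - (A ** B)" "(- A) ** B = - (A ** B)"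
  by (simp_all add: matrix_matrix_mult_def vec_eq_iff sum_negf)

lemma mat_exp_deriv_0: "((\<lambda>t. mat_exp (t *\<^sub>R W)) has_vector_derivative W) (at 0)"
  using mat_exp_has_vector_derivative[of W 0] by simp

lemma mat_exp_deriv_0_minus: "((\<lambda>t. mat_exp (t *\<^sub>R (- W))) has_vector_derivative - W) (at 0)"
  by (rule mat_exp_deriv_0)

text \<open>
  The differential \<open>dT\<close> of a representation is linear on \<open>k_real\<close> only; composed with the projection
  \<open>k_proj\<close> it is linear on all matrices and can be differentiated along curves.
\<close>

definition k_proj :: "('n::{finite,linorder}) cmat \<Rightarrow> 'n cmat" where
  "k_proj X = (let Y = X + theta X; Z = Y + real_conj Y in (1 / 8) *\<^sub>R (Z - transpose Z))"

lemma real_conj_theta: "real_conj (theta X) = theta (real_conj X)"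
  by (simp add: vec_eq_iff real_conj_entry theta_entry) (simp add: last_sign_def)

lemma transpose_theta: "transpose (theta X) = theta (transpose X)"
  and transpose_real_conj: "transpose (real_conj X) = real_conj (transpose X)"
  by (simp_all add: vec_eq_iff real_conj_entry theta_entry transpose_def)

lemma theta_theta: "theta (theta X) = X" and real_conj_real_conj: "real_conj (real_conj X) = X"
  by (simp_all add: vec_eq_iff real_conj_entry theta_entry) (simp_all add: last_sign_def)

lemmas mat_linear =
  linear_add[OF linear_theta] linear_add[OF linear_real_conj] linear_add[OF linear_transpose]
  linear_diff[OF linear_theta] linear_diff[OF linear_real_conj] linear_diff[OF linear_transpose]
  linear_scale[OF linear_theta] linear_scale[OF linear_real_conj] linear_scale[OF linear_transpose]
  linear_neg[OF linear_theta] linear_neg[OF linear_real_conj] linear_neg[OF linear_transpose]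

lemma k_proj_in: "k_proj X \<in> k_real"
  by (simp add: k_real_def g_real_def k_proj_def Let_def mat_linear real_conj_theta transpose_theta
      transpose_real_conj theta_theta real_conj_real_conj transpose_transpose algebra_simps)

text \<open>On \<open>k_real\<close> each of the three symmetrizations doubles its argument; the
  factor 1 / 8 undoes this.\<close>

lemma k_proj_id: "X \<in> k_real \<Longrightarrow> k_proj X = X"
  unfolding k_real_def g_real_def
  by (clarsimp simp only: k_proj_def Let_def scaleR_2[symmetric] mat_linear diff_minus_eq_add
      scaleR_minus_right mem_Collect_eq) simp

lemma linear_k_proj: "linear k_proj"
  by (rule linearI) (simp_all add: k_proj_def Let_def mat_linear algebra_simps)

section \<open>The differential of a representation of K\<close>

locale K_representation =
  fixes \<tau> :: "('n::{finite,linorder}) cmat \<Rightarrow> ('d::finite) cmat"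
  assumes K_rep: "K_rep \<tau>"
begin

definition T :: "'n cmat \<Rightarrow> 'd endo" where
  "T k = Endo (\<tau> k)"

definition dT :: "'n cmat \<Rightarrow> 'd endo" where
  "dT W = Endo (drep_real \<tau> W)"

lemma T_1: "T (mat 1) = 1"
  using K_rep by (simp add: T_def K_rep_def Endo_simps)

lemma T_mult: "k \<in> K_grp \<Longrightarrow> h \<in> K_grp \<Longrightarrow> T (k ** h) = T k * T h"
  using K_rep by (simp add: T_def K_rep_def Endo_simps)

lemma T_continuous: "continuous_on K_grp T"
  unfolding T_def
  using K_rep linear_continuous_on_compose[of K_grp \<tau> Endo] bounded_linear_Endo
  by (auto simp: K_rep_def intro: bounded_linear.continuous_on)

lemma T_lipschitz:
  "\<exists>C e. e > 0 \<and> (\<forall>k\<in>K_grp. norm (Endo k - 1) < e \<longrightarrow> norm (T k - 1) \<le> C * norm (Endo k - 1))"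
proof -
  obtain r where r: "r > 0" "\<And>k. k \<in> K_grp \<Longrightarrow> dist k (mat 1) < r \<Longrightarrow> dist (T k) 1 < 1 / 2"
    using T_continuous K_1 T_1 unfolding continuous_on_iff by (metis half_gt_zero zero_less_one)
  obtain c where c: "c > 0" "\<And>A :: 'n endo. norm (mat_of A) \<le> norm A * c"
    using bounded_linear.pos_bounded[OF bounded_linear_mat_of] by blast
  define e where "e = r / (2 * c)"
  have e: "e > 0" using r c by (simp add: e_def)
  have near: "norm (T k - 1) \<le> 1 / 2" if "k \<in> K_grp" "norm (Endo k - 1) \<le> e" for k
  proof -
    have "mat_of (Endo k - 1) = k - mat 1" by (simp add: minus_endo.rep_eq one_endo.rep_eq)
    then have "dist k (mat 1) \<le> norm (Endo k - 1) * c" using c(2)[of "Endo k - 1"] by (simp add: dist_norm)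
    also have "\<dots> \<le> e * c" using that c(1) by (intro mult_right_mono) auto
    also have "\<dots> < r" using r c by (simp add: e_def)
    finally show ?thesis using r(2)[OF that(1)] by (simp add: dist_norm)
  qed
  have "norm (T k - 1) \<le> (2 / e) * norm (Endo k - 1)" if k: "k \<in> K_grp" "norm (Endo k - 1) < e" for k
  proof (cases "Endo k = 1")
    case True
    then have "k = mat 1" by (metis Endo_eq_iff Endo_simps(6) cs_1)
    then show ?thesis using T_1 e by simp
  next
    case False
    define h where "h = norm (Endo k - 1)"
    \<comment> \<open>The powers of k up to J stay within e of 1, where T is within 1 / 2 of 1.
      \<open>near_1_of_powers\<close> then bounds T k - 1 by 1 / J, which is at most 2 h /
      e.\<close>
    define J where "J = nat \<lfloor>e / h\<rfloor>"
    have h: "h > 0" "h < e" using False k by (auto simp: h_def)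
    then have "e / h \<ge> 1" by simp
    then have J: "J > 0" "real J \<le> e / h" "e / h < real J + 1" unfolding J_def by linarith+
    have "norm (T k ^ j - 1) \<le> 1 / 2" if "j \<le> J" for j
    proof -
      have "T k ^ j = T (mat_pow k j)"
        by (induction j) (use K_power_near_1[OF k(1)] in \<open>simp_all add: T_1 T_mult k\<close>)
      moreover have "norm (Endo (mat_pow k j) - 1) \<le> e"
      proof -
        have "norm (Endo (mat_pow k j) - 1) \<le> real j * h"
          unfolding h_def using K_power_near_1[OF k(1)] by blast
        also have "\<dots> \<le> (e / h) * h" using that J h by (intro mult_right_mono) auto
        finally show ?thesis using h by simp
      qed
      ultimately show ?thesis using near K_power_near_1[OF k(1)] by simp
    qed
    then have "norm (T k - 1) \<le> 1 / real J" using J(1) by (rule near_1_of_powers)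
    also have "\<dots> \<le> (2 / e) * h"
    proof -
      have "e / h < 2 * real J" using J by linarith
      then have "e < 2 * real J * h" using h by (simp add: field_simps)
      then show ?thesis using J e by (simp add: field_simps)
    qed
    finally show ?thesis by (simp add: h_def)
  qed
  then show ?thesis using e by blast
qed

text \<open>\<open>drep_real\<close> is a \<open>vector_derivative\<close> and has the intended
  meaning only once the derivative exists; continuity of the one-parameter group ensures
  this.\<close>

lemma T_exp_deriv:
  assumes "W \<in> k_real"
  shows "((\<lambda>t. T (mat_exp (t *\<^sub>R W))) has_vector_derivative dT W) (at 0)"
proof -
  have K: "mat_exp (t *\<^sub>R W) \<in> K_grp" for t
    using assms by (intro mat_exp_K k_real_scaleR)
  have "\<exists>Y. ((\<lambda>t. T (mat_exp (t *\<^sub>R W))) has_vector_derivative Y) (at 0)"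
  proof (rule one_parameter_differentiable)
    show "continuous_on UNIV (\<lambda>t. T (mat_exp (t *\<^sub>R W)))"
      by (rule continuous_on_compose2[OF T_continuous continuous_on_mat_exp]) (use K in auto)
  qed (simp_all add: mat_exp_add T_mult K T_1)
  then obtain Y where Y: "((\<lambda>t. T (mat_exp (t *\<^sub>R W))) has_vector_derivative Y) (at 0)" by blast
  then have "((\<lambda>t. mat_of (T (mat_exp (t *\<^sub>R W)))) has_vector_derivative mat_of Y) (at 0)"
    by (rule bounded_linear.has_vector_derivative[OF bounded_linear_mat_of])
  then have "drep_real \<tau> W = mat_of Y"
    unfolding drep_real_def T_def by (simp add: vector_derivative_at)
  then show ?thesis using Y by (simp add: dT_def mat_of_inverse)
qed

text \<open>A chain rule for T along any curve in K. Writing c(t) = exp (t W) k(t), the curve k has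
  derivative 0 at 0, and the Lipschitz bound passes this on to T k; only the one-parameter group
  contributes.\<close>

lemma T_deriv_at_1:
  assumes c: "\<And>t. c t \<in> K_grp" "c 0 = mat 1" "(c has_vector_derivative W) (at 0)" and W: "W \<in> k_real"
  shows "((\<lambda>t. T (c t)) has_vector_derivative dT W) (at 0)"
proof -
  define k where "k t = mat_exp (t *\<^sub>R (- W)) ** c t" for t
  have E: "mat_exp (t *\<^sub>R X) \<in> K_grp" if "X \<in> k_real" for t X
    using that by (intro mat_exp_K k_real_scaleR)
  have W': "- W \<in> k_real" using k_real_scaleR[OF W, of "- 1"] by simp
  have k: "k t \<in> K_grp" for t unfolding k_def by (intro K_mult E W' c)
  have "(k has_vector_derivative (mat_exp (0 *\<^sub>R (- W)) ** W + (- W) ** c 0)) (at 0)"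
    unfolding k_def by (intro has_vector_derivative_matrix_mult mat_exp_deriv_0_minus c)
  then have "(k has_vector_derivative 0) (at 0)" by (simp add: c)
  then have k_deriv: "((\<lambda>t. Endo (k t)) has_vector_derivative 0) (at 0)"
    using has_vector_derivative_Endo[of k 0] by (simp add: Endo_simps)
  have k0: "Endo (k 0) = 1" by (simp add: k_def c Endo_simps)
  obtain C e where Ce: "e > 0" "\<And>k. k \<in> K_grp \<Longrightarrow> norm (Endo k - 1) < e \<Longrightarrow> norm (T k - 1) \<le> C * norm (Endo k - 1)"
    using T_lipschitz by blast
  have "isCont (\<lambda>t. Endo (k t)) 0" using k_deriv by (rule has_vector_derivative_continuous)
  then have "((\<lambda>t. Endo (k t)) \<longlongrightarrow> 1) (at 0)" using k0 by (simp add: isCont_def)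
  then have "eventually (\<lambda>t. dist (Endo (k t)) 1 < e) (at 0)" using Ce(1) by (rule tendstoD)
  then have "eventually (\<lambda>t. norm (T (k t) - T (k 0)) \<le> C * norm (Endo (k t) - Endo (k 0))) (at 0)"
    by eventually_elim (use Ce(2) k k0 T_1 in \<open>simp add: dist_norm k_def c\<close>)
  with k_deriv have Tk: "((\<lambda>t. T (k t)) has_vector_derivative 0) (at 0)"
    by (rule has_vector_derivative_zero_compare)
  have "T (c t) = T (mat_exp (t *\<^sub>R W)) * T (k t)" for t
    unfolding k_def T_mult[OF E[OF W] k[unfolded k_def], symmetric]
    using mat_exp_minus(2)[of "t *\<^sub>R W"] by (simp add: matrix_mul_assoc)
  moreover have "((\<lambda>t. T (mat_exp (t *\<^sub>R W)) * T (k t)) has_vector_derivative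
      (T (mat_exp (0 *\<^sub>R W)) * 0 + dT W * T (k 0))) (at 0)"
    by (intro has_vector_derivative_mult T_exp_deriv W Tk)
  ultimately show ?thesis by (simp add: k_def c T_1)
qed

lemma dT_unique:
  assumes "((\<lambda>t. T (mat_exp (t *\<^sub>R W))) has_vector_derivative Y) (at 0)" "W \<in> k_real"
  shows "dT W = Y"
  using T_exp_deriv[OF assms(2)] assms(1) by (rule vector_derivative_unique_at)

text \<open>The curve exp (t X) exp (t Y) has tangent X + Y, and T is multiplicative on it.\<close>

lemma dT_add:
  assumes "X \<in> k_real" "Y \<in> k_real"
  shows "dT (X + Y) = dT X + dT Y"
proof -
  let ?e = "\<lambda>X t. mat_exp (t *\<^sub>R X)"
  have K: "?e X t \<in> K_grp" "?e Y t \<in> K_grp" for t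
    using assms by (auto intro: mat_exp_K k_real_scaleR)
  have "((\<lambda>t. ?e X t ** ?e Y t) has_vector_derivative (?e X 0 ** Y + X ** ?e Y 0)) (at 0)"
    by (intro has_vector_derivative_matrix_mult mat_exp_deriv_0)
  then have "((\<lambda>t. T (?e X t ** ?e Y t)) has_vector_derivative dT (X + Y)) (at 0)"
    using assms K by (intro T_deriv_at_1 K_mult k_real_add) (auto simp: add.commute)
  moreover have "((\<lambda>t. T (?e X t) * T (?e Y t)) has_vector_derivative (T (?e X 0) * dT Y + dT X * T (?e Y 0))) (at 0)"
    by (intro has_vector_derivative_mult T_exp_deriv assms)
  ultimately show ?thesis
    by (simp add: T_mult K T_1 add.commute) (rule vector_derivative_unique_at)
qed

lemma dT_scaleR:
  assumes "W \<in> k_real"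
  shows "dT (r *\<^sub>R W) = r *\<^sub>R dT W"
proof (rule dT_unique)
  have "((\<lambda>t. r * t) has_vector_derivative r) (at 0)"
    by (auto intro!: derivative_eq_intros simp: has_real_derivative_iff_has_vector_derivative[symmetric])
  moreover have "((\<lambda>t. T (mat_exp (t *\<^sub>R W))) has_vector_derivative dT W) (at (r * 0))"
    using T_exp_deriv[OF assms] by simp
  ultimately have "((\<lambda>t. T (mat_exp (t *\<^sub>R W))) \<circ> (\<lambda>t. r * t) has_vector_derivative r *\<^sub>R dT W) (at 0)"
    by (rule vector_diff_chain_at)
  then show "((\<lambda>t. T (mat_exp (t *\<^sub>R r *\<^sub>R W))) has_vector_derivative r *\<^sub>R dT W) (at 0)"
    by (simp add: comp_def mult.commute)
qed (use assms in \<open>rule k_real_scaleR\<close>)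

lemma dT_conj:
  assumes "k \<in> K_grp" "k' \<in> K_grp" "k ** k' = mat 1" "W \<in> k_real" "k ** W ** k' \<in> k_real"
  shows "T k * dT W * T k' = dT (k ** W ** k')"
proof -
  let ?c = "\<lambda>t. k ** mat_exp (t *\<^sub>R W) ** k'"
  have K: "mat_exp (t *\<^sub>R W) \<in> K_grp" for t
    using assms by (auto intro: mat_exp_K k_real_scaleR)
  have "(?c has_vector_derivative k ** W ** k') (at 0)"
    by (intro bounded_linear.has_vector_derivative[OF bounded_linear_matrix_mult_left]
        bounded_linear.has_vector_derivative[OF bounded_linear_matrix_mult_right] mat_exp_deriv_0)
  then have "((\<lambda>t. T (?c t)) has_vector_derivative dT (k ** W ** k')) (at 0)"
    using assms K by (intro T_deriv_at_1 K_mult) auto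
  moreover have "((\<lambda>t. T k * T (mat_exp (t *\<^sub>R W)) * T k') has_vector_derivative T k * dT W * T k') (at 0)"
    by (intro bounded_linear.has_vector_derivative[OF bounded_linear_mult_left]
        bounded_linear.has_vector_derivative[OF bounded_linear_mult_right] T_exp_deriv assms)
  ultimately show ?thesis
    by (simp add: T_mult K K_mult assms) (metis vector_derivative_unique_at)
qed

lemma k_real_conj:
  assumes "X \<in> k_real" "W \<in> k_real"
  shows "mat_exp X ** W ** mat_exp (- X) \<in> k_real"
proof -
  have "- X \<in> k_real" using k_real_scaleR[OF assms(1), of "- 1"] by simp
  then show ?thesis
    using assms
    by (simp add: k_real_def g_real_def theta_mult real_conj_mult mat_exp_theta[symmetric] mat_exp_real_conj[symmetric]
        matrix_transpose_mul mat_exp_transpose mat_linear)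
      (simp add: mat_exp_theta mat_exp_real_conj mat_linear matrix_mul_assoc matrix_mul_minus)
qed

text \<open>Both sides are derivatives at 0 of T(exp (t X)) dT W T(exp (- t X)) = dT(exp (t X) W exp
  (- t X)). \<open>k_proj\<close> turns \<open>dT\<close> into a linear map on all matrices, so that
  the right side can be differentiated inside.\<close>

lemma dT_bracket:
  assumes "X \<in> k_real" "W \<in> k_real"
  shows "dT (bracket X W) = dT X * dT W - dT W * dT X"
proof -
  let ?e = "\<lambda>t. mat_exp (t *\<^sub>R X)" and ?e' = "\<lambda>t. mat_exp (t *\<^sub>R (- X))"
  have X': "- X \<in> k_real" using k_real_scaleR[OF assms(1), of "- 1"] by simp
  define L where "L Y = dT (k_proj Y)" for Y
  have "linear L"
    by (rule linearI) (simp_all add: L_def linear_add[OF linear_k_proj] linear_scale[OF linear_k_proj] dT_add dT_scaleR k_proj_in)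
  then have "bounded_linear L" by (simp add: linear_conv_bounded_linear)
  moreover have "((\<lambda>t. ?e t ** W ** ?e' t) has_vector_derivative (?e 0 ** W) ** (- X) + (X ** W) ** ?e' 0) (at 0)"
    by (intro has_vector_derivative_matrix_mult mat_exp_deriv_0
        bounded_linear.has_vector_derivative[OF bounded_linear_matrix_mult_left])
  ultimately have "((\<lambda>t. L (?e t ** W ** ?e' t)) has_vector_derivative L ((?e 0 ** W) ** (- X) + (X ** W) ** ?e' 0)) (at 0)"
    by (rule bounded_linear.has_vector_derivative)
  moreover have "L (?e t ** W ** ?e' t) = T (?e t) * dT W * T (?e' t)" for t
  proof -
    have "?e t ** W ** ?e' t \<in> k_real"
      using k_real_conj[OF k_real_scaleR[OF assms(1)] assms(2)] by simp
    then show ?thesis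
      unfolding L_def using assms mat_exp_K[OF k_real_scaleR[OF X', of t]] mat_exp_minus(2)[of "t *\<^sub>R X"]
      by (subst dT_conj) (auto simp: k_proj_id mat_exp_K k_real_scaleR)
  qed
  moreover have "((\<lambda>t. T (?e t) * dT W * T (?e' t)) has_vector_derivative
      (T (?e 0) * dT W) * dT (- X) + (dT X * dT W) * T (?e' 0)) (at 0)"
    by (intro has_vector_derivative_mult T_exp_deriv assms X'
        bounded_linear.has_vector_derivative[OF bounded_linear_mult_left])
  ultimately have "L ((?e 0 ** W) ** (- X) + (X ** W) ** ?e' 0) = (T (?e 0) * dT W) * dT (- X) + (dT X * dT W) * T (?e' 0)"
    by (simp add: vector_derivative_unique_at)
  moreover have "dT (- X) = - dT X" using dT_scaleR[OF assms(1), of "- 1"] by simp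
  moreover have "(?e 0 ** W) ** (- X) + (X ** W) ** ?e' 0 = bracket X W"
    by (simp add: bracket_def matrix_mul_minus)
  moreover have "bracket X W \<in> k_real"
    using assms by (simp add: bracket_def k_real_def g_real_def theta_mult real_conj_mult mat_linear matrix_transpose_mul)
      (simp add: matrix_mul_minus)
  ultimately show ?thesis by (simp add: L_def k_proj_id T_1)
qed

end

section \<open>Irreducibility under the Lie algebra\<close>

lemma idx_eq_iff: "i \<in> {1..CARD('n)} \<Longrightarrow> j \<in> {1..CARD('n)} \<Longrightarrow> (idx i :: 'n::{finite,linorder}) = idx j \<longleftrightarrow> i = j"
  by (rule inj_on_eq_iff[OF bij_betw_imp_inj_on[OF bij_betw_idx]])

lemma idx_surj: "\<exists>i\<in>{1..CARD('n)}. (a :: 'n::{finite,linorder}) = idx i"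
proof -
  have "a \<in> idx ` {1..CARD('n)}"
    unfolding bij_betw_imp_surj_on[OF bij_betw_idx] by (rule UNIV_I)
  then show ?thesis by (rule imageE) blast
qed

lemma card_pos: "CARD('n::finite) \<in> {1..CARD('n)}"
  by (simp add: Suc_leI)

lemma E_mat_mult:
  assumes "j \<in> {1..CARD('n)}" "k \<in> {1..CARD('n)}"
  shows "E_mat i j ** E_mat k l = (if j = k then E_mat i l else (0 :: ('n::{finite,linorder}) cmat))"
proof -
  have "(E_mat i j ** E_mat k l :: 'n cmat) $ a $ b = (if a = idx i \<and> idx j = (idx k :: 'n) \<and> b = idx l then 1 else 0)" for a b
  proof -
    have "(E_mat i j ** E_mat k l :: 'n cmat) $ a $ b = (\<Sum>c\<in>UNIV. (E_mat i j :: 'n cmat) $ a $ c * (E_mat k l :: 'n cmat) $ c $ b)"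
      by (simp add: matrix_matrix_mult_def)
    also have "\<dots> = (\<Sum>c\<in>UNIV. if c = (idx j :: 'n) then (if a = idx i \<and> idx j = (idx k :: 'n) \<and> b = idx l then 1 else 0) else 0)"
      by (intro sum.cong) (auto simp: E_mat_def)
    finally show ?thesis by simp
  qed
  then show ?thesis
    using idx_eq_iff[OF assms] by (simp add: vec_eq_iff E_mat_def)
qed

lemma matrix_mul_diffs:
  fixes A B C D :: "complex^'n^'n"
  shows "(A - B) ** (C - D) = A ** C - A ** D - B ** C + B ** D"
  by (simp add: matrix_matrix_mult_def vec_eq_iff sum_subtractf sum.distrib algebra_simps)

lemma A_mat_swap: "A_mat i j = - A_mat j i"
  by (simp add: A_mat_def)

lemma A_mat_bracket:
  assumes "x \<in> {1..CARD('n)}" "y \<in> {1..CARD('n)}" "z \<in> {1..CARD('n)}" "w \<in> {1..CARD('n)}"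
  shows "bracket (A_mat x y) (A_mat z w) = (if y = z then A_mat x w else 0) - (if x = z then A_mat y w else 0)
    - (if y = w then A_mat x z else 0) + (if x = w then A_mat y z else (0 :: ('n::{finite,linorder}) cmat))"
  unfolding bracket_def A_mat_def matrix_mul_diffs using assms by (simp add: E_mat_mult)

lemma A_mat_entry: "A_mat x y $ a $ b =
    (if a = idx x \<and> b = idx y then 1 else 0) - (if a = idx y \<and> b = idx x then 1 else 0)"
  by (simp add: A_mat_def E_mat_def)

lemma last_sign_idx:
  "i \<in> {1..CARD('n)} \<Longrightarrow> last_sign (idx i :: 'n::{finite,linorder}) = (if i = CARD('n) then - 1 else 1)"
  unfolding last_sign_def using idx_eq_iff[OF _ card_pos, of i] by auto

lemma A_mat_k_real:
  assumes "x \<in> {1..<CARD('n)}" "y \<in> {1..<CARD('n)}"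
  shows "A_mat x y \<in> (k_real :: ('n::{finite,linorder}) cmat set)"
proof -
  have "last_sign (idx x :: 'n) = 1" "last_sign (idx y :: 'n) = 1"
    using assms by (auto simp: last_sign_idx)
  then have sign: "last_sign a * last_sign b * (A_mat x y :: 'n cmat) $ a $ b = A_mat x y $ a $ b" for a b
    unfolding A_mat_entry by auto
  have "cnj ((A_mat x y :: 'n cmat) $ a $ b) = A_mat x y $ a $ b" for a b
    unfolding A_mat_entry by (simp only: complex_cnj_diff if_distrib[of cnj] complex_cnj_one complex_cnj_zero)
  moreover have "transpose (A_mat x y :: 'n cmat) = - A_mat x y"
    unfolding vec_eq_iff by (simp add: transpose_def A_mat_def E_mat_def conj_commute)
  ultimately show ?thesis
    using sign by (simp add: k_real_def g_real_def vec_eq_iff[of "real_conj _"] vec_eq_iff[of "theta _"] vec_eq_iff[of "_ $ _"]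
        real_conj_entry theta_entry)
qed

lemma A_mat_square:
  assumes "x \<in> {1..CARD('n)}" "y \<in> {1..CARD('n)}" "x \<noteq> y"
  shows "A_mat x y ** A_mat x y = - E_mat x x - (E_mat y y :: ('n::{finite,linorder}) cmat)"
    and "A_mat x y ** (A_mat x y ** A_mat x y) = - (A_mat x y :: ('n::{finite,linorder}) cmat)"
proof -
  show 1: "A_mat x y ** A_mat x y = - E_mat x x - (E_mat y y :: 'n cmat)"
    unfolding A_mat_def matrix_mul_diffs using assms by (simp add: E_mat_mult)
  have "A_mat x y ** (- E_mat x x - E_mat y y) = - (A_mat x y :: 'n cmat)"
    unfolding A_mat_def matrix_mul_diffs using assms by (simp add: E_mat_mult matrix_mul_minus)
  then show "A_mat x y ** (A_mat x y ** A_mat x y) = - (A_mat x y :: 'n cmat)"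
    unfolding 1 .
qed

text \<open>Rodrigues' formula: as A^3 = - A, the right side solves R' = A R with R 0 = 1.\<close>

lemma mat_exp_rotation:
  fixes A :: "('n::finite) cmat"
  assumes "A ** (A ** A) = - A"
  shows "mat_exp (t *\<^sub>R A) = mat 1 + sin t *\<^sub>R A + (1 - cos t) *\<^sub>R (A ** A)"
proof -
  define a where "a = Endo A"
  define R where "R t = 1 + sin t *\<^sub>R a + (1 - cos t) *\<^sub>R (a * a)" for t
  have a3: "a * (a * a) = - a" unfolding a_def Endo_simps(3,4)[symmetric] assms ..
  have "(R has_vector_derivative 0 + cos t *\<^sub>R a + sin t *\<^sub>R (a * a)) (at t)" for t
    unfolding R_def
    by (intro has_vector_derivative_add has_vector_derivative_const has_vector_derivative_scaleR[THEN has_vector_derivative_eq_rhs])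
      (auto intro!: derivative_eq_intros)
  moreover have "0 + cos t *\<^sub>R a + sin t *\<^sub>R (a * a) = a * R t" for t
    by (simp add: R_def distrib_left a3 algebra_simps)
  ultimately have "R t = exp (t *\<^sub>R a) * R 0"
    by (intro exp_ode_unique) simp
  then show ?thesis
    unfolding Endo_eq_iff[symmetric] Endo_mat_exp by (simp add: Endo_simps a_def R_def)
qed

section \<open>Generation of K by plane rotations\<close>

lemma norm_axis: "norm (axis i c :: complex^'n) = cmod c"
proof -
  have "(\<Sum>j\<in>UNIV. (norm (axis i c $ j :: complex))\<^sup>2) = (\<Sum>j\<in>UNIV. if j = i then (cmod c)\<^sup>2 else 0)"
    by (intro sum.cong) (auto simp: axis_def)
  then show ?thesis by (simp add: norm_vec_def L2_set_def)
qed

lemma real_unit_complex: "cnj z = z \<Longrightarrow> cmod z = 1 \<Longrightarrow> 0 \<le> Re z \<Longrightarrow> z = 1"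
  by (auto simp: complex_eq_iff cmod_def power2_eq_1_iff)

lemma mult_axis:
  fixes A :: "complex^'n^'n"
  assumes "\<And>a. a \<noteq> j \<Longrightarrow> A $ a $ j = 0"
  shows "A *v axis j 1 = axis j (A $ j $ j)"
  unfolding vec_eq_iff matrix_vector_axis using assms by (simp add: axis_def)

lemma fixed_axis_entry:
  fixes A :: "complex^'n^'n"
  assumes "A *v axis j 1 = axis j 1"
  shows "A $ a $ j = (if a = j then 1 else 0)"
proof -
  have "(A *v axis j 1) $ a = axis j 1 $ a" by (simp only: assms)
  then show ?thesis unfolding matrix_vector_axis by (simp add: axis_def)
qed

lemma rotation_vec:
  fixes u :: "complex^'n::{finite,linorder}"
  assumes xy: "x \<in> {1..CARD('n)}" "y \<in> {1..CARD('n)}" "x \<noteq> y" and i: "i \<in> {1..CARD('n)}"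
  shows "(mat_exp (t *\<^sub>R A_mat x y) *v u) $ idx i =
    (if i = x then complex_of_real (cos t) * u $ idx x + complex_of_real (sin t) * u $ idx y
     else if i = y then complex_of_real (cos t) * u $ idx y - complex_of_real (sin t) * u $ idx x
     else u $ idx i)"
proof -
  have E: "(E_mat a b *v u) $ c = (if c = idx a then u $ idx b else 0)" for a b c
  proof -
    have "(E_mat a b *v u) $ c = (\<Sum>d\<in>UNIV. (E_mat a b :: 'n cmat) $ c $ d * u $ d)"
      by (simp add: matrix_vector_mult_def)
    also have "\<dots> = (\<Sum>d\<in>UNIV. if d = idx b then (if c = idx a then u $ d else 0) else 0)"
      by (intro sum.cong) (auto simp: E_mat_def)
    finally show ?thesis by simp
  qed
  have eq: "mat_exp (t *\<^sub>R A_mat x y) *v u = u + sin t *\<^sub>R (E_mat x y *v u - E_mat y x *v u) -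
      (1 - cos t) *\<^sub>R (E_mat x x *v u + E_mat y y *v u)"
    unfolding mat_exp_rotation[OF A_mat_square(2)[OF xy]] A_mat_square(1)[OF xy]
    by (simp add: A_mat_def matrix_vector_mult_add_rdistrib matrix_vector_mult_diff_rdistrib matrix_vector_scaleR
        algebra_simps)
  have "(mat_exp (t *\<^sub>R A_mat x y) *v u) $ idx i = u $ idx i +
      complex_of_real (sin t) * ((E_mat x y *v u) $ idx i - (E_mat y x *v u) $ idx i) -
      complex_of_real (1 - cos t) * ((E_mat x x *v u) $ idx i + (E_mat y y *v u) $ idx i)"
    unfolding eq scaleR_vec_eq by (simp add: algebra_simps)
  then show ?thesis
    using xy(3) unfolding E idx_eq_iff[OF i xy(1)] idx_eq_iff[OF i xy(2)] by (auto simp: algebra_simps)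
qed

inductive_set rot_gen :: "('n::{finite,linorder}) cmat set" where
  one: "mat 1 \<in> rot_gen"
| rot: "g \<in> rot_gen \<Longrightarrow> x \<in> {1..<CARD('n)} \<Longrightarrow> y \<in> {1..<CARD('n)} \<Longrightarrow>
    mat_exp (t *\<^sub>R A_mat x y) ** g \<in> (rot_gen :: 'n cmat set)"

lemma rot_gen_cancel:
  assumes "mat_exp (t *\<^sub>R A_mat x y) ** g \<in> (rot_gen :: ('n::{finite,linorder}) cmat set)"
    "x \<in> {1..<CARD('n)}" "y \<in> {1..<CARD('n)}"
  shows "g \<in> rot_gen"
proof -
  have "mat_exp ((- t) *\<^sub>R A_mat x y) ** (mat_exp (t *\<^sub>R A_mat x y) ** g) \<in> rot_gen"
    by (rule rot_gen.rot) (use assms in auto)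
  then show ?thesis
    by (simp only: matrix_mul_assoc scaleR_minus_left mat_exp_minus(1) matrix_mul_lid)
qed

text \<open>The squares of the entries in the last column add up to 1, but entries off the diagonal
  are purely imaginary there. If the diagonal entry had real part 0 too, the sum of squares would
  have real part at most 0.\<close>

lemma G_full_last_pos:
  assumes "g \<in> (G_full :: ('n::{finite,linorder}) cmat set)"
  shows "Re (g $ idx CARD('n) $ idx CARD('n)) \<noteq> 0"
proof
  let ?n = "idx CARD('n) :: 'n"
  assume z: "Re (g $ ?n $ ?n) = 0"
  have rc: "last_sign a * last_sign b * cnj (g $ a $ b) = g $ a $ b" for a b
    using assms by (simp add: G_full_def vec_eq_iff real_conj_entry)
  have "Re (g $ a $ ?n * g $ a $ ?n) \<le> 0" for a
  proof (cases "a = ?n")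
    case False
    then have "- cnj (g $ a $ ?n) = g $ a $ ?n" using rc[of a ?n] by (simp add: last_sign_def)
    then have "Re (g $ a $ ?n) = 0" by (simp add: complex_eq_iff)
    then show ?thesis by simp
  qed (use z in simp)
  then have "(\<Sum>a\<in>UNIV. Re (g $ a $ ?n * g $ a $ ?n)) \<le> 0" by (intro sum_nonpos) auto
  moreover have "(\<Sum>a\<in>UNIV. g $ a $ ?n * g $ a $ ?n) = 1"
  proof -
    have "(transpose g ** g) $ ?n $ ?n = (mat 1 :: 'n cmat) $ ?n $ ?n" using assms by (simp add: G_full_def)
    then show ?thesis by (simp add: matrix_matrix_mult_def transpose_def mat_def)
  qed
  ultimately show False by (metis Re_sum one_complex.sel(1) not_one_le_zero)
qed

text \<open>The corner entry of k is real of modulus 1. Its real part cannot change sign on a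
  connected subset of \<open>G_full\<close> joining k to 1, so the entry is 1. This is where the
  identity component enters.\<close>

lemma K_fixes_last:
  fixes k :: "('n::{finite,linorder}) cmat"
  assumes "k \<in> K_grp"
  shows "k *v axis (idx CARD('n)) 1 = axis (idx CARD('n)) 1"
proof -
  let ?n = "idx CARD('n) :: 'n"
  have off: "k $ a $ ?n = 0" if "a \<noteq> ?n" for a
  proof -
    have "theta k $ a $ ?n = k $ a $ ?n" using assms by (simp add: K_grp_def)
    with that show ?thesis by (simp add: theta_entry last_sign_def)
  qed
  have real: "cnj (k $ a $ b) = k $ a $ b" for a b
    using K_real[OF assms] by (simp add: cnj_mat_def vec_eq_iff)
  have "connected_component G_full (mat 1) k" using assms by (simp add: K_grp_def G_grp_eq)
  then obtain S where S: "connected S" "S \<subseteq> G_full" "mat 1 \<in> S" "k \<in> S"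
    by (auto simp: connected_component_def)
  let ?f = "\<lambda>g :: 'n cmat. Re (g $ ?n $ ?n)"
  have "connected (?f ` S)"
    by (intro connected_continuous_image S continuous_intros)
  moreover have "0 \<notin> ?f ` S" using G_full_last_pos S(2) by (auto simp: image_iff)
  moreover have "1 \<in> ?f ` S" using S(3) by (auto simp: mat_def intro: image_eqI[of _ _ "mat 1"])
  ultimately have "?f k > 0"
    using connectedD_interval[of "?f ` S" "?f k" 1 0] S(4) by force
  moreover have "norm (k *v axis ?n 1) = norm (axis ?n (1::complex))" by (rule K_isometry[OF assms])
  moreover have ke: "k *v axis ?n 1 = axis ?n (k $ ?n $ ?n)"
    using off by (rule mult_axis)
  ultimately have "k $ ?n $ ?n = 1"
    using real[of ?n ?n] by (intro real_unit_complex) (auto simp: norm_axis)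
  then show ?thesis using ke by simp
qed

lemma K_fixes_row:
  assumes "k \<in> K_grp" "k *v axis j 1 = axis j 1" "a \<noteq> j"
  shows "k $ j $ a = 0"
proof -
  have "transpose k *v (k *v axis j 1) = axis j 1"
    by (simp only: matrix_vector_mul_assoc K_orthogonal[OF assms(1)] matrix_vector_mul_lid)
  then have "transpose k *v axis j 1 = axis j 1" using assms(2) by simp
  then have "(transpose k *v axis j 1) $ a = axis j 1 $ a" by simp
  then show ?thesis using assms(3) by (simp only: matrix_vector_axis) (simp add: transpose_def axis_def)
qed

text \<open>Elimination by plane rotations, as for Givens rotations: column p + 1 is made a unit
  vector, and the remaining matrix fixes one more axis.\<close>

lemma K_grp_rot_gen:
  fixes k :: "('n::{finite,linorder}) cmat"
  assumes "k \<in> K_grp" "p < CARD('n)" "\<And>j. j \<in> {p<..CARD('n)} \<Longrightarrow> k *v axis (idx j) 1 = axis (idx j) 1"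
  shows "k \<in> rot_gen"
  using assms
proof (induction p arbitrary: k)
  case 0
  have "k *v axis a 1 = axis a 1" for a
    using idx_surj[of a] 0(3) by auto
  then have "k $ b $ a = mat 1 $ b $ a" for a b
    using fixed_axis_entry[of k a b] by (simp add: mat_def)
  then have "k = mat 1" by (simp add: vec_eq_iff)
  then show ?case using rot_gen.one by simp
next
  case (Suc p)
  let ?P = "idx (Suc p) :: 'n"
  have P: "Suc p \<in> {1..CARD('n)}" "Suc p \<in> {1..<CARD('n)}" using Suc.prems by auto
  have column: "g *v axis ?P 1 = axis ?P (g $ ?P $ ?P)"
    if "g \<in> K_grp" "\<And>j. j \<in> {Suc p<..CARD('n)} \<Longrightarrow> g *v axis (idx j) 1 = axis (idx j) 1"
      "\<And>i. i \<in> {1..<Suc p} \<Longrightarrow> g $ idx i $ ?P = 0" for g :: "'n cmat"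
  proof -
    have "g $ a $ ?P = 0" if "a \<noteq> ?P" for a
    proof -
      obtain i where i: "i \<in> {1..CARD('n)}" "a = idx i" using idx_surj by blast
      with that have "i \<noteq> Suc p" by auto
      then consider "i \<in> {1..<Suc p}" | "i \<in> {Suc p<..CARD('n)}" using i(1) by force
      then show ?thesis
      proof cases
        case 2
        then show ?thesis
          using K_fixes_row[OF \<open>g \<in> K_grp\<close> \<open>\<And>j. j \<in> {Suc p<..CARD('n)} \<Longrightarrow> g *v axis (idx j) 1 = axis (idx j) 1\<close>[OF 2], of ?P] \<open>a \<noteq> ?P\<close> i(2) by auto
      qed (use \<open>\<And>i. i \<in> {1..<Suc p} \<Longrightarrow> g $ idx i $ ?P = 0\<close> i in auto)
    qed
    then show ?thesis by (rule mult_axis)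
  qed
  have fixed: "g \<in> rot_gen"
    if g: "g \<in> K_grp" "\<And>j. j \<in> {Suc p<..CARD('n)} \<Longrightarrow> g *v axis (idx j) 1 = axis (idx j) 1"
      "g *v axis ?P 1 = axis ?P 1" for g :: "'n cmat"
  proof (rule Suc.IH[OF g(1)])
    fix j assume "j \<in> {p<..CARD('n)}"
    then have "j = Suc p \<or> j \<in> {Suc p<..CARD('n)}" by auto
    then show "g *v axis (idx j) 1 = axis (idx j) 1" using g by auto
  qed (use Suc.prems in auto)
  have unit: "g $ ?P $ ?P = 1" if "g \<in> K_grp" "g *v axis ?P 1 = axis ?P (g $ ?P $ ?P)" "0 \<le> Re (g $ ?P $ ?P)" for g :: "'n cmat"
  proof -
    have "cnj (g $ ?P $ ?P) = g $ ?P $ ?P"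
      using K_real[OF that(1)] by (simp add: cnj_mat_def vec_eq_iff)
    moreover have "norm (g *v axis ?P 1) = norm (axis ?P (1::complex))" by (rule K_isometry[OF that(1)])
    ultimately show ?thesis
      using that(2,3) by (intro real_unit_complex) (auto simp: norm_axis)
  qed
  \<comment> \<open>The first q entries of the column are already 0, and a rotation in the plane of
    Suc q and Suc p clears the next. The last such rotation also makes the diagonal entry
    nonnegative, whence the extra condition at q = p.\<close>
  have elim: "g \<in> rot_gen"
    if "q \<le> p" "g \<in> K_grp" "\<And>j. j \<in> {Suc p<..CARD('n)} \<Longrightarrow> g *v axis (idx j) 1 = axis (idx j) 1"
      "\<And>i. i \<in> {1..<Suc q} \<Longrightarrow> g $ idx i $ ?P = 0" "q = p \<Longrightarrow> 0 \<le> Re (g $ ?P $ ?P)" for q and g :: "'n cmat"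
    using that
  proof (induction q arbitrary: g rule: inc_induct)
    case base
    then show ?case using column[OF base(1,2,3)] unit[OF base(1)] fixed[OF base(1,2)] by simp
  next
    case (step q)
    let ?q = "Suc q" and ?u = "g *v axis ?P 1"
    have q: "?q \<in> {1..CARD('n)}" "?q \<in> {1..<CARD('n)}" "?q \<noteq> Suc p" using step.hyps P by auto
    have real: "g $ a $ b = complex_of_real (Re (g $ a $ b))" for a b
      using K_real[OF step.prems(1)] by (auto simp: cnj_mat_def vec_eq_iff complex_eq_iff)
    \<comment> \<open>Rotating by the argument of z moves the length of both entries onto the
      diagonal.\<close>
    define z where "z = Complex (Re (g $ ?P $ ?P)) (Re (g $ idx ?q $ ?P))"
    define t where "t = Arg z"
    have z: "Re (g $ ?P $ ?P) = cmod z * cos t" "Re (g $ idx ?q $ ?P) = cmod z * sin t"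
      using rcis_cmod_Arg[of z] unfolding t_def z_def by (metis Re_rcis complex.sel(1), metis Im_rcis complex.sel(2))
    define R where "R = mat_exp ((- t) *\<^sub>R (A_mat ?q (Suc p) :: 'n cmat))"
    note rot = rotation_vec[OF q(1) P(1) q(3), where t = "- t", folded R_def]
    have R: "R \<in> K_grp" unfolding R_def by (intro mat_exp_K k_real_scaleR A_mat_k_real q P)
    have entry: "(R ** g) $ idx i $ ?P = (R *v ?u) $ idx i" for i
      by (simp add: matrix_vector_mul_assoc matrix_vector_axis)
    have "R ** g \<in> rot_gen"
    proof (rule step.IH)
      show "R ** g \<in> K_grp" by (rule K_mult[OF R step.prems(1)])
      fix j assume j: "j \<in> {Suc p<..CARD('n)}"
      have "R *v axis (idx j) 1 = axis (idx j) 1"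
      proof -
        have "(R *v axis (idx j) 1) $ a = axis (idx j) 1 $ a" for a
        proof -
          obtain i where i: "i \<in> {1..CARD('n)}" "a = idx i" using idx_surj by blast
          have "j \<in> {1..CARD('n)}" "j \<noteq> ?q" "j \<noteq> Suc p" using j step.hyps P by auto
          then show ?thesis
            unfolding i(2) rot[OF i(1)] using q(1) P(1) i(1) by (auto simp: axis_def idx_eq_iff)
        qed
        then show ?thesis by (simp add: vec_eq_iff)
      qed
      then show "(R ** g) *v axis (idx j) 1 = axis (idx j) 1"
        using step.prems(2)[OF j] by (simp flip: matrix_vector_mul_assoc)
    next
      fix i assume i: "i \<in> {1..<Suc (Suc q)}"
      then have i': "i \<in> {1..CARD('n)}" "i \<noteq> Suc p" using q step.hyps by auto
      show "(R ** g) $ idx i $ ?P = 0"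
      proof (cases "i = ?q")
        case True
        then show ?thesis
          unfolding entry rot[OF i'(1)]
          by (simp add: matrix_vector_axis) (subst (1 2) real, simp add: z mult_ac)
      next
        case False
        then show ?thesis
          unfolding entry rot[OF i'(1)] using i' i step.prems(3)[of i] by (simp add: matrix_vector_axis)
      qed
    next
      have "Re ((R ** g) $ ?P $ ?P) = cos t * (cmod z * cos t) + sin t * (cmod z * sin t)"
        unfolding entry rot[OF P(1)] using q(3) by (simp add: matrix_vector_axis z)
      also have "\<dots> = cmod z * ((sin t)\<^sup>2 + (cos t)\<^sup>2)"
        by (simp only: power2_eq_square distrib_left mult_ac add_ac)
      finally have "Re ((R ** g) $ ?P $ ?P) = cmod z" by simp
      then show "0 \<le> Re ((R ** g) $ ?P $ ?P)" by simp
    qed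
    then show ?case unfolding R_def by (rule rot_gen_cancel) (use q P in auto)
  qed
  show ?case
  proof (cases "p = 0")
    case False
    then show ?thesis using elim[of 0 k] Suc.prems by auto
  next
    \<comment> \<open>For p = 0 no rotation is left to correct the sign of the last diagonal entry;
      it equals det k = 1.\<close>
    case True
    have col: "k *v axis ?P 1 = axis ?P (k $ ?P $ ?P)" by (rule column) (use Suc.prems True in auto)
    have "k $ a $ b = 0" if "a \<noteq> b" for a b
    proof (cases "b = ?P")
      case True
      have "k $ a $ ?P = axis ?P (k $ ?P $ ?P) $ a" unfolding col[symmetric] matrix_vector_axis ..
      then show ?thesis using True that by (simp add: axis_def)
    next
      case False
      obtain j where j: "j \<in> {1..CARD('n)}" "b = idx j" using idx_surj by blast
      then have "j \<in> {Suc p<..CARD('n)}" using False \<open>p = 0\<close> by (cases "j = 1") auto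
      then have "k *v axis b 1 = axis b 1" using Suc.prems(3) j by blast
      then show ?thesis using that by (simp add: fixed_axis_entry)
    qed
    then have "det k = (\<Prod>a\<in>UNIV. k $ a $ a)" by (rule det_diagonal)
    also have "\<dots> = (\<Prod>a\<in>UNIV. if a = ?P then k $ ?P $ ?P else 1)"
    proof (intro prod.cong refl)
      fix a :: 'n
      obtain j where j: "j \<in> {1..CARD('n)}" "a = idx j" using idx_surj by blast
      show "k $ a $ a = (if a = ?P then k $ ?P $ ?P else 1)"
      proof (cases "a = ?P")
        case False
        then have "j \<in> {Suc p<..CARD('n)}" using j \<open>p = 0\<close> by (cases "j = 1") auto
        then have "k *v axis a 1 = axis a 1" using Suc.prems(3) j by blast
        then show ?thesis using False by (simp add: fixed_axis_entry)
      qed simp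
    qed
    finally have "det k = k $ ?P $ ?P" by simp
    moreover have "det k = 1" using Suc.prems(1) G_subset by (auto simp: K_grp_def G_full_def)
    ultimately show ?thesis using fixed[OF Suc.prems(1,3)] col by simp
  qed
qed

lemma K_grp_generated:
  assumes "k \<in> K_grp"
  shows "k \<in> (rot_gen :: ('n::{finite,linorder}) cmat set)"
proof (rule K_grp_rot_gen[OF assms])
  show "CARD('n) - 1 < CARD('n)" using card_pos[where 'n = 'n] by auto
  fix j assume "j \<in> {CARD('n) - 1<..CARD('n)}"
  then have "j = CARD('n)" by auto
  then show "k *v axis (idx j) 1 = axis (idx j) 1" using K_fixes_last[OF assms] by simp
qed

section \<open>The module structure of an irreducible representation\<close>

lemma linear_cscale: "linear (cscale c)"
  by (rule linearI) (simp_all add: cscale_def vec_eq_iff algebra_simps)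

lemma real_conj_cscale: "real_conj (cscale c X) = cscale (cnj c) (real_conj X)"
  by (simp add: vec_eq_iff real_conj_entry) (simp add: cscale_def real_conj_entry)

lemma re_im_form:
  assumes "real_conj X = X" "real_conj Y = Y"
  shows "re_form (X + cscale \<i> Y) = X" "im_form (X + cscale \<i> Y) = Y"
  unfolding re_form_def im_form_def real_conj_def[symmetric]
  using assms by (simp_all add: linear_add[OF linear_real_conj] real_conj_cscale)
    (simp_all add: cscale_def vec_eq_iff)

lemma k_real_0: "0 \<in> k_real"
  using k_real_scaleR[OF k_proj_in[of 0], of 0] by simp

lemma k_real_diff: "X \<in> k_real \<Longrightarrow> Y \<in> k_real \<Longrightarrow> X - Y \<in> k_real"
  using k_real_add[of X "(- 1) *\<^sub>R Y"] k_real_scaleR[of Y "- 1"] by simp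

lemma k_real_k_alg: "X \<in> k_real \<Longrightarrow> Y \<in> k_real \<Longrightarrow> X + cscale \<i> Y \<in> k_alg"
proof -
  have "transpose (cscale c Z) = cscale c (transpose Z)" "theta (cscale c Z) = cscale c (theta Z)" for c and Z :: "'a cmat"
    by (simp_all add: vec_eq_iff theta_entry) (simp_all add: cscale_def transpose_def theta_entry)
  then show "X \<in> k_real \<Longrightarrow> Y \<in> k_real \<Longrightarrow> X + cscale \<i> Y \<in> k_alg"
    by (simp add: k_real_def g_real_def k_alg_def mat_linear linear_neg[OF linear_cscale])
qed

lemma bracket_cartan:
  "bracket (cscale \<i> A) (P + cscale \<i> Q) = cscale \<i> (bracket A P) - bracket A (Q :: ('n::finite) cmat)"
proof -
  have c: "Endo X * (cs \<i> * y) = cs \<i> * (Endo X * y)" for X :: "'n cmat" and y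
    by (rule cs_left_commute[symmetric])
  have i: "cs \<i> * (cs \<i> * y) = - (y :: 'n endo)" for y
    by (simp add: cs_mult[symmetric] cs_minus flip: mult.assoc)
  show ?thesis
    unfolding bracket_def Endo_eq_iff[symmetric]
    by (simp add: Endo_simps distrib_left distrib_right right_diff_distrib mult.assoc c i)
qed

text \<open>The partial sums of the exponential series stay in S, which is closed as a subspace of a
  finite-dimensional space.\<close>

lemma exp_invariant:
  assumes S: "vec.subspace S" and A: "\<And>w. w \<in> S \<Longrightarrow> A \<rhd> w \<in> S" and w: "w \<in> S"
  shows "exp (A :: 'd::finite endo) \<rhd> w \<in> S"
proof -
  have "subspace S"
    using S by (auto simp: vec.subspace_def subspace_def scaleR_vec_eq)
  then have cl: "closed S" by (rule closed_subspace)
  have pow: "(A ^ k) \<rhd> w \<in> S" for k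
    by (induction k) (simp_all add: w A)
  have bl: "bounded_linear (\<lambda>B :: 'd endo. B \<rhd> w)"
    unfolding ap_def
    by (rule bounded_linear_compose[OF bounded_bilinear.bounded_linear_left[OF bounded_bilinear_matrix_vector_mult] bounded_linear_mat_of])
  have "(\<lambda>k. A ^ k /\<^sub>R fact k) sums exp A"
    unfolding exp_def by (rule summable_sums[OF summable_exp_generic])
  then have "(\<lambda>k. (A ^ k /\<^sub>R fact k) \<rhd> w) sums (exp A \<rhd> w)"
    by (rule bounded_linear.sums[OF bl])
  then have lim: "(\<lambda>n. \<Sum>k<n. (A ^ k /\<^sub>R fact k) \<rhd> w) \<longlonglongrightarrow> exp A \<rhd> w"
    by (simp add: sums_def)
  have "(\<Sum>k<n. (A ^ k /\<^sub>R fact k) \<rhd> w) \<in> S" for n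
    by (rule vec.subspace_sum[OF S]) (simp add: scaleR_vec_eq vec.subspace_scale[OF S] pow)
  then show ?thesis by (rule closed_sequentially[OF cl _ lim])
qed

section \<open>From a representation of K to a highest weight module\<close>

context K_representation
begin

definition D :: "nat \<Rightarrow> nat \<Rightarrow> 'd endo" where
  "D x y = dT (A_mat x y)"

lemma dT_0: "dT 0 = 0"
  using dT_scaleR[OF k_real_0, of 0] by simp

lemma dT_minus: "X \<in> k_real \<Longrightarrow> dT (- X) = - dT X"
  using dT_scaleR[of X "- 1"] by simp

lemma dT_diff: "X \<in> k_real \<Longrightarrow> Y \<in> k_real \<Longrightarrow> dT (X - Y) = dT X - dT Y"
  using dT_add[of X "- Y"] dT_minus[of Y] k_real_scaleR[of Y "- 1"] by simp

lemma drep_eq: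
  assumes "X \<in> k_real" "Y \<in> k_real"
  shows "Endo (drep \<tau> (X + cscale \<i> Y)) = dT X + cs \<i> * dT Y"
proof -
  have "real_conj X = X" "real_conj Y = Y" using assms by (simp_all add: k_real_def g_real_def)
  then show ?thesis by (simp add: drep_def re_im_form Endo_simps dT_def)
qed

lemma drep_k_real: "X \<in> k_real \<Longrightarrow> Endo (drep \<tau> X) = dT X"
  using drep_eq[OF _ k_real_0, of X] by (simp add: dT_0 linear_0[OF linear_cscale])

lemma T_mat_exp:
  assumes "W \<in> k_real"
  shows "T (mat_exp (t *\<^sub>R W)) = exp (t *\<^sub>R dT W)"
proof -
  let ?g = "\<lambda>t. T (mat_exp (t *\<^sub>R W))"
  have K: "mat_exp (t *\<^sub>R W) \<in> K_grp" for t
    using assms by (intro mat_exp_K k_real_scaleR)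
  have g': "(?g has_vector_derivative dT W * ?g t) (at t)" for t
  proof -
    have "((\<lambda>s. ?g s * ?g t) has_vector_derivative dT W * ?g t) (at 0)"
      by (intro bounded_linear.has_vector_derivative[OF bounded_linear_mult_left] T_exp_deriv assms)
    moreover have "?g s * ?g t = ?g (t + s)" for s
      using mat_exp_add[of s t W] by (simp add: T_mult[OF K K] add.commute)
    ultimately have "((\<lambda>s. ?g (t + s)) has_vector_derivative dT W * ?g t) (at (- t + t))"
      by simp
    from has_vector_derivative_shift[OF this] show ?thesis by simp
  qed
  from exp_ode_unique[OF g', of t] show ?thesis by (simp add: T_1)
qed

text \<open>K is generated by the rotations exp (t A_{x,y}), on which T is exp (t D x y). This turns
  irreducibility under K into irreducibility under the operators D.\<close>

lemma invariant_under_K: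
  assumes S: "vec.subspace S"
    and inv: "\<And>x y w. \<lbrakk>x \<in> {1..<CARD('n)}; y \<in> {1..<CARD('n)}; w \<in> S\<rbrakk> \<Longrightarrow> D x y \<rhd> w \<in> S"
    and "k \<in> K_grp" "w \<in> S"
  shows "T k \<rhd> w \<in> S"
proof -
  have "k \<in> K_grp \<and> (\<forall>w\<in>S. T k \<rhd> w \<in> S)" if "k \<in> rot_gen" for k
    using that
  proof induction
    case one
    then show ?case by (simp add: K_1 T_1)
  next
    case (rot g x y t)
    have A: "A_mat x y \<in> (k_real :: 'n cmat set)" by (rule A_mat_k_real) fact+
    then have K: "mat_exp (t *\<^sub>R A_mat x y) \<in> (K_grp :: 'n cmat set)" by (intro mat_exp_K k_real_scaleR)
    have "exp (t *\<^sub>R D x y) \<rhd> w \<in> S" if "w \<in> S" for w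
      by (rule exp_invariant[OF S]) (use inv[OF rot.hyps(2,3)] that in \<open>auto simp: scaleR_vec_eq vec.subspace_scale[OF S]\<close>)
    then show ?case
      using rot.IH K by (simp add: K_mult T_mult T_mat_exp[OF A] D_def)
  qed
  then show ?thesis using K_grp_generated[OF assms(3)] assms(4) by blast
qed

lemma D_so_family: "so_ops D {1..<CARD('n)}"
proof
  fix x y assume xy: "x \<in> {1..<CARD('n)}" "y \<in> {1..<CARD('n)}"
  show "D y x = - D x y"
    unfolding D_def A_mat_swap[of y x] by (rule dT_minus) (rule A_mat_k_real[OF xy])
  fix z w assume zw: "z \<in> {1..<CARD('n)}" "w \<in> {1..<CARD('n)}"
  have K: "(if P then A_mat a b else 0) \<in> (k_real :: 'n cmat set)" "dT (if P then A_mat a b else 0) = (if P then D a b else 0)"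
    if "a \<in> {1..<CARD('n)}" "b \<in> {1..<CARD('n)}" for P a b
    using A_mat_k_real[OF that] k_real_0 by (auto simp: dT_0 D_def)
  have "D x y * D z w - D w z * D x y + (D w z * D x y - D z w * D x y) = dT (bracket (A_mat x y) (A_mat z w))"
    by (simp add: D_def dT_bracket[OF A_mat_k_real[OF xy] A_mat_k_real[OF zw]])
  also have "bracket (A_mat x y) (A_mat z w) = (if y = z then A_mat x w else 0) - (if x = z then A_mat y w else 0)
    - (if y = w then A_mat x z else 0) + (if x = w then A_mat y z else (0 :: 'n cmat))"
    by (rule A_mat_bracket) (use xy zw in auto)
  also have "dT \<dots> = (if y = z then D x w else 0) - (if x = z then D y w else 0) - (if y = w then D x z else 0) + (if x = w then D y z else 0)"
    by (simp only: dT_add dT_diff k_real_add k_real_diff K xy zw)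
  finally show "D x y * D z w - D z w * D x y = (if y = z then D x w else 0) - (if x = z then D y w else 0)
    - (if y = w then D x z else 0) + (if x = w then D y z else 0)" by simp
qed simp

text \<open>A root vector X + i Y is given by its real parts: [i A, X + i Y] = \<alpha> (X + i Y)
  follows from [A, X] = \<alpha> Y and [A, Y] = - \<alpha> X.\<close>

lemma root_vector_kills:
  assumes hw: "\<And>X. pos_root_vector X \<Longrightarrow> drep \<tau> X *v v = 0"
    and XY: "X \<in> k_real" "Y \<in> k_real" and j: "j \<in> {1..CARD('n) div 2 - 1}" "\<alpha> j = 1" "\<And>l. l < j \<Longrightarrow> \<alpha> l = (0 :: int)"
    and br: "\<And>r. r \<in> {1..CARD('n) div 2 - 1} \<Longrightarrow> bracket (A_mat (2 * r) (2 * r - 1)) X = of_int (\<alpha> r) *\<^sub>R Y"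
      "\<And>r. r \<in> {1..CARD('n) div 2 - 1} \<Longrightarrow> bracket (A_mat (2 * r) (2 * r - 1)) Y = - (of_int (\<alpha> r) *\<^sub>R X)"
  shows "dT X \<rhd> v + \<i> *s (dT Y \<rhd> v) = 0"
proof -
  have "bracket (cartan r) (X + cscale \<i> Y) = cscale (of_int (\<alpha> r)) (X + cscale \<i> Y)"
    if "r \<in> {1..CARD('n) div 2 - 1}" for r
    unfolding cartan_def bracket_cartan br[OF that]
    by (simp add: cscale_def vec_eq_iff) (simp add: scaleR_conv_of_real algebra_simps)
  then have "pos_root_vector (X + cscale \<i> Y)"
    unfolding pos_root_vector_def using j k_real_k_alg[OF XY] by (auto intro!: exI[of _ \<alpha>] bexI[of _ j])
  then have "Endo (drep \<tau> (X + cscale \<i> Y)) \<rhd> v = 0" using hw by (simp add: ap_def)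
  then show ?thesis unfolding drep_eq[OF XY] by simp
qed

end

text \<open>The hypotheses come from the root vectors of \<epsilon>_j + \<epsilon>_l and
  \<epsilon>_j - \<epsilon>_l; their sum and difference separate the two indices of the pair
  l.\<close>

lemma root_pair_split:
  assumes "x - w + \<i> *s (y + z) = 0" "x + w + \<i> *s (z - y) = (0 :: complex^'d)"
  shows "z = \<i> *s x" "w = \<i> *s y"
proof -
  have "z $ k = \<i> * x $ k \<and> w $ k = \<i> * y $ k" for k
    using arg_cong[OF assms(1), of "\<lambda>u. u $ k"] arg_cong[OF assms(2), of "\<lambda>u. u $ k"]
    by (auto simp: complex_eq_iff)
  then show "z = \<i> *s x" "w = \<i> *s y" by (simp_all add: vec_eq_iff)
qed

lemma (in K_representation) so_module_D:
  assumes card: "CARD('n) = 2 * m"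
    and irr: "irreducible_under K_grp \<tau> UNIV" and v: "v \<noteq> 0"
    and weight: "\<And>j. j \<in> {1..CARD('n) div 2 - 1} \<Longrightarrow> drep \<tau> (cartan j) *v v = of_int (lam j) *s v"
    and hw: "\<And>X. pos_root_vector X \<Longrightarrow> drep \<tau> X *v v = 0"
  shows "so_module D {1..<CARD('n)} (m - 1) v lam"
proof -
  have m: "m \<ge> 1" using card card_pos[where 'n = 'n] by auto
  have r: "CARD('n) div 2 - 1 = m - 1" using card by simp
  interpret so_ops D "{1..<CARD('n)}" by (rule D_so_family)
  show ?thesis
  proof
    show "{1..<CARD('n)} = {1..2 * (m - 1) + 1}" using card m by auto
  next
    fix S :: "(complex^'d) set"
    assume S: "vec.subspace S"
      and inv: "\<And>x y w. x \<in> {1..<CARD('n)} \<Longrightarrow> y \<in> {1..<CARD('n)} \<Longrightarrow> w \<in> S \<Longrightarrow> D x y \<rhd> w \<in> S"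
    have "\<tau> k *v w \<in> S" if "k \<in> K_grp" "w \<in> S" for k w
      using invariant_under_K[OF S inv that] by (simp add: ap_def T_def)
    then show "S = {0} \<or> S = UNIV" using irr S by (auto simp: irreducible_under_def)
  next
    fix j assume j: "j \<in> {1..m - 1}"
    have A: "A_mat (2 * j) (2 * j - 1) \<in> (k_real :: 'n cmat set)" by (rule A_mat_k_real) (use j card in auto)
    have "Endo (drep \<tau> (cartan j)) = cs \<i> * D (2 * j) (2 * j - 1)"
      using drep_eq[OF k_real_0 A] by (simp add: cartan_def D_def dT_0)
    then have "\<i> *s (D (2 * j) (2 * j - 1) \<rhd> v) = of_int (lam j) *s v"
      using weight[of j] j r by (metis ap_def ap_simps(4) ap_simps(8) mat_of_Endo)
    then have "(- \<i>) *s (\<i> *s (D (2 * j) (2 * j - 1) \<rhd> v)) = (- \<i>) *s (of_int (lam j) *s v)" by simp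
    then show "D (2 * j) (2 * j - 1) \<rhd> v = (- \<i> * of_int (lam j)) *s v" by (simp add: vec.scale_scale)
    fix y assume y: "y \<in> {2 * j<..2 * (m - 1) + 1}"
    define a where "a = 2 * j - 1"
    define b where "b = 2 * j"
    note kills = root_vector_kills[OF hw, of _ _ j]
    \<comment> \<open>The last index y belongs to the short root \<epsilon>_j. Any other y lies in a
      later pair l and is reached by the two long roots \<epsilon>_j + \<epsilon>_l and \<epsilon>_j
      - \<epsilon>_l.\<close>
    consider "y = 2 * m - 1" | l where "l \<in> {1..m - 1}" "j < l" "y = 2 * l - 1 \<or> y = 2 * l"
    proof -
      assume 1: "y = 2 * m - 1 \<Longrightarrow> thesis" and 2: "\<And>l. l \<in> {1..m - 1} \<Longrightarrow> j < l \<Longrightarrow> y = 2 * l - 1 \<or> y = 2 * l \<Longrightarrow> thesis"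
      show thesis
      proof (cases "y = 2 * m - 1")
        case False
        show thesis by (rule 2[of "(y + 1) div 2"]) (use False y j in auto)
      qed (rule 1)
    qed
    then show "D (2 * j) y \<rhd> v = \<i> *s (D (2 * j - 1) y \<rhd> v)"
    proof cases
      case 1
      have K: "A_mat a y \<in> (k_real :: 'n cmat set)" "A_mat b y \<in> (k_real :: 'n cmat set)"
        by (rule A_mat_k_real; use 1 j card in \<open>auto simp: a_def b_def\<close>)+
      have br: "bracket (A_mat (2 * r) (2 * r - 1)) (A_mat a y) = of_int (if r = j then 1 else 0) *\<^sub>R (A_mat b y :: 'n cmat)"
        "bracket (A_mat (2 * r) (2 * r - 1)) (A_mat b y) = - (of_int (if r = j then 1 else 0) *\<^sub>R (A_mat a y :: 'n cmat))"
        if "r \<in> {1..CARD('n) div 2 - 1}" for r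
      proof -
        have i: "2 * r \<in> {1..CARD('n)}" "2 * r - 1 \<in> {1..CARD('n)}" "a \<in> {1..CARD('n)}" "b \<in> {1..CARD('n)}" "y \<in> {1..CARD('n)}"
          using that j 1 card by (auto simp: a_def b_def)
        have e: "2 * r - 1 = a \<longleftrightarrow> r = j" "2 * r = b \<longleftrightarrow> r = j" "2 * r \<noteq> a" "2 * r - 1 \<noteq> b" "2 * r \<noteq> y" "2 * r - 1 \<noteq> y"
          using that j 1 card unfolding a_def b_def by (simp_all, presburger+)
        show "bracket (A_mat (2 * r) (2 * r - 1)) (A_mat a y) = of_int (if r = j then 1 else 0) *\<^sub>R (A_mat b y :: 'n cmat)"
          unfolding A_mat_bracket[OF i(1,2,3,5)] using e by (auto simp: b_def)
        show "bracket (A_mat (2 * r) (2 * r - 1)) (A_mat b y) = - (of_int (if r = j then 1 else 0) *\<^sub>R (A_mat a y :: 'n cmat))"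
          unfolding A_mat_bracket[OF i(1,2,4,5)] using e by (auto simp: a_def)
      qed
      have "D a y \<rhd> v + \<i> *s (D b y \<rhd> v) = 0"
        unfolding D_def by (rule kills[where \<alpha> = "\<lambda>r. if r = j then 1 else 0"]) (use K j r br in auto)
      then have "\<i> *s (D a y \<rhd> v + \<i> *s (D b y \<rhd> v)) = 0" by simp
      then show ?thesis by (simp add: a_def b_def vec.scale_right_distrib vec.scale_scale vec.scale_minus_left)
    next
      case (2 l)
      define c where "c = 2 * l - 1"
      define d where "d = 2 * l"
      have K: "A_mat a c \<in> (k_real :: 'n cmat set)" "A_mat a d \<in> (k_real :: 'n cmat set)"
        "A_mat b c \<in> (k_real :: 'n cmat set)" "A_mat b d \<in> (k_real :: 'n cmat set)"
        by (rule A_mat_k_real; use 2 j card in \<open>auto simp: a_def b_def c_def d_def\<close>)+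
      have br: "bracket (A_mat (2 * r) (2 * r - 1)) (A_mat a c) = (if r = j then A_mat b c else if r = l then A_mat a d else (0 :: 'n cmat))"
        "bracket (A_mat (2 * r) (2 * r - 1)) (A_mat a d) = (if r = j then A_mat b d else if r = l then - A_mat a c else (0 :: 'n cmat))"
        "bracket (A_mat (2 * r) (2 * r - 1)) (A_mat b c) = (if r = j then - A_mat a c else if r = l then A_mat b d else (0 :: 'n cmat))"
        "bracket (A_mat (2 * r) (2 * r - 1)) (A_mat b d) = (if r = j then - A_mat a d else if r = l then - A_mat b c else (0 :: 'n cmat))"
        if "r \<in> {1..CARD('n) div 2 - 1}" for r
      proof -
        have i: "2 * r \<in> {1..CARD('n)}" "2 * r - 1 \<in> {1..CARD('n)}" "a \<in> {1..CARD('n)}" "b \<in> {1..CARD('n)}"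
          "c \<in> {1..CARD('n)}" "d \<in> {1..CARD('n)}"
          using that j 2 card by (auto simp: a_def b_def c_def d_def)
        have e: "2 * r - 1 = a \<longleftrightarrow> r = j" "2 * r = b \<longleftrightarrow> r = j" "2 * r \<noteq> a" "2 * r - 1 \<noteq> b"
          "2 * r - 1 = c \<longleftrightarrow> r = l" "2 * r = d \<longleftrightarrow> r = l" "2 * r \<noteq> c" "2 * r - 1 \<noteq> d" "j \<noteq> l"
          using that j 2 card unfolding a_def b_def c_def d_def by (simp_all, presburger+)
        have s: "A_mat d z = - (A_mat z d :: 'n cmat)" "A_mat c z = - (A_mat z c :: 'n cmat)" for z
          by (rule A_mat_swap)+
        show "bracket (A_mat (2 * r) (2 * r - 1)) (A_mat a c) = (if r = j then A_mat b c else if r = l then A_mat a d else (0 :: 'n cmat))"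
          unfolding A_mat_bracket[OF i(1,2,3,5)] using e s[of a] s[of b] by (auto simp: b_def d_def)
        show "bracket (A_mat (2 * r) (2 * r - 1)) (A_mat a d) = (if r = j then A_mat b d else if r = l then - A_mat a c else (0 :: 'n cmat))"
          unfolding A_mat_bracket[OF i(1,2,3,6)] using e s[of a] s[of b] by (auto simp: b_def c_def)
        show "bracket (A_mat (2 * r) (2 * r - 1)) (A_mat b c) = (if r = j then - A_mat a c else if r = l then A_mat b d else (0 :: 'n cmat))"
          unfolding A_mat_bracket[OF i(1,2,4,5)] using e s[of a] s[of b] by (auto simp: a_def d_def)
        show "bracket (A_mat (2 * r) (2 * r - 1)) (A_mat b d) = (if r = j then - A_mat a d else if r = l then - A_mat b c else (0 :: 'n cmat))"
          unfolding A_mat_bracket[OF i(1,2,4,6)] using e s[of a] s[of b] by (auto simp: a_def c_def)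
      qed
      have bl: "bracket Z (P + Q) = bracket Z P + bracket Z Q" "bracket Z (P - Q) = bracket Z P - bracket Z Q" for Z P Q :: "'n cmat"
        unfolding bracket_def Endo_eq_iff[symmetric] by (simp_all add: Endo_simps algebra_simps)
      have 3: "dT (A_mat a c - A_mat b d) \<rhd> v + \<i> *s (dT (A_mat a d + A_mat b c) \<rhd> v) = 0"
        by (rule kills[where \<alpha> = "\<lambda>r. if r = j then 1 else if r = l then 1 else 0"])
          (use K j r 2 br in \<open>auto simp: bl k_real_add k_real_diff\<close>)
      have 4: "dT (A_mat a c + A_mat b d) \<rhd> v + \<i> *s (dT (A_mat b c - A_mat a d) \<rhd> v) = 0"
        by (rule kills[where \<alpha> = "\<lambda>r. if r = j then 1 else if r = l then - 1 else 0"])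
          (use K j r 2 br in \<open>auto simp: bl k_real_add k_real_diff\<close>)
      have "D b c \<rhd> v = \<i> *s (D a c \<rhd> v)" "D b d \<rhd> v = \<i> *s (D a d \<rhd> v)"
        unfolding D_def
        by (rule root_pair_split; use 3 4 in \<open>simp add: dT_add dT_diff K\<close>)+
      then show ?thesis using 2(3) by (auto simp: a_def b_def c_def d_def)
    qed
  qed (rule v)
qed

section \<open>Evaluating elements of the free algebra\<close>

text \<open>The action on words is replaced by an arbitrary function G of words, so that a leading
  generator can be moved into G, as in \<open>ev_gen_mult\<close>.\<close>

definition ev :: "('n cmat list \<Rightarrow> complex^'d) \<Rightarrow> ('n::finite) env \<Rightarrow> complex^'d" where
  "ev G u = (\<Sum>w\<in>Poly_Mapping.keys u. Poly_Mapping.lookup u w *s G (letters w))"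

lemma lreg_env_eq_ev: "lreg_env (*s) u f g = ev (\<lambda>w. lreg_word (*s) w f g) u"
  by (simp add: lreg_env_def ev_def)

lemma ev_0 [simp]: "ev G 0 = 0"
  by (simp add: ev_def)

lemma ev_add: "ev G (u + u') = ev G u + ev G u'"
  unfolding ev_def
  by (rule Poly_Mapping.setsum_keys_plus_distrib[where f = "\<lambda>w c. c *s G (letters w)"])
    (simp_all add: vec.scale_left_distrib)

lemma ev_minus: "ev G (- u) = - ev G u"
  using ev_add[of G u "- u"] by (simp add: add_eq_0_iff)

lemma ev_sum: "ev G (\<Sum>i\<in>I. f i) = (\<Sum>i\<in>I. ev G (f i))"
  by (induction I rule: infinite_finite_induct) (simp_all add: ev_add)

lemma ev_single: "ev G (Poly_Mapping.single w c) = c *s G (letters w)"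
  by (simp add: ev_def)

lemma ev_1: "ev G 1 = G []"
  unfolding single_one[symmetric] ev_single by (simp add: zero_word_def)

lemma ev_gen_mult: "ev G (gen X * u) = ev (\<lambda>w. G (X # w)) u"
proof -
  have u: "u = (\<Sum>w\<in>Poly_Mapping.keys u. Poly_Mapping.single w (Poly_Mapping.lookup u w))"
    by (rule poly_mapping_eqI) (simp add: lookup_sum lookup_single when_def in_keys_iff)
  have "ev G (gen X * u) = ev G (\<Sum>w\<in>Poly_Mapping.keys u. gen X * Poly_Mapping.single w (Poly_Mapping.lookup u w))"
    by (subst u) (simp add: sum_distrib_left)
  also have "\<dots> = ev (\<lambda>w. G (X # w)) u"
    by (simp add: ev_sum gen_def mult_single ev_single plus_word_def) (simp add: ev_def)
  finally show ?thesis .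
qed

lemma ev_sign_mult: "ev G ((- 1) ^ k * u) = (- 1) ^ k *\<^sub>R ev G u"
  by (cases "even k") (simp_all add: ev_minus)

section \<open>The left regular representation on equivariant functions\<close>

lemma mat_exp_left_curve:
  fixes W g :: "('n::finite) cmat"
  shows "((\<lambda>t. mat_exp ((- t) *\<^sub>R W) ** g) has_vector_derivative - (W ** g)) (at 0)"
proof -
  have "((\<lambda>t. mat_exp (t *\<^sub>R (- W)) ** g) has_vector_derivative (- W) ** g) (at 0)"
    by (rule bounded_linear.has_vector_derivative[OF bounded_linear_matrix_mult_left mat_exp_deriv_0])
  then show ?thesis by (simp add: matrix_mul_minus)
qed

lemma left_curve_in_G: "W \<in> g_real \<Longrightarrow> g \<in> G_grp \<Longrightarrow> mat_exp ((- t) *\<^sub>R W) ** g \<in> G_grp"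
  by (intro G_mult mat_exp_G g_real_scaleR)

lemma lreg_real_cong:
  assumes "\<And>h. h \<in> G_grp \<Longrightarrow> f h = f' h" "W \<in> g_real" "g \<in> G_grp"
  shows "lreg_real W f g = lreg_real W f' g"
  unfolding lreg_real_def using assms(1)[OF left_curve_in_G[OF assms(2,3)]] by simp

lemma lreg_real_0 [simp]: "lreg_real 0 f g = 0"
  by (simp add: lreg_real_def vector_derivative_const_at)

lemma lreg_real_form:
  assumes "W \<in> g_real" "sc \<i> 0 = (0 :: 'b::real_normed_vector)"
  shows "lreg sc W f g = (lreg_real W f g :: 'b)"
proof -
  have "re_form W = W" "im_form W = 0"
    using re_im_form[of W 0] assms(1) linear_0[OF linear_real_conj]
    by (simp_all add: g_real_def linear_0[OF linear_cscale])
  then show ?thesis by (simp add: lreg_def assms)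
qed

text \<open>For W = A_{n,a} it is i W that lies in the real form, and L(W) = - i L(i W).\<close>

lemma lreg_imaginary:
  assumes "cscale \<i> W \<in> g_real" "lreg_real (- cscale \<i> W) f g = - lreg_real (cscale \<i> W) f g"
  shows "lreg (*s) W f g = (- \<i>) *s lreg_real (cscale \<i> W) f g"
proof -
  let ?Y = "- cscale \<i> W"
  have Y: "?Y \<in> g_real" using g_real_scaleR[OF assms(1), of "- 1"] by simp
  have "W = 0 + cscale \<i> ?Y" by (simp add: cscale_def vec_eq_iff)
  then have "re_form W = 0" "im_form W = ?Y"
    using re_im_form[of 0 ?Y] Y linear_0[OF linear_real_conj] by (simp_all add: g_real_def)
  then show ?thesis by (simp add: lreg_def assms(2))
qed

definition p_basis :: "nat \<Rightarrow> ('n::{finite,linorder}) cmat" where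
  "p_basis a = cscale \<i> (A_mat CARD('n) a)"

lemma A_mat_last:
  assumes "a \<in> {1..<CARD('n)}"
  shows "theta (A_mat CARD('n) a) = - (A_mat CARD('n) a :: ('n::{finite,linorder}) cmat)"
    "real_conj (A_mat CARD('n) a) = - (A_mat CARD('n) a :: 'n cmat)"
    "transpose (A_mat CARD('n) a) = - (A_mat CARD('n) a :: 'n cmat)"
proof -
  have "last_sign (idx a :: 'n) = 1" "last_sign (idx CARD('n) :: 'n) = - 1"
    using assms card_pos[where 'n = 'n] by (auto simp: last_sign_idx)
  then have sign: "last_sign b * last_sign c * (A_mat CARD('n) a :: 'n cmat) $ b $ c = - (A_mat CARD('n) a $ b $ c)" for b c
    unfolding A_mat_entry by auto
  have cnj: "cnj ((A_mat CARD('n) a :: 'n cmat) $ b $ c) = A_mat CARD('n) a $ b $ c" for b c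
    unfolding A_mat_entry by (simp only: complex_cnj_diff if_distrib[of cnj] complex_cnj_one complex_cnj_zero)
  show "theta (A_mat CARD('n) a) = - (A_mat CARD('n) a :: 'n cmat)"
    "real_conj (A_mat CARD('n) a) = - (A_mat CARD('n) a :: 'n cmat)"
    unfolding vec_eq_iff theta_entry real_conj_entry cnj sign by simp_all
  show "transpose (A_mat CARD('n) a) = - (A_mat CARD('n) a :: 'n cmat)"
    unfolding vec_eq_iff by (simp add: transpose_def A_mat_def E_mat_def conj_commute)
qed

lemma p_basis_g_real:
  assumes "a \<in> {1..<CARD('n)}"
  shows "p_basis a \<in> (g_real :: ('n::{finite,linorder}) cmat set)"
proof -
  have "transpose (cscale \<i> Z) = cscale \<i> (transpose Z)" for Z :: "'n cmat"
    by (simp add: vec_eq_iff cscale_def transpose_def)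
  then show ?thesis
    using A_mat_last[OF assms]
    by (simp add: g_real_def p_basis_def real_conj_cscale linear_neg[OF linear_cscale])
      (simp add: cscale_def vec_eq_iff)
qed

lemma p_basis_p_alg:
  assumes "a \<in> {1..<CARD('n)}"
  shows "p_basis a \<in> (p_alg :: ('n::{finite,linorder}) cmat set)"
proof -
  have "transpose (cscale \<i> Z) = cscale \<i> (transpose Z)" "theta (cscale \<i> Z) = cscale \<i> (theta Z)" for Z :: "'n cmat"
    by (simp_all add: vec_eq_iff theta_entry) (simp_all add: cscale_def transpose_def theta_entry)
  then show ?thesis
    using A_mat_last[OF assms] by (simp add: p_alg_def p_basis_def linear_neg[OF linear_cscale])
qed

lemma k_real_g_real: "W \<in> k_real \<Longrightarrow> W \<in> g_real"
  by (simp add: k_real_def)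

section \<open>Left derivatives of equivariant functions\<close>

locale equivariant_function = K_representation \<tau> for \<tau> :: "('n::{finite,linorder}) cmat \<Rightarrow> ('d::finite) cmat" +
  fixes \<phi> :: "'n cmat \<Rightarrow> complex^'d"
  assumes smooth: "\<phi> \<in> C_infty \<tau>"
begin

definition dphi :: "'n cmat \<Rightarrow> 'n cmat \<Rightarrow> complex^'d" where
  "dphi g W = lreg_real W \<phi> g"

lemma equivariant: "k \<in> K_grp \<Longrightarrow> g \<in> G_grp \<Longrightarrow> \<phi> (k ** g) = T k \<rhd> \<phi> g"
  using smooth by (simp add: C_infty_def T_def ap_def)

text \<open>A smooth extension F near g has a derivative F', and the curve exp (- t W) g has tangent
  - W g; so L W = F'(- W g), which is linear in W.\<close>

lemma dphi_linear:
  assumes g: "g \<in> G_grp"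
  shows "\<exists>L. linear L \<and> (\<forall>W\<in>g_real. ((\<lambda>t. \<phi> (mat_exp ((- t) *\<^sub>R W) ** g)) has_vector_derivative L W) (at 0))"
proof -
  have "\<exists>U F. open U \<and> g \<in> U \<and> (\<forall>k. Ck_on k U F) \<and> (\<forall>x\<in>U \<inter> G_grp. F x = \<phi> x)"
    using smooth g unfolding C_infty_def smooth_on_G_def by blast
  then obtain U F where UF: "open U" "g \<in> U" "\<And>k. Ck_on k U F" "\<And>x. x \<in> U \<inter> G_grp \<Longrightarrow> F x = \<phi> x"
    by blast
  from UF(3)[of 1] UF(2) have "F differentiable (at g)" by simp
  then have F: "(F has_derivative frechet_derivative F (at g)) (at g)"
    by (simp add: frechet_derivative_works)
  define F' where "F' = frechet_derivative F (at g)"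
  have F'_lin: "linear F'" unfolding F'_def using F by (rule has_derivative_linear)
  have "((\<lambda>t. \<phi> (mat_exp ((- t) *\<^sub>R W) ** g)) has_vector_derivative F' (- (W ** g))) (at 0)" if W: "W \<in> g_real" for W
  proof -
    let ?c = "\<lambda>t. mat_exp ((- t) *\<^sub>R W) ** g"
    have c: "(?c has_vector_derivative - (W ** g)) (at 0)" by (rule mat_exp_left_curve)
    have "((\<lambda>t. F (?c t)) has_derivative (\<lambda>t. F' (t *\<^sub>R - (W ** g)))) (at 0)"
      using has_derivative_compose[of ?c "\<lambda>t. t *\<^sub>R - (W ** g)" 0 UNIV F F'] c F
      by (simp add: has_vector_derivative_def F'_def)
    then have FC: "((\<lambda>t. F (?c t)) has_vector_derivative F' (- (W ** g))) (at 0)"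
      by (simp add: has_vector_derivative_def linear_scale[OF F'_lin] linear_neg[OF F'_lin])
    have "isCont ?c 0" using c by (rule has_vector_derivative_continuous)
    then have "(?c \<longlongrightarrow> ?c 0) (nhds 0)"
      unfolding isCont_def by (rule tendsto_at_iff_tendsto_nhds[THEN iffD1])
    then have "eventually (\<lambda>t. ?c t \<in> U) (nhds 0)"
      by (rule topological_tendstoD) (use UF(1,2) in simp_all)
    then have "eventually (\<lambda>t. t \<in> UNIV \<longrightarrow> F (?c t) = \<phi> (?c t)) (nhds 0)"
      by eventually_elim (use UF(4) left_curve_in_G[OF W g] in auto)
    then show ?thesis
      using FC by (subst has_vector_derivative_cong_ev[symmetric]) (use UF(2,4) g in auto)
  qed
  moreover have "linear (\<lambda>W. F' (- (W ** g)))"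
    using linear_compose[OF linear_compose[OF bounded_linear.linear[OF bounded_linear_matrix_mult_left] linear_uminus] F'_lin]
    by (simp add: comp_def)
  ultimately show ?thesis by (intro exI[of _ "\<lambda>W. F' (- (W ** g))"]) simp
qed

lemma dphi_deriv_linear:
  assumes "g \<in> G_grp"
  shows "\<exists>L. linear L \<and> (\<forall>W\<in>g_real. dphi g W = L W \<and>
    ((\<lambda>t. \<phi> (mat_exp ((- t) *\<^sub>R W) ** g)) has_vector_derivative dphi g W) (at 0))"
proof -
  obtain L where L: "linear L"
    "\<And>W. W \<in> g_real \<Longrightarrow> ((\<lambda>t. \<phi> (mat_exp ((- t) *\<^sub>R W) ** g)) has_vector_derivative L W) (at 0)"
    using dphi_linear[OF assms] by blast
  moreover have "dphi g W = L W" if "W \<in> g_real" for W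
    unfolding dphi_def lreg_real_def by (rule vector_derivative_at) (rule L(2)[OF that])
  ultimately show ?thesis by (intro exI[of _ L]) simp
qed

lemma dphi_deriv:
  assumes "g \<in> G_grp" "W \<in> g_real"
  shows "((\<lambda>t. \<phi> (mat_exp ((- t) *\<^sub>R W) ** g)) has_vector_derivative dphi g W) (at 0)"
  using dphi_deriv_linear[OF assms(1)] assms(2) by blast

lemma dphi_add:
  assumes "g \<in> G_grp" "W \<in> g_real" "W' \<in> g_real"
  shows "dphi g (W + W') = dphi g W + dphi g W'"
proof -
  obtain L where L: "linear L" "\<And>W. W \<in> g_real \<Longrightarrow> dphi g W = L W"
    using dphi_deriv_linear[OF assms(1)] by blast
  show ?thesis using L(2)[OF g_real_add[OF assms(2,3)]] L(2)[OF assms(2)] L(2)[OF assms(3)]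
    by (simp add: linear_add[OF L(1)])
qed

lemma dphi_minus:
  assumes "g \<in> G_grp" "W \<in> g_real"
  shows "dphi g (- W) = - dphi g W"
proof -
  obtain L where L: "linear L" "\<And>W. W \<in> g_real \<Longrightarrow> dphi g W = L W"
    using dphi_deriv_linear[OF assms(1)] by blast
  show ?thesis using L(2)[OF g_real_scaleR[OF assms(2), of "- 1"]] L(2)[OF assms(2)]
    by (simp add: linear_neg[OF L(1)])
qed

lemma dphi_k:
  assumes "g \<in> G_grp" "W \<in> k_real"
  shows "dphi g W = - (dT W \<rhd> \<phi> g)"
proof -
  have W': "- W \<in> k_real" using k_real_scaleR[OF assms(2), of "- 1"] by simp
  have "\<phi> (mat_exp ((- t) *\<^sub>R W) ** g) = mat_of (T (mat_exp (t *\<^sub>R (- W)))) *v \<phi> g" for t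
    using equivariant[OF mat_exp_K[OF k_real_scaleR[OF W', of t]] assms(1)] by (simp add: ap_def)
  moreover have "((\<lambda>t. mat_of (T (mat_exp (t *\<^sub>R (- W)))) *v \<phi> g) has_vector_derivative mat_of (dT (- W)) *v \<phi> g) (at 0)"
    by (intro bounded_linear.has_vector_derivative[OF bounded_bilinear.bounded_linear_left[OF bounded_bilinear_matrix_vector_mult]]
        bounded_linear.has_vector_derivative[OF bounded_linear_mat_of] T_exp_deriv W')
  ultimately have "((\<lambda>t. \<phi> (mat_exp ((- t) *\<^sub>R W) ** g)) has_vector_derivative dT (- W) \<rhd> \<phi> g) (at 0)"
    by (simp add: ap_def)
  then have "dphi g W = dT (- W) \<rhd> \<phi> g"
    by (rule vector_derivative_unique_at[OF dphi_deriv[OF assms(1) k_real_g_real[OF assms(2)]]])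
  then show ?thesis by (simp add: dT_minus[OF assms(2)])
qed

lemma lreg_real_linear_image:
  assumes "bounded_linear f" "g \<in> G_grp" "W \<in> g_real"
  shows "lreg_real W (\<lambda>h. f (\<phi> h)) g = f (dphi g W)"
  unfolding lreg_real_def
  by (rule vector_derivative_at) (rule bounded_linear.has_vector_derivative[OF assms(1) dphi_deriv[OF assms(2,3)]])

lemma bounded_linear_ap: "bounded_linear (\<lambda>w. A \<rhd> w)"
  unfolding ap_def by (rule bounded_linear_mult_vec)

text \<open>The letters occur in reversed order: the operator found for w is constant in g, so the
  derivative along the leading letter X passes through it and acts on \<phi> by - dT X.\<close>

primrec word_op :: "'n cmat list \<Rightarrow> 'd endo" where
  "word_op [] = 1"
| "word_op (X # w) = word_op w * (- dT X)"

lemma lreg_word_k: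
  assumes "set w \<subseteq> k_real" "g \<in> G_grp"
  shows "lreg_word (*s) w \<phi> g = word_op w \<rhd> \<phi> g"
  using assms
proof (induction w arbitrary: g)
  case (Cons X w)
  then have X: "X \<in> k_real" "X \<in> g_real" by (auto intro: k_real_g_real)
  have "lreg_word (*s) (X # w) \<phi> g = lreg_real X (lreg_word (*s) w \<phi>) g"
    using lreg_real_form[OF X(2), of "(*s)"] by simp
  also have "\<dots> = lreg_real X (\<lambda>h. word_op w \<rhd> \<phi> h) g"
    by (rule lreg_real_cong) (use Cons X in auto)
  also have "\<dots> = word_op w \<rhd> dphi g X"
    by (rule lreg_real_linear_image) (use Cons X bounded_linear_ap in auto)
  finally show ?case using dphi_k[OF Cons.prems(2) X(1)] by (simp add: ap_minus)
qed simp

lemma lreg_word_p: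
  assumes "set w \<subseteq> k_real" "g \<in> G_grp" "a \<in> {1..<CARD('n)}"
  shows "lreg_word (*s) (A_mat CARD('n) a # w) \<phi> g = word_op w \<rhd> ((- \<i>) *s dphi g (p_basis a))"
proof -
  have P: "p_basis a \<in> (g_real :: 'n cmat set)" by (rule p_basis_g_real[OF assms(3)])
  have P': "- p_basis a \<in> (g_real :: 'n cmat set)" using g_real_scaleR[OF P, of "- 1"] by simp
  have eq: "lreg_real W (lreg_word (*s) w \<phi>) g = word_op w \<rhd> dphi g W" if "W \<in> g_real" for W
  proof -
    have "lreg_real W (lreg_word (*s) w \<phi>) g = lreg_real W (\<lambda>h. word_op w \<rhd> \<phi> h) g"
      by (rule lreg_real_cong) (use lreg_word_k assms that in auto)
    then show ?thesis using lreg_real_linear_image[OF bounded_linear_ap assms(2) that] by simp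
  qed
  have "lreg (*s) (A_mat CARD('n) a) (lreg_word (*s) w \<phi>) g =
      (- \<i>) *s lreg_real (cscale \<i> (A_mat CARD('n) a)) (lreg_word (*s) w \<phi>) g"
    by (rule lreg_imaginary)
      (use P eq[OF P] eq[OF P'] dphi_minus[OF assms(2) P] in \<open>simp_all add: p_basis_def ap_minus\<close>)
  then show ?thesis using eq[OF P] by (simp add: p_basis_def ap_scale ap_minus vec.scale_minus_left)
qed

end

section \<open>Pfaffians acting on equivariant functions\<close>

context equivariant_function
begin

text \<open>The sign counts the k letters, each acting by - dT. Their reversal is harmless because
  the leading entry shares no index with its minor and commutes with it. G and x stay general so
  that the leading letter can be absorbed into x in the induction.\<close>

lemma ev_Pf:
  assumes "\<And>a b. 1 \<le> a \<Longrightarrow> a < b \<Longrightarrow> b \<le> 2 * k \<Longrightarrow> i a < i b"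
    and "\<And>a. a \<in> {1..2 * k} \<Longrightarrow> i a \<in> {1..<CARD('n)}"
    and "\<And>w. set w \<subseteq> k_real \<Longrightarrow> G w = word_op w \<rhd> x"
  shows "ev G (Pf k i) = ((- 1) ^ k *\<^sub>R pf D (i ` {1..2 * k})) \<rhd> x"
  using assms
proof (induction k arbitrary: i G x)
  case 0
  then show ?case using "0.prems"(3)[of "[]"] by (simp add: ev_1)
next
  case (Suc k)
  interpret so_ops D "{1..<CARD('n)}" by (rule D_so_family)
  let ?n = "2 * k + 2"
  define S where "S = i ` {1..?n}"
  define top where "top = i ?n"
  have less_iff: "i a < i b \<longleftrightarrow> a < b" if "a \<in> {1..?n}" "b \<in> {1..?n}" for a b
    using Suc.prems(1)[of a b] Suc.prems(1)[of b a] that by (cases a b rule: linorder_cases) force+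
  have inj: "inj_on i {1..?n}"
    by (rule inj_onI) (metis less_iff less_irrefl linorder_neqE_nat)
  have iU: "i a \<in> {1..<CARD('n)}" if "a \<in> {1..?n}" for a
    using Suc.prems(2)[of a] that by simp
  have S: "finite S" "S \<subseteq> {1..<CARD('n)}" "top \<in> S"
    using iU by (auto simp: S_def top_def)
  have pos: "pos_sign S (i j) = (- 1) ^ (j - 1)" if j: "j \<in> {1..?n}" for j
  proof -
    have "{c \<in> S. c < i j} = i ` {1..<j}"
      using j less_iff by (auto simp: S_def image_iff)
    moreover have "card (i ` {1..<j}) = j - 1"
    proof -
      have "{1..<j} \<subseteq> {1..?n}" using j by auto
      then show ?thesis using card_image[OF inj_on_subset[OF inj]] by simp
    qed
    ultimately show ?thesis by (simp add: pos_sign_def)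
  qed
  define ih where "ih j l = (if l < j then i l else i (l + 1))" for j l :: nat
  have ih_image: "ih j ` {1..2 * k} = S - {top, i j}" if j: "j \<in> {1..2 * k + 1}" for j
  proof -
    have "ih j ` {1..2 * k} = i ` ({1..<j} \<union> {j<..2 * k + 1})"
    proof -
      have "{1..2 * k} = {1..<j} \<union> {j..2 * k}" using j by auto
      moreover have "ih j ` {1..<j} = i ` {1..<j}" by (auto simp: ih_def)
      moreover have "ih j ` {j..2 * k} = i ` (Suc ` {j..2 * k})" unfolding image_image by (rule image_cong) (auto simp: ih_def)
      moreover have "Suc ` {j..2 * k} = {j<..2 * k + 1}" by (simp add: image_Suc_atLeastAtMost atLeastSucAtMost_greaterThanAtMost)
      ultimately show ?thesis by (simp add: image_Un)
    qed
    also have "{1..<j} \<union> {j<..2 * k + 1} = {1..?n} - {?n, j}" using j by auto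
    also have "i ` \<dots> = i ` {1..?n} - i ` {?n, j}"
      by (rule inj_on_image_set_diff[OF inj]) (use j in auto)
    finally show ?thesis by (simp add: S_def top_def)
  qed
  have summand: "ev G ((- 1) ^ (j + 1) * gen (A_mat top (i j)) * Pf k (ih j)) =
      (- 1) ^ Suc k *\<^sub>R ((pf_sign S top (i j) *\<^sub>R (D top (i j) * pf D (S - {top, i j}))) \<rhd> x)"
    if j: "j \<in> {1..2 * k + 1}" for j
  proof -
    have ij: "i j \<in> {1..<CARD('n)}" "top \<in> {1..<CARD('n)}" using iU j by (auto simp: top_def)
    have A: "A_mat top (i j) \<in> (k_real :: 'n cmat set)" by (rule A_mat_k_real) fact+
    have "ev (\<lambda>w. G (A_mat top (i j) # w)) (Pf k (ih j)) =
        ((- 1) ^ k *\<^sub>R pf D (ih j ` {1..2 * k})) \<rhd> (- D top (i j)) \<rhd> x"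
    proof (rule Suc.IH)
      show "ih j a < ih j b" if "1 \<le> a" "a < b" "b \<le> 2 * k" for a b
        using that j by (auto simp: ih_def less_iff)
      show "ih j a \<in> {1..<CARD('n)}" if "a \<in> {1..2 * k}" for a
        using that iU by (auto simp: ih_def)
      show "G (A_mat top (i j) # w) = word_op w \<rhd> (- D top (i j)) \<rhd> x" if "set w \<subseteq> k_real" for w
        using Suc.prems(3)[of "A_mat top (i j) # w"] A that by (simp add: D_def ap_minus)
    qed
    also have "\<dots> = (- 1) ^ Suc k *\<^sub>R ((pf D (S - {top, i j}) * D top (i j)) \<rhd> x)"
      unfolding ih_image[OF j] by (simp add: ap_minus)
    also have "pf D (S - {top, i j}) * D top (i j) = D top (i j) * pf D (S - {top, i j})"
      by (rule D_pf_commute[symmetric]) (use S ij in auto)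
    finally have e: "ev (\<lambda>w. G (A_mat top (i j) # w)) (Pf k (ih j)) =
      (- 1) ^ Suc k *\<^sub>R ((D top (i j) * pf D (S - {top, i j})) \<rhd> x)" .
    \<comment> \<open>S has even cardinality and \<open>top\<close> is its largest element, so an
      odd number of elements lies below it; the remaining sign is the one used in
      \<open>Pf\<close>.\<close>
    have "pf_sign S top (i j) = (- 1) ^ (j + 1)"
    proof -
      have "sgl top (i j) = 1" using less_iff[of ?n j] j by (simp add: sgl_def top_def)
      moreover have "pos_sign S top = - 1" using pos[of ?n] by (simp add: top_def)
      moreover have "pos_sign S (i j) = (- 1) ^ (j + 1)" using pos[of j] j by (cases j) auto
      ultimately show ?thesis by (simp add: pf_sign_def)
    qed
    then show ?thesis
      unfolding mult.assoc ev_sign_mult ev_gen_mult e by (simp add: mult.commute)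
  qed
  have "ev G (Pf (Suc k) i) = (\<Sum>j=1..2 * k + 1. ev G ((- 1) ^ (j + 1) * gen (A_mat top (i j)) * Pf k (ih j)))"
    by (simp only: Pf.simps ev_sum top_def ih_def[abs_def])
  also have "\<dots> = (\<Sum>j=1..2 * k + 1. (- 1) ^ Suc k *\<^sub>R ((pf_sign S top (i j) *\<^sub>R (D top (i j) * pf D (S - {top, i j}))) \<rhd> x))"
    by (rule sum.cong[OF refl summand])
  also have "\<dots> = (- 1) ^ Suc k *\<^sub>R ((\<Sum>j=1..2 * k + 1. pf_sign S top (i j) *\<^sub>R (D top (i j) * pf D (S - {top, i j}))) \<rhd> x)"
    by (simp only: scaleR_sum_right sum_ap)
  also have "(\<Sum>j=1..2 * k + 1. pf_sign S top (i j) *\<^sub>R (D top (i j) * pf D (S - {top, i j}))) = pf D S"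
  proof -
    have "S - {top} = i ` ({1..?n} - {?n})"
      unfolding S_def top_def by (subst inj_on_image_set_diff[OF inj]) auto
    also have "{1..?n} - {?n} = {1..2 * k + 1}" by auto
    finally have "S - {top} = i ` {1..2 * k + 1}" .
    moreover have "inj_on i {1..2 * k + 1}" by (rule inj_on_subset[OF inj]) auto
    ultimately show ?thesis
      unfolding pf_row[OF S] by (simp only: sum.reindex comp_def)
  qed
  finally show ?case by (simp add: S_def)
qed

text \<open>The first row of the Pfaffian lies in the complexification of p and its minors come from
  k. The scalar collects k minus signs from the minors and the factor - i from A_{n,a} = - i (i
  A_{n,a}).\<close>

lemma lreg_PF:
  assumes "CARD('n) = 2 * k + 2" "g \<in> G_grp"
  shows "lreg_env (*s) (PF (Suc k)) \<phi> g = ((- 1) ^ k * - \<i>) *s (\<Sum>a=1..2 * k + 1.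
     (((- 1) ^ (a + 1)) *\<^sub>R pf D ({1..2 * k + 1} - {a})) \<rhd> dphi g (p_basis a))"
proof -
  let ?G = "\<lambda>w. lreg_word (*s) w \<phi> g"
  define ih where "ih j l = (if l < j then l else l + 1)" for j l :: nat
  have summand: "ev ?G ((- 1) ^ (j + 1) * gen (A_mat (2 * k + 2) j) * Pf k (ih j)) =
      ((- 1) ^ k * - \<i>) *s ((((- 1) ^ (j + 1)) *\<^sub>R pf D ({1..2 * k + 1} - {j})) \<rhd> dphi g (p_basis j))"
    if j: "j \<in> {1..2 * k + 1}" for j
  proof -
    have img: "ih j ` {1..2 * k} = {1..2 * k + 1} - {j}"
    proof
      show "{1..2 * k + 1} - {j} \<subseteq> ih j ` {1..2 * k}"
      proof
        fix b assume b: "b \<in> {1..2 * k + 1} - {j}"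
        show "b \<in> ih j ` {1..2 * k}"
          by (rule image_eqI[of _ _ "if b < j then b else b - 1"]) (use b j in \<open>auto simp: ih_def\<close>)
      qed
    qed (use j in \<open>auto simp: ih_def\<close>)
    have E: "ev (\<lambda>w. ?G (A_mat (2 * k + 2) j # w)) (Pf k (ih j)) =
        ((- 1) ^ k *\<^sub>R pf D (ih j ` {1..2 * k})) \<rhd> ((- \<i>) *s dphi g (p_basis j))"
      by (rule ev_Pf)
        (use assms j lreg_word_p[OF _ assms(2), of _ j] in \<open>auto simp: ih_def\<close>)
    have V: "r *\<^sub>R ((s *\<^sub>R P) \<rhd> (c *s w)) = (of_real s * c) *s ((r *\<^sub>R P) \<rhd> w)" for r s c w and P :: "'d endo"
      by (simp only: ap_simps ap_scale scaleR_vec_eq vec.scale_scale mult_ac)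
    show ?thesis
      unfolding mult.assoc ev_sign_mult ev_gen_mult E img V by simp
  qed
  have "lreg_env (*s) (PF (Suc k)) \<phi> g =
      (\<Sum>j=1..2 * k + 1. ev ?G ((- 1) ^ (j + 1) * gen (A_mat (2 * k + 2) j) * Pf k (ih j)))"
    by (simp only: lreg_env_eq_ev PF_def Pf.simps ev_sum ih_def[abs_def])
  also have "\<dots> = (\<Sum>j=1..2 * k + 1. ((- 1) ^ k * - \<i>) *s
      ((((- 1) ^ (j + 1)) *\<^sub>R pf D ({1..2 * k + 1} - {j})) \<rhd> dphi g (p_basis j)))"
    by (rule sum.cong[OF refl summand])
  finally show ?thesis by (simp only: vec.scale_sum_right)
qed

end

section \<open>The shift operator as a vector operator\<close>

lemma tensor_arith:
  "tensor (v + w) X = tensor v X + tensor w X" "tensor (c *s v) X = c *s tensor v X"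
  "tensor v (X + Y) = tensor v X + tensor v Y" "tensor v (r *\<^sub>R X) = complex_of_real r *s tensor v X"
  by (auto simp: tensor_def vec_eq_iff algebra_simps) (simp_all add: scaleR_conv_of_real)

lemma subspace_tensor_p: "vec.subspace tensor_p"
  by (simp add: tensor_p_def)

lemma tensor_in_tensor_p: "X \<in> p_alg \<Longrightarrow> tensor v X \<in> tensor_p"
  unfolding tensor_p_def by (intro vec.span_base) blast

lemma linear_on_sub_sum:
  assumes "linear_on_sub S f" "vec.subspace S" "\<And>i. i \<in> I \<Longrightarrow> x i \<in> S"
  shows "f (\<Sum>i\<in>I. x i) = (\<Sum>i\<in>I. f (x i))"
proof -
  have "f (0 *s 0) = 0 *s f 0"
    using assms(1) vec.subspace_0[OF assms(2)] unfolding linear_on_sub_def by blast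
  then have f0: "f 0 = 0" by simp
  show ?thesis
    using assms(3)
  proof (induction I rule: infinite_finite_induct)
    case (insert i I)
    then have "x i \<in> S" "(\<Sum>i\<in>I. x i) \<in> S" by (auto intro: vec.subspace_sum[OF assms(2)])
    then have "f (x i + (\<Sum>i\<in>I. x i)) = f (x i) + f (\<Sum>i\<in>I. x i)"
      using assms(1) by (simp add: linear_on_sub_def)
    with insert show ?case by simp
  qed (simp_all add: f0)
qed

lemma matrix_inv_eq:
  fixes A B :: "complex^'n^'n"
  assumes "A ** B = mat 1" "B ** A = mat 1"
  shows "matrix_inv A = B"
proof -
  have "A ** matrix_inv A = mat 1 \<and> matrix_inv A ** A = mat 1"
    unfolding matrix_inv_def by (rule someI[of _ B]) (use assms in simp)
  then have "matrix_inv A ** (A ** B) = B" by (simp add: matrix_mul_assoc)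
  then show ?thesis by (simp add: assms)
qed

text \<open>Conjugation by exp (t A) is identified through its differential equation: multiplying Y
  by exp (t A) on the right turns Y' = [A, Y] into an equation that \<open>exp_ode_unique\<close>
  solves.\<close>

lemma conj_flow:
  fixes A :: "complex^'n^'n"
  assumes "\<And>t. (Y has_vector_derivative bracket A (Y t)) (at t)"
  shows "mat_exp (t *\<^sub>R A) ** Y 0 ** mat_exp (- (t *\<^sub>R A)) = Y t"
proof -
  define a where "a = Endo A"
  define y where "y t = Endo (Y t)" for t
  have y': "(y has_vector_derivative a * y t - y t * a) (at t)" for t
    using has_vector_derivative_Endo[OF assms] by (simp add: y_def[abs_def] a_def bracket_def Endo_simps)
  have "((\<lambda>t. y t * exp (t *\<^sub>R a)) has_vector_derivative
      y t * (a * exp (t *\<^sub>R a)) + (a * y t - y t * a) * exp (t *\<^sub>R a)) (at t)" for t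
    by (intro has_vector_derivative_mult exp_scaleR_has_vector_derivative_left y')
  then have "((\<lambda>t. y t * exp (t *\<^sub>R a)) has_vector_derivative a * (y t * exp (t *\<^sub>R a))) (at t)" for t
    by (simp add: algebra_simps)
  from exp_ode_unique[OF this, of t] have "y t * exp (t *\<^sub>R a) = exp (t *\<^sub>R a) * y 0" by simp
  then have "exp (t *\<^sub>R a) * y 0 * exp (- (t *\<^sub>R a)) = y t * (exp (t *\<^sub>R a) * exp (- (t *\<^sub>R a)))"
    by (simp flip: mult.assoc)
  then show ?thesis
    unfolding Endo_eq_iff[symmetric]
    by (simp add: Endo_simps Endo_mat_exp a_def y_def exp_minus_inverse)
qed

lemma matrix_mul_cscale:
  fixes A B :: "complex^'n^'n"
  shows "A ** cscale c B = cscale c (A ** B)" "cscale c A ** B = cscale c (A ** B)"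
  by (simp_all add: matrix_matrix_mult_def cscale_def vec_eq_iff sum_distrib_left mult_ac)

lemma bracket_p_basis:
  assumes "x \<in> {1..<CARD('n)}" "y \<in> {1..<CARD('n)}" "a \<in> {1..<CARD('n)}"
  shows "bracket (A_mat x y) (p_basis a :: ('n::{finite,linorder}) cmat) =
    (if y = a then p_basis x else 0) - (if x = a then p_basis y else 0)"
proof -
  have "bracket (A_mat x y) (A_mat CARD('n) a) = (if y = a then A_mat CARD('n) x else 0) - (if x = a then A_mat CARD('n) y else (0 :: 'n cmat))"
  proof -
    have "A_mat z CARD('n) = - (A_mat CARD('n) z :: 'n cmat)" for z by (rule A_mat_swap)
    then show ?thesis
      using assms card_pos[where 'n = 'n] by (subst A_mat_bracket) auto
  qed
  moreover have "bracket (A_mat x y) (cscale \<i> Z) = cscale \<i> (bracket (A_mat x y) Z)" for Z :: "'n cmat"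
    by (simp add: bracket_def matrix_mul_cscale linear_diff[OF linear_cscale])
  ultimately show ?thesis
    by (simp add: p_basis_def linear_diff[OF linear_cscale] linear_0[OF linear_cscale])
qed

context K_representation
begin

definition shift_op :: "(complex^('d \<times> 'n \<times> 'n) \<Rightarrow> complex^'d) \<Rightarrow> nat \<Rightarrow> 'd endo" where
  "shift_op pr0 a = Endo (matrix (\<lambda>v. pr0 (tensor v (p_basis a))))"

lemma shift_op_ap:
  assumes "linear_on_sub tensor_p pr0" "a \<in> {1..<CARD('n)}"
  shows "shift_op pr0 a \<rhd> v = pr0 (tensor v (p_basis a))"
proof -
  have t: "tensor v (p_basis a :: 'n cmat) \<in> tensor_p" for v :: "complex^'d"
    by (rule tensor_in_tensor_p[OF p_basis_p_alg[OF assms(2)]])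
  have "Vector_Spaces.linear (*s) (*s) (\<lambda>v. pr0 (tensor v (p_basis a)))"
    unfolding Vector_Spaces.linear_iff
    using assms(1) t vec.vector_space_axioms by (auto simp: linear_on_sub_def tensor_arith)
  from matrix_works[OF this] show ?thesis by (simp add: shift_op_def ap_def)
qed

text \<open>Equivariance of pr0 under a single k: passing T k through the operator rotates its index
  by Ad k.\<close>

lemma shift_op_conj:
  assumes lin: "linear_on_sub tensor_p pr0" and equiv: "\<forall>k\<in>K_grp. \<forall>S\<in>tensor_p. pr0 (tensor_act \<tau> k S) = \<tau> k *v pr0 S"
    and abc: "a \<in> {1..<CARD('n)}" "b \<in> {1..<CARD('n)}" "c \<in> {1..<CARD('n)}" and k: "k \<in> K_grp"
    and Ad: "Ad k (p_basis a) = r *\<^sub>R p_basis b + s *\<^sub>R p_basis c"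
  shows "T k * shift_op pr0 a = (r *\<^sub>R shift_op pr0 b + s *\<^sub>R shift_op pr0 c) * T k"
proof (rule endo_eqI)
  fix v
  let ?w = "T k \<rhd> v"
  have t: "tensor u (p_basis a) \<in> (tensor_p :: (complex^('d \<times> 'n \<times> 'n)) set)" if "a \<in> {1..<CARD('n)}" for u :: "complex^'d" and a
    by (rule tensor_in_tensor_p[OF p_basis_p_alg[OF that]])
  have "(T k * shift_op pr0 a) \<rhd> v = pr0 (tensor_act \<tau> k (tensor v (p_basis a)))"
    using equiv k t[OF abc(1)] by (simp add: shift_op_ap[OF lin abc(1)]) (simp add: ap_def T_def)
  also have "\<dots> = pr0 (of_real r *s tensor ?w (p_basis b) + of_real s *s tensor ?w (p_basis c))"
    by (simp add: tensor_act_tensor Ad tensor_arith) (simp add: ap_def T_def)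
  also have "\<dots> = of_real r *s pr0 (tensor ?w (p_basis b)) + of_real s *s pr0 (tensor ?w (p_basis c))"
  proof -
    have "of_real r *s tensor ?w (p_basis b :: 'n cmat) \<in> tensor_p" "of_real s *s tensor ?w (p_basis c :: 'n cmat) \<in> tensor_p"
      by (intro vec.subspace_scale[OF subspace_tensor_p] t abc)+
    then show ?thesis
      using lin t[OF abc(2), of ?w] t[OF abc(3), of ?w] by (simp add: linear_on_sub_def)
  qed
  finally show "(T k * shift_op pr0 a) \<rhd> v = ((r *\<^sub>R shift_op pr0 b + s *\<^sub>R shift_op pr0 c) * T k) \<rhd> v"
    by (simp add: shift_op_ap[OF lin abc(2)] shift_op_ap[OF lin abc(3)] scaleR_vec_eq)
qed

lemma intertwiner_deriv:
  assumes "A \<in> k_real" "\<And>t. T (mat_exp (t *\<^sub>R A)) * B = C t * T (mat_exp (t *\<^sub>R A))"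
    "(C has_vector_derivative C') (at 0)" "C 0 = B"
  shows "dT A * B - B * dT A = C'"
proof -
  have "((\<lambda>t. T (mat_exp (t *\<^sub>R A)) * B) has_vector_derivative dT A * B) (at 0)"
    by (intro bounded_linear.has_vector_derivative[OF bounded_linear_mult_left] T_exp_deriv assms)
  moreover have "((\<lambda>t. C t * T (mat_exp (t *\<^sub>R A))) has_vector_derivative (C 0 * dT A + C' * T (mat_exp (0 *\<^sub>R A)))) (at 0)"
    by (intro has_vector_derivative_mult T_exp_deriv assms)
  ultimately have "dT A * B = C 0 * dT A + C' * T (mat_exp (0 *\<^sub>R A))"
    unfolding assms(2) by (rule vector_derivative_unique_at)
  then show ?thesis by (simp add: assms(4) T_1)
qed

text \<open>Along exp (t A_{x,y}) the vector i A_{n,a} rotates in the plane of x and y or stays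
  fixed. Differentiating the intertwining relation of \<open>shift_op_conj\<close> at t = 0 gives
  the bracket.\<close>

lemma shift_op_vector:
  assumes lin: "linear_on_sub tensor_p pr0" and equiv: "\<forall>k\<in>K_grp. \<forall>S\<in>tensor_p. pr0 (tensor_act \<tau> k S) = \<tau> k *v pr0 S"
  shows "so_ops.index_vector_op D {1..<CARD('n)} (shift_op pr0)"
  unfolding so_ops.index_vector_op_def[OF D_so_family]
proof (intro ballI)
  interpret so_ops D "{1..<CARD('n)}" by (rule D_so_family)
  fix x y a assume x: "x \<in> {1..<CARD('n)}" and y: "y \<in> {1..<CARD('n)}" and a: "a \<in> {1..<CARD('n)}"
  let ?A = "A_mat x y :: 'n cmat" and ?B = "shift_op pr0"
  have A: "?A \<in> k_real" by (rule A_mat_k_real[OF x y])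
  have K: "mat_exp (t *\<^sub>R ?A) \<in> K_grp" for t by (intro mat_exp_K k_real_scaleR A)
  have bl: "bracket Z (r *\<^sub>R P + s *\<^sub>R Q) = r *\<^sub>R bracket Z P + s *\<^sub>R bracket Z Q" for Z P Q :: "'n cmat" and r s
    unfolding bracket_def Endo_eq_iff[symmetric] by (simp add: Endo_simps algebra_simps)
  \<comment> \<open>The angular speed s is - 1 for a = x, 1 for a = y, and 0 when a is neither (with
    b = a).\<close>
  have rot: "D x y * ?B a - ?B a * D x y = s *\<^sub>R ?B b"
    if b: "b \<in> {1..<CARD('n)}" and s: "bracket ?A (p_basis a) = s *\<^sub>R p_basis b" "bracket ?A (p_basis b) = - s *\<^sub>R p_basis a" "s * s = \<bar>s\<bar>"
    for b and s :: real
  proof -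
    define Y where "Y t = cos (s * t) *\<^sub>R p_basis a + sin (s * t) *\<^sub>R (p_basis b :: 'n cmat)" for t
    have "(Y has_vector_derivative (- s * sin (s * t)) *\<^sub>R p_basis a + (s * cos (s * t)) *\<^sub>R p_basis b) (at t)" for t
      unfolding Y_def
      by (intro has_vector_derivative_add has_vector_derivative_scaleR[where g' = 0, simplified] has_vector_derivative_const)
        (auto intro!: derivative_eq_intros)
    moreover have "bracket ?A (Y t) = (- s * sin (s * t)) *\<^sub>R p_basis a + (s * cos (s * t)) *\<^sub>R p_basis b" for t
      unfolding Y_def bl s by (simp add: mult.commute)
    ultimately have "mat_exp (t *\<^sub>R ?A) ** Y 0 ** mat_exp (- (t *\<^sub>R ?A)) = Y t" for t
      by (intro conj_flow) simp
    moreover have "matrix_inv (mat_exp (t *\<^sub>R ?A)) = mat_exp (- (t *\<^sub>R ?A))" for t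
      by (rule matrix_inv_eq) (rule mat_exp_minus)+
    ultimately have Ad: "Ad (mat_exp (t *\<^sub>R ?A)) (p_basis a) = cos (s * t) *\<^sub>R p_basis a + sin (s * t) *\<^sub>R p_basis b" for t
      by (simp add: Ad_def Y_def)
    have "((\<lambda>t. cos (s * t) *\<^sub>R ?B a + sin (s * t) *\<^sub>R ?B b) has_vector_derivative
        (- s * sin (s * 0)) *\<^sub>R ?B a + (s * cos (s * 0)) *\<^sub>R ?B b) (at 0)"
      by (intro has_vector_derivative_add has_vector_derivative_scaleR[where g' = 0, simplified] has_vector_derivative_const)
        (auto intro!: derivative_eq_intros)
    then have "dT ?A * ?B a - ?B a * dT ?A = (- s * sin (s * 0)) *\<^sub>R ?B a + (s * cos (s * 0)) *\<^sub>R ?B b"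
      by (rule intertwiner_deriv[OF A shift_op_conj[OF lin equiv a a b K Ad]]) simp
    then show ?thesis by (simp add: D_def)
  qed
  consider "x = y" | "x \<noteq> y" "a = x" | "x \<noteq> y" "a = y" | "x \<noteq> a" "y \<noteq> a" by blast
  then show "D x y * ?B a - ?B a * D x y = (if y = a then ?B x else 0) - (if x = a then ?B y else 0)"
  proof cases
    case 1
    then show ?thesis using D_same x by simp
  next
    case 2
    then show ?thesis
      using rot[OF y, of "- 1"] by (simp add: bracket_p_basis[OF x y x] bracket_p_basis[OF x y y])
  next
    case 3
    then show ?thesis
      using rot[OF x, of 1] by (simp add: bracket_p_basis[OF x y x] bracket_p_basis[OF x y y])
  next
    case 4
    then show ?thesis
      using rot[OF a, of 0] by (simp add: bracket_p_basis[OF x y a])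
  qed
qed

end

section \<open>Coordinates in a basis and the final computation\<close>

lemma representation_bounded_linear:
  assumes "vec.independent B" "vec.span B = (UNIV :: (complex^'d) set)"
  shows "bounded_linear (\<lambda>v. vec.representation B v Q)"
proof -
  have "linear (\<lambda>v. vec.representation B v Q)"
    using vec.representation_add[OF assms(1)] vec.representation_scale[OF assms(1)] assms(2)
    by (intro linearI) (auto simp: scaleR_vec_eq scaleR_conv_of_real)
  then show ?thesis by (simp add: linear_conv_bounded_linear)
qed

lemma representation_unique:
  assumes "vec.independent B" "(v :: complex^'d) = (\<Sum>Q\<in>B. f Q *s Q)" "Q \<in> B"
  shows "vec.representation B v Q = f Q"
proof -
  have fin: "finite B" using vec.finiteI_independent[OF assms(1)] .
  have "vec.representation B v = (\<lambda>Q. if Q \<in> B then f Q else 0)"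
  proof (rule vec.representation_eqI[OF assms(1)])
    show "v \<in> vec.span B" unfolding assms(2) by (intro vec.span_sum vec.span_scale vec.span_base)
    show "finite {b. (if b \<in> B then f b else 0) \<noteq> 0}" using fin by (rule rev_finite_subset) (auto split: if_splits)
    have "(\<Sum>b | (if b \<in> B then f b else 0) \<noteq> 0. (if b \<in> B then f b else 0) *s b) = (\<Sum>b\<in>B. f b *s b)"
      using fin by (intro sum.mono_neutral_cong_left) (auto split: if_splits)
    then show "(\<Sum>b | (if b \<in> B then f b else 0) \<noteq> 0. (if b \<in> B then f b else 0) *s b) = v" using assms(2) by simp
  qed (auto split: if_splits)
  then show ?thesis using assms(3) by simp
qed

theorem proposition5p3:
  fixes m :: nat
    and \<tau> :: "('n::{finite,linorder}) cmat \<Rightarrow> ('d::finite) cmat"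
    and lam :: "nat \<Rightarrow> int"
    and GT :: "(complex^'d) set"
    and pr0 :: "complex^('d \<times> 'n \<times> 'n) \<Rightarrow> complex^'d"
  assumes "CARD('n) = 2 * m"
    and "irreducible_K_rep \<tau>"
    and "highest_weight \<tau> lam"
    and "GT_basis \<tau> GT"
    and "is_pr0 \<tau> pr0"
  shows "\<exists>d :: complex. \<forall>\<phi>\<in>C_infty \<tau>. \<forall>c :: complex^'d \<Rightarrow> 'n cmat \<Rightarrow> complex.
           (\<forall>g\<in>G_grp. \<phi> g = (\<Sum>Q\<in>GT. c Q g *s Q)) \<longrightarrow>
           (\<forall>g\<in>G_grp.
              let R = (\<Sum>Q\<in>GT.
                    (lreg (*) H_mat (c Q) g - of_nat m * c Q g + c Q g) *s varpi0 pr0 Q +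
                    (\<Sum>i=1..2*m-2. lreg (*) (X_mat i) (c Q) g *s
                       varpi0_comm \<tau> pr0 (A_mat (2*m-1) i) Q))
              in d *s lreg_env (*s) (PF m) \<phi> g = R \<and> R = P0 pr0 \<phi> g)"
proof -
  define M where "M = m - 1"
  let ?U = "{1..<CARD('n)}" and ?N = "2 * M + 1"
  have m: "m = Suc M" using assms(1) card_pos[where 'n = 'n] by (cases m) (auto simp: M_def)
  have card: "CARD('n) = 2 * M + 2" using assms(1) m by simp
  have U: "?U = {1..?N}" using card by auto
  interpret K_representation \<tau>
    using assms(2) by unfold_locales (simp add: irreducible_K_rep_def)
  obtain v where v: "v \<noteq> 0" "\<And>j. j \<in> {1..CARD('n) div 2 - 1} \<Longrightarrow> drep \<tau> (cartan j) *v v = of_int (lam j) *s v"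
    "\<And>X. pos_root_vector X \<Longrightarrow> drep \<tau> X *v v = 0"
    using assms(3) by (auto simp: highest_weight_def)
  interpret so_module D ?U M v lam
    unfolding M_def
    by (rule so_module_D[OF assms(1) _ v]) (use assms(2) in \<open>simp add: irreducible_K_rep_def\<close>)
  have lin: "linear_on_sub tensor_p pr0"
    and equiv: "\<forall>k\<in>K_grp. \<forall>S\<in>tensor_p. pr0 (tensor_act \<tau> k S) = \<tau> k *v pr0 S"
    using assms(5) by (auto simp: is_pr0_def)
  let ?B = "shift_op pr0"
  have B: "index_vector_op ?B" by (rule shift_op_vector[OF lin equiv])
  obtain d where d: "\<And>a. a \<in> ?U \<Longrightarrow> ?B a = cs d * pf_op a"
    using index_vector_op_pfaffian[OF B] by blast
  have N: "?N \<in> ?U" using card by simp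
  have comm: "?B ?N * D ?N i - D ?N i * ?B ?N = ?B i" if "i \<in> {1..2 * M}" for i
  proof -
    have "D ?N i * ?B ?N - ?B ?N * D ?N i = - ?B i"
      using B N that card unfolding index_vector_op_def by auto
    then show ?thesis by (simp add: algebra_simps)
  qed
  have casimir: "(\<Sum>i=1..2 * M. ?B i * D ?N i) = - (real M *\<^sub>R ?B ?N)"
  proof -
    have "real M *\<^sub>R ?B ?N = (\<Sum>x\<in>?U. ?B x * D x ?N)" by (rule index_vector_op_casimir[OF B N, symmetric])
    also have "\<dots> = (\<Sum>x=1..2 * M. ?B x * D x ?N) + ?B ?N * D ?N ?N" unfolding U by simp
    also have "(\<Sum>x=1..2 * M. ?B x * D x ?N) = (\<Sum>x=1..2 * M. - (?B x * D ?N x))"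
    proof (rule sum.cong[OF refl])
      fix x assume "x \<in> {1..2 * M}"
      then have "x \<in> ?U" using card by simp
      then show "?B x * D x ?N = - (?B x * D ?N x)" using D_skew[OF N] by simp
    qed
    also have "D ?N ?N = 0" by (rule D_same[OF N])
    finally show ?thesis by (simp add: sum_negf)
  qed
  \<comment> \<open>The factor (-1)^M i is the inverse of the scalar (-1)^M (- i) in
    \<open>lreg_PF\<close>.\<close>
  define d' where "d' = d * ((- 1) ^ M * \<i>)"
  have GT: "vec.independent GT" "vec.span GT = UNIV" using assms(4) by (auto simp: GT_basis_def)
  have finGT: "finite GT" by (rule vec.finiteI_independent[OF GT(1)])
  \<comment> \<open>Through this identity a sum over the basis becomes one operator applied to one
    vector.\<close>
  have expand: "(\<Sum>Q\<in>GT. vec.representation GT w Q *s (A \<rhd> Q)) = A \<rhd> w" for A w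
  proof -
    have "(\<Sum>Q\<in>GT. vec.representation GT w Q *s Q) = w"
      by (rule vec.sum_representation_eq) (use GT finGT in auto)
    then show ?thesis by (metis (no_types, lifting) ap_sum ap_scale sum.cong)
  qed
  have varpi: "varpi0 pr0 Q = ?B ?N \<rhd> Q" for Q
    using shift_op_ap[OF lin N] card by (simp add: varpi0_def H_mat_def p_basis_def)
  have varpi_comm: "varpi0_comm \<tau> pr0 (A_mat (2 * m - 1) i) Q = ?B i \<rhd> Q" if i: "i \<in> {1..2 * M}" for i Q
  proof -
    have "i \<in> ?U" using i card by simp
    then have "Endo (drep \<tau> (A_mat ?N i)) = D ?N i" unfolding D_def by (intro drep_k_real A_mat_k_real N)
    from arg_cong[OF this, of mat_of] have "drep \<tau> (A_mat ?N i) *v w = D ?N i \<rhd> w" for w by (simp add: ap_def)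
    then have "varpi0_comm \<tau> pr0 (A_mat (2 * m - 1) i) Q = (?B ?N * D ?N i - D ?N i * ?B ?N) \<rhd> Q"
      by (simp add: varpi0_comm_def varpi m)
    then show ?thesis unfolding comm[OF i] .
  qed
  have "let R = (\<Sum>Q\<in>GT.
                    (lreg (*) H_mat (c Q) g - of_nat m * c Q g + c Q g) *s varpi0 pr0 Q +
                    (\<Sum>i=1..2*m-2. lreg (*) (X_mat i) (c Q) g *s
                       varpi0_comm \<tau> pr0 (A_mat (2*m-1) i) Q))
        in d' *s lreg_env (*s) (PF m) \<phi> g = R \<and> R = P0 pr0 \<phi> g"
    if phi: "\<phi> \<in> C_infty \<tau>" and c: "\<And>g. g \<in> G_grp \<Longrightarrow> \<phi> g = (\<Sum>Q\<in>GT. c Q g *s Q)" and g: "g \<in> G_grp"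
    for \<phi> and c :: "complex^'d \<Rightarrow> 'n cmat \<Rightarrow> complex" and g
  proof -
    interpret equivariant_function \<tau> \<phi> by unfold_locales (rule phi)
    define p where "p a = dphi g (p_basis a)" for a
    have P: "p_basis a \<in> (g_real :: 'n cmat set)" if "a \<in> ?U" for a by (rule p_basis_g_real[OF that])
    have coord: "c Q h = vec.representation GT (\<phi> h) Q" if "Q \<in> GT" "h \<in> G_grp" for Q h
      by (rule representation_unique[OF GT(1) c[OF that(2)] that(1), symmetric])
    \<comment> \<open>c Q is a coordinate of \<phi> only on G; the curves that define L do not leave
      G, so derivatives agree.\<close>
    have lc: "lreg (*) W (c Q) g = vec.representation GT (dphi g W) Q" if "W \<in> g_real" "Q \<in> GT" for W Q
    proof -
      have "lreg (*) W (c Q) g = lreg_real W (c Q) g" by (rule lreg_real_form[OF that(1)]) simp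
      also have "\<dots> = lreg_real W (\<lambda>h. vec.representation GT (\<phi> h) Q) g"
        by (rule lreg_real_cong[OF coord[OF that(2)] that(1) g])
      also have "\<dots> = vec.representation GT (dphi g W) Q"
        by (rule lreg_real_linear_image[OF representation_bounded_linear[OF GT] g that(1)])
      finally show ?thesis .
    qed
    have H: "(H_mat :: 'n cmat) = p_basis ?N" using card by (simp add: H_mat_def p_basis_def)
    have X: "(X_mat i :: 'n cmat) = A_mat ?N i + p_basis i" for i using card by (simp add: X_mat_def p_basis_def)
    have XR: "X_mat i \<in> (g_real :: 'n cmat set)" "dphi g (X_mat i) = p i - D ?N i \<rhd> \<phi> g" if i: "i \<in> {1..2 * M}" for i
    proof -
      have iU: "i \<in> ?U" using i card by simp
      have A: "A_mat ?N i \<in> (k_real :: 'n cmat set)" by (rule A_mat_k_real[OF N iU])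
      show "X_mat i \<in> (g_real :: 'n cmat set)" unfolding X by (rule g_real_add[OF k_real_g_real[OF A] P[OF iU]])
      show "dphi g (X_mat i) = p i - D ?N i \<rhd> \<phi> g"
        unfolding X dphi_add[OF g k_real_g_real[OF A] P[OF iU]] dphi_k[OF g A] by (simp add: p_def D_def)
    qed
    define R where "R = (\<Sum>Q\<in>GT.
                    (lreg (*) H_mat (c Q) g - of_nat m * c Q g + c Q g) *s varpi0 pr0 Q +
                    (\<Sum>i=1..2*m-2. lreg (*) (X_mat i) (c Q) g *s
                       varpi0_comm \<tau> pr0 (A_mat (2*m-1) i) Q))"
    have mm: "2 * m - 2 = 2 * M" using m by simp
    have "R = (\<Sum>Q\<in>GT. (vec.representation GT (p ?N) Q *s (?B ?N \<rhd> Q) - of_nat M *s (vec.representation GT (\<phi> g) Q *s (?B ?N \<rhd> Q))) +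
        (\<Sum>i=1..2 * M. vec.representation GT (p i - D ?N i \<rhd> \<phi> g) Q *s (?B i \<rhd> Q)))"
      unfolding R_def
    proof (rule sum.cong[OF refl], rule arg_cong2[where f = "(+)"])
      fix Q assume Q: "Q \<in> GT"
      show "(lreg (*) H_mat (c Q) g - of_nat m * c Q g + c Q g) *s varpi0 pr0 Q =
          vec.representation GT (p ?N) Q *s (?B ?N \<rhd> Q) - of_nat M *s (vec.representation GT (\<phi> g) Q *s (?B ?N \<rhd> Q))"
        unfolding H lc[OF P[OF N] Q] coord[OF Q g] varpi m by (simp add: p_def vec_eq_iff algebra_simps)
      show "(\<Sum>i=1..2*m-2. lreg (*) (X_mat i) (c Q) g *s varpi0_comm \<tau> pr0 (A_mat (2*m-1) i) Q) =
          (\<Sum>i=1..2 * M. vec.representation GT (p i - D ?N i \<rhd> \<phi> g) Q *s (?B i \<rhd> Q))"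
        unfolding mm by (intro sum.cong refl) (simp only: varpi_comm lc[OF XR(1) Q] XR(2))
    qed
    also have "\<dots> = (\<Sum>Q\<in>GT. vec.representation GT (p ?N) Q *s (?B ?N \<rhd> Q)) -
        of_nat M *s (\<Sum>Q\<in>GT. vec.representation GT (\<phi> g) Q *s (?B ?N \<rhd> Q)) +
        (\<Sum>i=1..2 * M. \<Sum>Q\<in>GT. vec.representation GT (p i - D ?N i \<rhd> \<phi> g) Q *s (?B i \<rhd> Q))"
      by (simp only: sum.distrib sum_subtractf vec.scale_sum_right sum.swap[of _ GT "{1..2 * M}"])
    also have "\<dots> = ?B ?N \<rhd> p ?N - of_nat M *s (?B ?N \<rhd> \<phi> g) + (\<Sum>i=1..2 * M. ?B i \<rhd> (p i - D ?N i \<rhd> \<phi> g))"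
      by (simp only: expand)
    also have "(\<Sum>i=1..2 * M. ?B i \<rhd> (p i - D ?N i \<rhd> \<phi> g)) = (\<Sum>i=1..2 * M. ?B i \<rhd> p i) - (\<Sum>i=1..2 * M. ?B i * D ?N i) \<rhd> \<phi> g"
      by (simp add: ap_diff sum_subtractf sum_ap)
    \<comment> \<open>The parts A_{n-1,i} of the X_i contribute M times the value of \<varpi>_0 at
      \<phi> g, which cancels the correction - m + 1 at L(H).\<close>
    also have "(\<Sum>i=1..2 * M. ?B i * D ?N i) \<rhd> \<phi> g = - (of_nat M *s (?B ?N \<rhd> \<phi> g))"
      unfolding casimir by (simp add: scaleR_vec_eq)
    finally have R: "R = (\<Sum>a=1..?N. ?B a \<rhd> p a)" by simp
    have "P0 pr0 \<phi> g = pr0 (\<Sum>a=1..?N. tensor (p a) (p_basis a))"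
    proof -
      have "lreg (*s) (p_basis a) \<phi> g = p a" if "a \<in> ?U" for a
        using lreg_real_form[OF P[OF that], of "(*s)" \<phi> g] by (simp add: p_def dphi_def)
      then have "nabla \<phi> g = (\<Sum>a=1..?N. tensor (p a) (p_basis a))"
        unfolding nabla_def p_basis_def[symmetric] using card U by (intro sum.cong) auto
      then show ?thesis by (simp add: P0_def)
    qed
    also have "\<dots> = (\<Sum>a=1..?N. pr0 (tensor (p a) (p_basis a)))"
      by (rule linear_on_sub_sum[OF lin subspace_tensor_p], rule tensor_in_tensor_p, rule p_basis_p_alg) (simp only: U)
    also have "\<dots> = R"
      unfolding R using U by (intro sum.cong refl shift_op_ap[OF lin, symmetric]) auto
    finally have P0: "R = P0 pr0 \<phi> g" ..
    have "R = (\<Sum>a=1..?N. d *s (pf_op a \<rhd> p a))"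
      unfolding R using U d by (intro sum.cong refl) auto
    also have "\<dots> = d *s (\<Sum>a=1..?N. pf_op a \<rhd> p a)"
      by (simp only: vec.scale_sum_right)
    also have "\<dots> = d' *s (((- 1) ^ M * - \<i>) *s (\<Sum>a=1..?N. pf_op a \<rhd> p a))"
    proof -
      have "(- 1) ^ M * (- 1) ^ M = (1 :: complex)" by (simp flip: power_mult_distrib)
      then have "d' * ((- 1) ^ M * - \<i>) = d" by (simp add: d'_def mult_ac)
      then show ?thesis by (simp only: vec.scale_scale)
    qed
    also have "((- 1) ^ M * - \<i>) *s (\<Sum>a=1..?N. pf_op a \<rhd> p a) = lreg_env (*s) (PF m) \<phi> g"
      unfolding m lreg_PF[OF card g] pf_op_def by (simp only: U p_def)
    finally show ?thesis using P0 unfolding R_def[symmetric] Let_def by simp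
  qed
  then show ?thesis by blast
qed

end
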